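(* Let $k\ge 1$ and let $\mathfrak M$, $\Lambda$, $G$, $\mathfrak f$, $\mathfrak M'$, $\mathcal E$, $\mathfrak i$, $\mathfrak j$, $\delta\mathfrak f$, $\mathcal Y$, $\widetilde{\jmath}$, $\kappa$ be data satisfying all of the axioms (A1)--(A3), (B), (C), (D1)--(D4), (E1)--(E2), (F) listed in the context. Let $(x_0,\lambda_0)\in\mathfrak M'\times\Lambda$ be a point such that $\partial_1\mathfrak f(x_0,\lambda_0)=0$ (equivalently $\delta\mathfrak f(x_0,\lambda_0)=0_{x_0}$, the zero of $\mathcal E_{x_0}$). Denote by $L\colon T_{x_0}\mathfrak M\to\mathcal E_{x_0}$ the linear map $$L:=\pi_{\mathrm{ver}}\circ\partial_1(\delta\mathfrak f)(x_0,\lambda_0),$$ where $\pi_{\mathrm{ver}}\colon T_{0_{x_0}}\mathcal E\to\mathcal E_{x_0}$ is the canonical vertical projection at the zero section. Assume: (G1) $L$ is a Fredholm operator of index $0$; (G2) $\ker L=\mathrm{Im}\big(\mathrm d\beta_{x_0}(1)\big)$. Then there exist a neighborhood $V\subset\mathfrak M\times\Lambda$ of $(G\cdot x_0)\times\{\lambda_0\}$, invariant under the action of $G$ on the first factor, a neighborhood $\Lambda_0$ of $\lambda_0$ in $\Lambda$, and a map $\sigma\colon\Lambda_0\to\mathfrak M$ of class $\mathcal C^k$ with $\sigma(\lambda_0)=x_0$, such that for all $x\in\mathfrak M$ and $\lambda\in\Lambda_0$: one has $(x,\lambda)\in V$ and $\partial_1\mathfrak f(x,\lambda)=0$ if and only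 if $x\in G\cdot\sigma(\lambda)$.
   Context: Notation: $\partial_1$ is the derivative with respect to the first variable; $\mathfrak g$ is the Lie algebra of $G$; for $x\in\mathfrak M$, $\beta_x\colon G\to\mathfrak M$ is $\beta_x(g)=g\cdot x$; $\mathrm{Lin}$ denotes bounded linear maps (and the corresponding Banach bundle); a star denotes the (topological) dual space, dual bundle or adjoint map; injectivity of bundle morphisms is meant fiberwise; $\mathcal E_x$, $\mathcal Y_x$ denote fibers over $x$. Axioms. (A1) $\mathfrak M$ and $\Lambda$ are differentiable manifolds modeled on (possibly infinite-dimensional) Banach spaces. (A2) $G$ is a finite-dimensional Lie group (not necessarily compact) acting continuously on $\mathfrak M$ on the left by homeomorphisms. (A3) $\mathfrak f\colon\mathfrak M\times\Lambda\to\mathbb R$ is of class $\mathcal C^{k+1}$ and $\mathfrak f(g\cdot x,\lambda)=\mathfrak f(x,\lambda)$ for all $g\in G$, $x\in\mathfrak M$, $\lambda\in\Lambda$. (B) There is a dense subset $\mathfrak M'\subset\mathfrak M$ such that for all $x\in\mathfrak M'$ the map $\beta_x$ is differentiable at $1\in G$. (C) For all $\lambda\in\Lambda$ the set $\{x\in\mathfrak M:\partial_1\mathfrak f(x,\lambda)=0\}$ is $G$-invariant. (D1) $\mathcal E\to\mathfrak M$ is a $\mathcal C^k$ Banach vector bundle. (D2) There are $\mathcal C^k$ vector bundle morphisms $\mathfrak i\colon T\mathfrak M\to\mathcal E$ and $\mathfrak j\colon\mathcal E\to T\mathfrak M^*$, with $\mathfrak j$ injective. (D3) For all $x\in\mathfrak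 M$ the bilinear form $\langle u,v\rangle_x=\mathfrak j_x(\mathfrak i_x(u))v$ on $T_x\mathfrak M$ is a (not necessarily complete) positive definite inner product. (D4) There is a $\mathcal C^k$ map $\delta\mathfrak f\colon\mathfrak M\times\Lambda\to\mathcal E$ (with $\delta\mathfrak f(x,\lambda)\in\mathcal E_x$) such that $\mathfrak j\circ\delta\mathfrak f=\partial_1\mathfrak f$. (E1) There is a continuous left $G$-action by linear isomorphisms on the fibers of $\mathcal E$ compatible with the action on $\mathfrak M$: for each $g\in G$, $x\in\mathfrak M$ a linear isomorphism $\varphi_{g,x}\colon\mathcal E_x\to\mathcal E_{g\cdot x}$, depending continuously on $x$ and $g$, with $\varphi_{gh,x}=\varphi_{g,h\cdot x}\circ\varphi_{h,x}$ for all $g,h\in G$, $x\in\mathfrak M$. (E2) For all $\lambda\in\Lambda$ the map $\delta\mathfrak f(\cdot,\lambda)\colon\mathfrak M\to\mathcal E$ is $G$-equivariant. (F) There are a $\mathcal C^k$ Banach vector bundle $\mathcal Y\to\mathfrak M$ and $\mathcal C^k$ vector bundle morphisms $\widetilde{\jmath}\colon\mathcal E\to\mathcal Y^*$ and $\kappa\colon T\mathfrak M\to\mathcal Y$, with $\kappa$ injective, such that: (F1) $\kappa^*\circ\widetilde{\jmath}=\mathfrak j$; (F2) the map $\mathfrak M'\ni x\mapsto\kappa_x\circ\mathrm d\beta_x(1)\in\mathrm{Lin}(\mathfrak g,\mathcal Y_x)$ has a continuous extension to a section over $\mathfrak M$ of the vector bundle $\mathrm{Lin}(\mathfrak g,\mathcal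 Y)\to\mathfrak M$. *)

theory Defs
  imports "HOL-Analysis.Analysis" "HOL-Algebra.Group_Action"
begin

section \<open>Maps of class \<open>C\<^sup>k\<close> between normed spaces\<close>

definition bounded_multilinear ::
    "nat \<Rightarrow> ('a::real_normed_vector list \<Rightarrow> 'b::real_normed_vector) \<Rightarrow> bool" where
  "bounded_multilinear j T \<longleftrightarrow>
     (\<forall>vs i. length vs = j \<and> i < j \<longrightarrow> linear (\<lambda>v. T (vs[i := v]))) \<and>
     (\<exists>C. \<forall>vs. length vs = j \<longrightarrow> norm (T vs) \<le> C * prod_list (map norm vs))"

text \<open>The operator norm of the \<open>j\<close>-linear map \<open>T\<close> is at most \<open>c\<close> (for \<open>c \<ge> 0\<close>).\<close>

definition multilinear_norm_le ::
    "nat \<Rightarrow> ('a::real_normed_vector list \<Rightarrow> 'b::real_normed_vector) \<Rightarrow> real \<Rightarrow> bool" where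
  "multilinear_norm_le j T c \<longleftrightarrow>
     (\<forall>vs. length vs = j \<longrightarrow> norm (T vs) \<le> c * prod_list (map norm vs))"

text \<open>
  Class \<open>C\<^sup>k\<close> in the sense of Frechet, for open \<open>S\<close>.  The iterated derivatives of \<open>f\<close> take values
  in different types \<open>L('a, L('a, \<dots>))\<close>, so that recursion on \<open>k\<close> is not possible in HOL;
  instead the \<open>j\<close>-th derivative at \<open>x\<close> is the bounded \<open>j\<close>-linear map \<open>D j x\<close>, acting on lists of
  length \<open>j\<close>.  The third conjunct says that \<open>D j\<close> is Frechet differentiable with respect to the
  operator norm, with derivative \<open>h \<mapsto> D (j + 1) x (h, \<dots>)\<close>, the last one that \<open>D k\<close> is
  continuous with respect to the operator norm.
\<close>

definition C_on ::
    "nat \<Rightarrow> 'a::real_normed_vector set \<Rightarrow> ('a \<Rightarrow> 'b::real_normed_vector) \<Rightarrow> bool" where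
  "C_on k S f \<longleftrightarrow> (\<exists>D :: nat \<Rightarrow> 'a \<Rightarrow> 'a list \<Rightarrow> 'b.
     (\<forall>x\<in>S. D 0 x [] = f x) \<and>
     (\<forall>j\<le>k. \<forall>x\<in>S. bounded_multilinear j (D j x)) \<and>
     (\<forall>j<k. \<forall>x\<in>S. \<forall>\<epsilon>>0. \<exists>\<delta>>0. \<forall>y\<in>S. norm (y - x) < \<delta> \<longrightarrow>
        multilinear_norm_le j (\<lambda>vs. D j y vs - D j x vs - D (Suc j) x ((y - x) # vs))
          (\<epsilon> * norm (y - x))) \<and>
     (\<forall>x\<in>S. \<forall>\<epsilon>>0. \<exists>\<delta>>0. \<forall>y\<in>S. norm (y - x) < \<delta> \<longrightarrow>
        multilinear_norm_le k (\<lambda>vs. D k y vs - D k x vs) \<epsilon>))"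


section \<open>Manifolds modeled on a Banach space\<close>

text \<open>
  A chart is a pair of its domain and its coordinate map (whose values outside of the domain are
  irrelevant).  A manifold is given by an atlas; its underlying set and its topology are those
  determined by the atlas.  No separation or countability axiom is imposed.
\<close>

type_synonym ('m, 'e) chart = "'m set \<times> ('m \<Rightarrow> 'e)"
type_synonym ('m, 'e) atlas = "('m, 'e) chart set"

definition points :: "('m, 'e) atlas \<Rightarrow> 'm set" where
  "points A = (\<Union>c\<in>A. fst c)"

definition mtop :: "('m, 'e::topological_space) atlas \<Rightarrow> 'm topology" where
  "mtop A = topology_generated_by {fst c \<inter> snd c -` W | c W. c \<in> A \<and> open W}"

definition charts_at :: "('m, 'e) atlas \<Rightarrow> 'm \<Rightarrow> ('m, 'e) chart set" where
  "charts_at A p = {c \<in> A. p \<in> fst c}"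

definition coord_map ::
    "('m, 'e) chart \<Rightarrow> ('n, 'd) chart \<Rightarrow> ('m \<Rightarrow> 'n) \<Rightarrow> 'e \<Rightarrow> 'd" where
  "coord_map c d f = snd d \<circ> f \<circ> inv_into (fst c) (snd c)"

definition manifold :: "nat \<Rightarrow> ('m, 'e::banach) atlas \<Rightarrow> bool" where
  "manifold k A \<longleftrightarrow>
     (\<forall>c\<in>A. inj_on (snd c) (fst c) \<and> open (snd c ` fst c)) \<and>
     (\<forall>c\<in>A. \<forall>d\<in>A. open (snd c ` (fst c \<inter> fst d)) \<and>
        C_on k (snd c ` (fst c \<inter> fst d)) (coord_map c d (\<lambda>x. x)))"

definition space_atlas :: "('e, 'e) atlas" where
  "space_atlas = {(UNIV, \<lambda>x. x)}"

definition prod_chart :: "('m, 'e) chart \<Rightarrow> ('n, 'd) chart \<Rightarrow> ('m \<times> 'n, 'e \<times> 'd) chart" where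
  "prod_chart c d = (fst c \<times> fst d, map_prod (snd c) (snd d))"

definition prod_atlas :: "('m, 'e) atlas \<Rightarrow> ('n, 'd) atlas \<Rightarrow> ('m \<times> 'n, 'e \<times> 'd) atlas" where
  "prod_atlas A B = {prod_chart c d | c d. c \<in> A \<and> d \<in> B}"

definition C_map ::
    "nat \<Rightarrow> ('m, 'e::banach) atlas \<Rightarrow> 'm set \<Rightarrow> ('n, 'd::banach) atlas \<Rightarrow> ('m \<Rightarrow> 'n) \<Rightarrow> bool" where
  "C_map k A S B f \<longleftrightarrow>
     openin (mtop A) S \<and> continuous_map (subtopology (mtop A) S) (mtop B) f \<and>
     (\<forall>c\<in>A. \<forall>d\<in>B. C_on k (snd c ` (fst c \<inter> S \<inter> f -` fst d)) (coord_map c d f))"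


section \<open>Tangent spaces and derivatives\<close>

text \<open>
  A tangent vector at \<open>p\<close> is an equivalence class of pairs of a chart at \<open>p\<close> and a vector of the
  model space.  The class is encoded as the function that maps every chart at \<open>p\<close> to its
  representing vector (and everything else to 0).
\<close>

definition tangent :: "('m, 'e::banach) atlas \<Rightarrow> 'm \<Rightarrow> (('m, 'e) chart \<Rightarrow> 'e) set" where
  "tangent A p = {v. (\<forall>c. c \<notin> charts_at A p \<longrightarrow> v c = 0) \<and>
     (\<forall>c\<in>charts_at A p. \<forall>d\<in>charts_at A p.
        v d = frechet_derivative (coord_map c d (\<lambda>x. x)) (at (snd c p)) (v c))}"

definition mdifferentiable_at ::
    "('m, 'e::banach) atlas \<Rightarrow> ('n, 'd::banach) atlas \<Rightarrow> ('m \<Rightarrow> 'n) \<Rightarrow> 'm \<Rightarrow> bool" where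
  "mdifferentiable_at A B f p \<longleftrightarrow>
     topcontinuous_at (mtop A) (mtop B) f p \<and>
     (\<forall>c\<in>charts_at A p. \<forall>d\<in>charts_at B (f p). coord_map c d f differentiable (at (snd c p)))"

text \<open>The value does not depend on the chart chosen at \<open>p\<close>, by the chain rule.\<close>

definition mderiv ::
    "('m, 'e::banach) atlas \<Rightarrow> ('n, 'd::banach) atlas \<Rightarrow> ('m \<Rightarrow> 'n) \<Rightarrow> 'm \<Rightarrow>
     (('m, 'e) chart \<Rightarrow> 'e) \<Rightarrow> (('n, 'd) chart \<Rightarrow> 'd)" where
  "mderiv A B f p v = (\<lambda>d.
     if d \<in> charts_at B (f p)
     then let c = (SOME c. c \<in> charts_at A p)
          in frechet_derivative (coord_map c d f) (at (snd c p)) (v c)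
     else 0)"

text \<open>
  The first partial derivative of a function on \<open>M \<times> \<Lambda>\<close>, as a functional on the tangent space of
  \<open>M\<close>; the tangent spaces of the real line are identified with the real line.
\<close>

definition partial1 ::
    "('m, 'e::banach) atlas \<Rightarrow> ('m \<times> 'l \<Rightarrow> real) \<Rightarrow> 'm \<Rightarrow> 'l \<Rightarrow> (('m, 'e) chart \<Rightarrow> 'e) \<Rightarrow> real" where
  "partial1 M f x l =
     (\<lambda>v\<in>tangent M x. mderiv M space_atlas (\<lambda>y. f (y, l)) x v (UNIV, \<lambda>r. r))"

definition critical :: "('m, 'e::banach) atlas \<Rightarrow> ('m \<times> 'l \<Rightarrow> real) \<Rightarrow> 'm \<Rightarrow> 'l \<Rightarrow> bool" where
  "critical M f x l \<longleftrightarrow> (\<forall>v\<in>tangent M x. partial1 M f x l v = 0)"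


section \<open>Banach vector bundles\<close>

text \<open>
  A vector bundle over \<open>A\<close> is given by its fibers (which need not be disjoint: the total space
  consists of the pairs \<open>(x, v)\<close> with \<open>v\<close> in the fiber over \<open>x\<close>) and its local trivializations, a
  trivialization over \<open>U\<close> being a family of bijections of the fibers with a Banach space \<open>'f\<close>.  The
  transition maps are linear, so the fibers have a well-defined structure of topological vector
  space, for which the trivializations are linear homeomorphisms.
\<close>

type_synonym ('m, 'u, 'f) triv = "'m set \<times> ('m \<Rightarrow> 'u \<Rightarrow> 'f)"

record ('m, 'u, 'f) vbundle =
  fib :: "'m \<Rightarrow> 'u set"
  trivs :: "('m, 'u, 'f) triv set"

definition trivs_at :: "('m, 'u, 'f) vbundle \<Rightarrow> 'm \<Rightarrow> ('m, 'u, 'f) triv set" where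
  "trivs_at B x = {t \<in> trivs B. x \<in> fst t}"

text \<open>
  Morphisms over the identity, which in trivializations are maps of class \<open>C\<^sup>k\<close> into the Banach
  space of bounded linear operators.
\<close>

definition vb_morphism ::
    "nat \<Rightarrow> ('m, 'e::banach) atlas \<Rightarrow> ('m, 'u, 'f::banach) vbundle \<Rightarrow>
     ('m, 'w, 'd::banach) vbundle \<Rightarrow> ('m \<Rightarrow> 'u \<Rightarrow> 'w) \<Rightarrow> bool" where
  "vb_morphism k A B B' h \<longleftrightarrow>
     (\<forall>x\<in>points A. h x \<in> fib B x \<rightarrow> fib B' x) \<and>
     (\<forall>t\<in>trivs B. \<forall>t'\<in>trivs B'. \<exists>T :: 'm \<Rightarrow> 'f \<Rightarrow>\<^sub>L 'd.
        C_map k A (fst t \<inter> fst t') space_atlas T \<and>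
        (\<forall>x\<in>fst t \<inter> fst t'. \<forall>v\<in>fib B x. snd t' x (h x v) = blinfun_apply (T x) (snd t x v)))"

definition vector_bundle ::
    "nat \<Rightarrow> ('m, 'e::banach) atlas \<Rightarrow> ('m, 'u, 'f::banach) vbundle \<Rightarrow> bool" where
  "vector_bundle k A B \<longleftrightarrow>
     (\<Union>t\<in>trivs B. fst t) = points A \<and>
     (\<forall>t\<in>trivs B. openin (mtop A) (fst t) \<and> (\<forall>x\<in>fst t. bij_betw (snd t x) (fib B x) UNIV)) \<and>
     vb_morphism k A B B (\<lambda>x v. v)"

definition fib_zero :: "('m, 'u, 'f::banach) vbundle \<Rightarrow> 'm \<Rightarrow> 'u" where
  "fib_zero B x = (THE v. v \<in> fib B x \<and> (\<forall>t\<in>trivs_at B x. snd t x v = 0))"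

definition fib_rep ::
    "('m, 'u, 'f) vbundle \<Rightarrow> 'm \<Rightarrow> ('m, 'u, 'f) triv \<Rightarrow> 'n \<Rightarrow> ('n, 'w, 'd) triv \<Rightarrow>
     ('u \<Rightarrow> 'w) \<Rightarrow> 'f \<Rightarrow> 'd" where
  "fib_rep B x t y t' h = (\<lambda>a. snd t' y (h (inv_into (fib B x) (snd t x) a)))"

definition fib_bounded_linear ::
    "('m, 'u, 'f::banach) vbundle \<Rightarrow> 'm \<Rightarrow> ('n, 'w, 'd::banach) vbundle \<Rightarrow> 'n \<Rightarrow> ('u \<Rightarrow> 'w) \<Rightarrow> bool"
  where
  "fib_bounded_linear B x B' y h \<longleftrightarrow>
     h \<in> fib B x \<rightarrow> fib B' y \<and>
     (\<forall>t\<in>trivs_at B x. \<forall>t'\<in>trivs_at B' y. bounded_linear (fib_rep B x t y t' h))"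

definition tangent_bundle ::
    "('m, 'e::banach) atlas \<Rightarrow> ('m, ('m, 'e) chart \<Rightarrow> 'e, 'e) vbundle" where
  "tangent_bundle A = \<lparr>fib = tangent A, trivs = {(fst c, \<lambda>x v. v c) | c. c \<in> A}\<rparr>"

definition real_bundle :: "('m, 'e) atlas \<Rightarrow> ('m, real, real) vbundle" where
  "real_bundle A = \<lparr>fib = \<lambda>x. UNIV, trivs = {(points A, \<lambda>x r. r)}\<rparr>"

text \<open>The trivial bundle over \<open>A\<close> whose fiber is the fiber of \<open>B\<close> over \<open>p\<close>.\<close>

definition const_bundle ::
    "('m, 'e) atlas \<Rightarrow> ('n, 'u, 'f) vbundle \<Rightarrow> 'n \<Rightarrow> ('m, 'u, 'f) vbundle" where
  "const_bundle A B p =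
     \<lparr>fib = \<lambda>x. fib B p, trivs = {(points A, \<lambda>x. snd t p) | t. t \<in> trivs_at B p}\<rparr>"

definition Lin_bundle ::
    "('m, 'u, 'f::banach) vbundle \<Rightarrow> ('m, 'w, 'd::banach) vbundle \<Rightarrow>
     ('m, 'u \<Rightarrow> 'w, 'f \<Rightarrow>\<^sub>L 'd) vbundle" where
  "Lin_bundle B B' =
     \<lparr>fib = \<lambda>x. {h \<in> extensional (fib B x). fib_bounded_linear B x B' x h},
      trivs = {(fst t \<inter> fst t', \<lambda>x h. Blinfun (fib_rep B x t x t' h)) | t t'.
                 t \<in> trivs B \<and> t' \<in> trivs B'}\<rparr>"

definition dual_bundle ::
    "('m, 'e) atlas \<Rightarrow> ('m, 'u, 'f::banach) vbundle \<Rightarrow> ('m, 'u \<Rightarrow> real, 'f \<Rightarrow>\<^sub>L real) vbundle" where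
  "dual_bundle A B = Lin_bundle B (real_bundle A)"

definition fib_adjoint ::
    "('m, 'u, 'f) vbundle \<Rightarrow> ('m \<Rightarrow> 'u \<Rightarrow> 'w) \<Rightarrow> 'm \<Rightarrow> ('w \<Rightarrow> real) \<Rightarrow> 'u \<Rightarrow> real" where
  "fib_adjoint B h x \<alpha> = (\<lambda>v\<in>fib B x. \<alpha> (h x v))"

definition total_chart ::
    "('m, 'u, 'f) vbundle \<Rightarrow> ('m, 'e) chart \<Rightarrow> ('m, 'u, 'f) triv \<Rightarrow> ('m \<times> 'u, 'e \<times> 'f) chart" where
  "total_chart B c t =
     ({(x, v). x \<in> fst c \<inter> fst t \<and> v \<in> fib B x}, \<lambda>(x, v). (snd c x, snd t x v))"

definition total_atlas ::
    "('m, 'e) atlas \<Rightarrow> ('m, 'u, 'f) vbundle \<Rightarrow> ('m \<times> 'u, 'e \<times> 'f) atlas" where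
  "total_atlas A B = {total_chart B c t | c t. c \<in> A \<and> t \<in> trivs B}"

text \<open>
  The canonical projection of the tangent space of the total space at the zero vector over \<open>x\<close> onto
  the fiber over \<open>x\<close>, given by \<open>(a, b) \<mapsto> b\<close> in every bundle chart.  This is independent of the bundle
  chart since the derivative of \<open>(y, b) \<mapsto> (\<psi> y, T y b)\<close> at a point with \<open>b = 0\<close> maps \<open>(a, b)\<close> to
  \<open>(d\<psi> a, T y b)\<close>.
\<close>

definition vert_proj ::
    "('m, 'e::banach) atlas \<Rightarrow> ('m, 'u, 'f::banach) vbundle \<Rightarrow> 'm \<Rightarrow>
     (('m \<times> 'u, 'e \<times> 'f) chart \<Rightarrow> 'e \<times> 'f) \<Rightarrow> 'u" where
  "vert_proj A B x w = (THE v. v \<in> fib B x \<and>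
     (\<forall>c\<in>charts_at A x. \<forall>t\<in>trivs_at B x. snd t x v = snd (w (total_chart B c t))))"


section \<open>Fredholm operators\<close>

definition codim :: "'a::real_vector set \<Rightarrow> nat" where
  "codim S = (LEAST n. \<exists>C. finite C \<and> card C = n \<and> span (S \<union> C) = UNIV)"

definition fredholm :: "('a::banach \<Rightarrow> 'b::banach) \<Rightarrow> bool" where
  "fredholm T \<longleftrightarrow> bounded_linear T \<and> closed (range T) \<and>
     (\<exists>B. finite B \<and> span B = {v. T v = 0}) \<and>
     (\<exists>C. finite C \<and> span (range T \<union> C) = UNIV)"

definition fredholm_index :: "('a::banach \<Rightarrow> 'b::banach) \<Rightarrow> int" where
  "fredholm_index T = int (dim {v. T v = 0}) - int (codim (range T))"

definition fib_fredholm ::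
    "('m, 'u, 'f::banach) vbundle \<Rightarrow> 'm \<Rightarrow> ('n, 'w, 'd::banach) vbundle \<Rightarrow> 'n \<Rightarrow> int \<Rightarrow>
     ('u \<Rightarrow> 'w) \<Rightarrow> bool" where
  "fib_fredholm B x B' y n h \<longleftrightarrow> fib_bounded_linear B x B' y h \<and>
     (\<forall>t\<in>trivs_at B x. \<forall>t'\<in>trivs_at B' y.
        fredholm (fib_rep B x t y t' h) \<and> fredholm_index (fib_rep B x t y t' h) = n)"


section \<open>Lie groups and their actions\<close>

text \<open>
  The model space is any Banach space of finite dimension; the class \<open>euclidean_space\<close> would
  exclude dimension 0, that is, discrete groups.
\<close>

definition lie_group :: "('g, 'z) monoid_scheme \<Rightarrow> ('g, 'h::banach) atlas \<Rightarrow> bool" where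
  "lie_group G A \<longleftrightarrow>
     group G \<and> carrier G = points A \<and>
     (\<exists>B :: 'h set. finite B \<and> span B = UNIV) \<and>
     (\<forall>n. manifold n A \<and>
        C_map n (prod_atlas A A) (carrier G \<times> carrier G) A (\<lambda>(a, b). a \<otimes>\<^bsub>G\<^esub> b) \<and>
        C_map n A (carrier G) A (\<lambda>a. inv\<^bsub>G\<^esub> a))"

definition continuous_action ::
    "('g, 'z) monoid_scheme \<Rightarrow> ('g, 'h::banach) atlas \<Rightarrow> ('m, 'e::banach) atlas \<Rightarrow>
     ('g \<Rightarrow> 'm \<Rightarrow> 'm) \<Rightarrow> bool" where
  "continuous_action G A M act \<longleftrightarrow>
     group_action G (points M) act \<and>
     continuous_map (prod_topology (mtop A) (mtop M)) (mtop M) (\<lambda>(g, x). act g x)"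

text \<open>
  Continuity in \<open>g\<close> and \<open>x\<close> is that of the action on the total space of \<open>E\<close>, not continuity of
  \<open>\<phi>\<close> in the operator norm.
\<close>

definition continuous_bundle_action ::
    "('g, 'z) monoid_scheme \<Rightarrow> ('g, 'h::banach) atlas \<Rightarrow> ('m, 'e::banach) atlas \<Rightarrow>
     ('g \<Rightarrow> 'm \<Rightarrow> 'm) \<Rightarrow> ('m, 'u, 'f::banach) vbundle \<Rightarrow> ('g \<Rightarrow> 'm \<Rightarrow> 'u \<Rightarrow> 'u) \<Rightarrow> bool" where
  "continuous_bundle_action G A M act E \<phi> \<longleftrightarrow>
     (\<forall>g\<in>carrier G. \<forall>x\<in>points M.
        fib_bounded_linear E x E (act g x) (\<phi> g x) \<and>
        bij_betw (\<phi> g x) (fib E x) (fib E (act g x))) \<and>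
     (\<forall>g\<in>carrier G. \<forall>h\<in>carrier G. \<forall>x\<in>points M. \<forall>v\<in>fib E x.
        \<phi> (g \<otimes>\<^bsub>G\<^esub> h) x v = \<phi> g (act h x) (\<phi> h x v)) \<and>
     continuous_map (prod_topology (mtop A) (mtop (total_atlas M E))) (mtop (total_atlas M E))
       (\<lambda>(g, x, v). (act g x, \<phi> g x v))"

text \<open>The map \<open>d\<beta>\<^sub>x(1)\<close> from the Lie algebra of \<open>G\<close>, where \<open>\<beta>\<^sub>x(g) = g x\<close>.\<close>

definition orbit_deriv ::
    "('g, 'z) monoid_scheme \<Rightarrow> ('g, 'h::banach) atlas \<Rightarrow> ('m, 'e::banach) atlas \<Rightarrow>
     ('g \<Rightarrow> 'm \<Rightarrow> 'm) \<Rightarrow> 'm \<Rightarrow> (('g, 'h) chart \<Rightarrow> 'h) \<Rightarrow> (('m, 'e) chart \<Rightarrow> 'e)" where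
  "orbit_deriv G A M act x = mderiv A M (\<lambda>g. act g x) \<one>\<^bsub>G\<^esub>"

end

theory Submission
  imports Defs
begin

text \<open>
  In coordinates at \<open>x\<^sub>0\<close> the section \<open>\<delta>f\<close> becomes a \<open>C\<^sup>k\<close> map \<open>\<Phi>\<close> with \<open>\<Phi>(x\<^sub>0, \<lambda>\<^sub>0) = 0\<close> and
  \<open>\<partial>\<^sub>1\<Phi> = L\<close>.  At the points of \<open>M'\<close> invariance of \<open>f\<close> says that \<open>j'(\<Phi>)\<close> annihilates
  \<open>\<kappa> \<circ> d\<beta>(1)\<close>, and by density and (F2) it annihilates the continuous extension of this map
  everywhere.  Differentiating this relation at the zero \<open>(x\<^sub>0, \<lambda>\<^sub>0)\<close> of \<open>\<Phi>\<close>, where only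
  continuity of the other factors matters, shows that \<open>j(L h)\<close> vanishes on \<open>ker L\<close>; as the index
  is 0, the range of \<open>L\<close> is exactly the annihilator of \<open>ker L\<close>, with complement \<open>i(ker L)\<close>.
  Therefore the equations \<open>\<Phi> = 0\<close> modulo \<open>i(ker L)\<close> and \<open>x - x\<^sub>0 \<bottom> ker L\<close> together have a
  unique local solution \<open>\<sigma>(\<lambda>)\<close> by the implicit function theorem, and the annihilation
  relation, which is nondegenerate on \<open>i(ker L)\<close> near \<open>x\<^sub>0\<close>, upgrades it to \<open>\<Phi> = 0\<close>.

  Conversely every point near \<open>x\<^sub>0\<close> can be moved into the slice \<open>x - x\<^sub>0 \<bottom> ker L\<close> by the group.
  The action being merely continuous, this is not an implicit function argument: in a chart of \<open>G\<close>
  one applies Brouwer's fixed point theorem to \<open>h \<mapsto> h - Q (h x - x\<^sub>0)\<close>, which for \<open>x = x\<^sub>0\<close> is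
  \<open>o(h)\<close> by differentiability of the orbit map at \<open>1\<close> and depends continuously on \<open>x\<close>.
\<close>

section \<open>Calculus of maps of class \<open>C\<^sup>k\<close>\<close>

text \<open>The inner product of (D3) need not be complete and \<open>j\<close> need not be onto, so
  orthogonal complements of general closed subspaces cannot be relied on. All projections are finite
  sums over an orthonormal basis of \<open>ker L\<close>, which makes them bounded. This kernel
  plays two roles: by (G2) it is the tangent space of the orbit, and through \<open>i\<close> it
  complements the range of \<open>L\<close>. Hence the equations lost by projecting are as many as
  the relations that invariance supplies. The orbit map of a point outside \<open>M'\<close> need
  not be differentiable at 1; there the extension in (F2) takes the place of the orbit directions.
  The stabilizer of the base point may have positive dimension, so the orbit derivative need not be
  injective. The slice condition is therefore expressed by a map \<open>Q\<close> into group
  parameters such that \<open>Q\<close>, the orbit derivative and again \<open>Q\<close> compose to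
  \<open>Q\<close>, and Brouwer's theorem is applied on the range of \<open>Q\<close> only. No
  compactness of \<open>G\<close> enters in passing to the whole orbit: the invariant neighbourhood
  is the saturation of a small one, and (C) transports criticality.\<close>

text \<open>An element of \<open>mlm\<close> is a bounded sequence of bounded \<open>j\<close>-linear maps, one for every \<open>j\<close>.  This
  space contains \<open>'b\<close> (\<open>j = 0\<close>) and, by currying, the bounded linear maps from \<open>'a\<close> to itself.\<close>

typedef (overloaded) ('a::real_normed_vector, 'b::real_normed_vector) mlm =
  "{T :: 'a list \<Rightarrow> 'b. (\<forall>vs i. i < length vs \<longrightarrow> linear (\<lambda>v. T (vs[i := v]))) \<and>
     (\<exists>C. \<forall>vs. norm (T vs) \<le> C * prod_list (map norm vs))}"
  morphisms mapply Mlm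
proof
  show "(\<lambda>_. 0) \<in> {T :: 'a list \<Rightarrow> 'b. (\<forall>vs i. i < length vs \<longrightarrow> linear (\<lambda>v. T (vs[i := v]))) \<and>
     (\<exists>C. \<forall>vs. norm (T vs) \<le> C * prod_list (map norm vs))}"
    by (auto simp: linear_iff intro!: exI[of _ 0])
qed

setup_lifting type_definition_mlm

lemma mlm_eqI: "(\<And>vs. mapply S vs = mapply T vs) \<Longrightarrow> S = T"
  by (simp add: mapply_inject[symmetric] fun_eq_iff)

lemma prod_list_map_norm_nonneg [simp]: "0 \<le> prod_list (map norm vs)"
  by (induction vs) auto

lemma linear_mapply: "i < length vs \<Longrightarrow> linear (\<lambda>v. mapply T (vs[i := v]))"
  using mapply[of T] by blast

lemma mapply_bound: "\<exists>C\<ge>0. \<forall>vs. norm (mapply T vs) \<le> C * prod_list (map norm vs)"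
proof -
  obtain C where C: "\<And>vs. norm (mapply T vs) \<le> C * prod_list (map norm vs)"
    using mapply[of T] by blast
  have "norm (mapply T vs) \<le> max C 0 * prod_list (map norm vs)" for vs
    by (rule order_trans[OF C]) (simp add: mult_right_mono)
  then show ?thesis by (intro exI[of _ "max C 0"]) auto
qed

instantiation mlm :: (real_normed_vector, real_normed_vector) real_vector
begin

lift_definition zero_mlm :: "('a, 'b) mlm" is "\<lambda>_. 0"
  by (auto simp: linear_iff intro!: exI[of _ 0])

lift_definition plus_mlm :: "('a, 'b) mlm \<Rightarrow> ('a, 'b) mlm \<Rightarrow> ('a, 'b) mlm" is "\<lambda>S T vs. S vs + T vs"
proof safe
  fix S T :: "'a list \<Rightarrow> 'b" and C D
  assume "\<forall>vs. norm (S vs) \<le> C * prod_list (map norm vs)" "\<forall>vs. norm (T vs) \<le> D * prod_list (map norm vs)"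
  then show "\<exists>C. \<forall>vs. norm (S vs + T vs) \<le> C * prod_list (map norm vs)"
    by (intro exI[of _ "C + D"] allI order_trans[OF norm_triangle_ineq]) (simp add: distrib_right add_mono)
qed (auto intro!: linear_compose_add)

lift_definition uminus_mlm :: "('a, 'b) mlm \<Rightarrow> ('a, 'b) mlm" is "\<lambda>T vs. - T vs"
  by (auto intro!: linear_compose_neg)

lift_definition minus_mlm :: "('a, 'b) mlm \<Rightarrow> ('a, 'b) mlm \<Rightarrow> ('a, 'b) mlm" is "\<lambda>S T vs. S vs - T vs"
proof safe
  fix S T :: "'a list \<Rightarrow> 'b" and C D
  assume "\<forall>vs. norm (S vs) \<le> C * prod_list (map norm vs)" "\<forall>vs. norm (T vs) \<le> D * prod_list (map norm vs)"
  then show "\<exists>C. \<forall>vs. norm (S vs - T vs) \<le> C * prod_list (map norm vs)"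
    by (intro exI[of _ "C + D"] allI order_trans[OF norm_triangle_ineq4]) (simp add: distrib_right add_mono)
qed (auto intro!: linear_compose_sub)

lift_definition scaleR_mlm :: "real \<Rightarrow> ('a, 'b) mlm \<Rightarrow> ('a, 'b) mlm" is "\<lambda>r T vs. r *\<^sub>R T vs"
proof safe
  fix r and T :: "'a list \<Rightarrow> 'b" and C
  assume "\<forall>vs. norm (T vs) \<le> C * prod_list (map norm vs)"
  then show "\<exists>C. \<forall>vs. norm (r *\<^sub>R T vs) \<le> C * prod_list (map norm vs)"
    by (intro exI[of _ "\<bar>r\<bar> * C"]) (simp add: mult.assoc mult_left_mono)
qed (auto intro!: linear_compose_scale_right)

instance
  by standard (transfer; simp add: algebra_simps)+

end

lemmas mapply_simps [simp] = zero_mlm.rep_eq plus_mlm.rep_eq uminus_mlm.rep_eq minus_mlm.rep_eq scaleR_mlm.rep_eq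

instantiation mlm :: (real_normed_vector, real_normed_vector) real_normed_vector
begin

text \<open>One supremum over lists of all lengths, so that a bound on the norm is uniform in the
  degree. Quotients with vanishing product are 0 by the convention for division.\<close>

definition norm_mlm :: "('a, 'b) mlm \<Rightarrow> real" where
  "norm_mlm T = (SUP vs. norm (mapply T vs) / prod_list (map norm vs))"

definition dist_mlm :: "('a, 'b) mlm \<Rightarrow> ('a, 'b) mlm \<Rightarrow> real" where
  "dist_mlm S T = norm (S - T)"

definition sgn_mlm :: "('a, 'b) mlm \<Rightarrow> ('a, 'b) mlm" where
  "sgn_mlm T = T /\<^sub>R norm T"

definition [code del]:
  "(uniformity :: (('a, 'b) mlm \<times> ('a, 'b) mlm) filter) = (INF e\<in>{0 <..}. principal {(x, y). dist x y < e})"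

definition open_mlm :: "('a, 'b) mlm set \<Rightarrow> bool" where [code del]:
  "open_mlm S = (\<forall>x\<in>S. \<forall>\<^sub>F (x', y) in uniformity. x' = x \<longrightarrow> y \<in> S)"

lemma norm_mapply: "norm (mapply T vs) \<le> norm T * prod_list (map norm vs)"
proof -
  obtain C where C: "C \<ge> 0" "\<And>vs. norm (mapply T vs) \<le> C * prod_list (map norm vs)"
    using mapply_bound by blast
  have "norm (mapply T vs) / prod_list (map norm vs) \<le> C" for vs
    using C by (cases "prod_list (map norm vs) = 0") (auto simp: pos_divide_le_eq less_le)
  then have "bdd_above (range (\<lambda>vs. norm (mapply T vs) / prod_list (map norm vs)))"
    by (intro bdd_aboveI[of _ C]) auto
  then have *: "norm (mapply T vs) / prod_list (map norm vs) \<le> norm T"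
    unfolding norm_mlm_def by (rule cSUP_upper2) auto
  show ?thesis
  \<comment> \<open>A list with vanishing product contributes only 0 to the supremum; there the
    value of \<open>T\<close> is 0 because of the bound by \<open>C\<close>.\<close>
  proof (cases "prod_list (map norm vs) = 0")
    case True
    then show ?thesis using C(2)[of vs] by (simp add: True)
  next
    case False
    then have "prod_list (map norm vs) > 0" by (simp add: less_le)
    with * show ?thesis by (simp add: pos_divide_le_eq)
  qed
qed

lemma norm_mlm_le:
  assumes "0 \<le> C" "\<And>vs. norm (mapply T vs) \<le> C * prod_list (map norm vs)"
  shows "norm T \<le> C"
  unfolding norm_mlm_def
proof (rule cSUP_least)
  fix vs
  show "norm (mapply T vs) / prod_list (map norm vs) \<le> C"
    using assms by (cases "prod_list (map norm vs) = 0") (auto simp: pos_divide_le_eq less_le)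
qed simp

instance
proof
  fix S T :: "('a, 'b) mlm" and r :: real
  have nn: "0 \<le> norm T" for T :: "('a, 'b) mlm"
    using norm_mapply[of T "[]"] by (simp add: order_trans[OF norm_ge_zero])
  show "(norm T = 0) = (T = 0)"
  proof
    assume "norm T = 0"
    then show "T = 0" using norm_mapply[of T] by (intro mlm_eqI) auto
  next
    assume "T = 0"
    then have "norm T \<le> 0" by (intro norm_mlm_le) auto
    then show "norm T = 0" using nn[of T] by simp
  qed
  show "norm (S + T) \<le> norm S + norm T"
    by (rule norm_mlm_le)
      (auto simp: nn distrib_right intro!: norm_triangle_mono norm_mapply)
  have le: "norm (r *\<^sub>R T) \<le> \<bar>r\<bar> * norm T" for r and T :: "('a, 'b) mlm"
    by (rule norm_mlm_le) (auto simp: nn mult.assoc intro!: mult_left_mono norm_mapply)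
  show "norm (r *\<^sub>R T) = \<bar>r\<bar> * norm T"
  proof (cases "r = 0")
    case True
    then show ?thesis using le[of 0 T] nn[of "0 *\<^sub>R T"] by simp
  next
    case False
    have "norm T = norm (inverse r *\<^sub>R (r *\<^sub>R T))" using False by simp
    also have "\<dots> \<le> \<bar>inverse r\<bar> * norm (r *\<^sub>R T)" by (rule le)
    finally have "\<bar>r\<bar> * norm T \<le> norm (r *\<^sub>R T)" using False by (simp add: field_simps)
    then show ?thesis using le[of r T] by simp
  qed
qed (rule dist_mlm_def sgn_mlm_def uniformity_mlm_def open_mlm_def)+

end

section \<open>Currying, and the embedding of vectors in degree 0\<close>

lemma bounded_linear_mapply: "bounded_linear (\<lambda>T. mapply T vs)"
  by (rule bounded_linear_intro[of _ "prod_list (map norm vs)"]) (auto intro: norm_mapply)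

text \<open>The convention for derivatives: the derivative of an \<open>mlm\<close>-valued map is
  stored as an element \<open>T\<close> of the same space, which acts on an increment
  \<open>h\<close> as \<open>mcurry T h\<close>.\<close>

lift_definition mcurry :: "('a::real_normed_vector, 'b::real_normed_vector) mlm \<Rightarrow> 'a \<Rightarrow> ('a, 'b) mlm"
  is "\<lambda>T v vs. T (v # vs)"
proof safe
  fix T :: "'a list \<Rightarrow> 'b" and v and vs :: "'a list" and i
  assume "\<forall>vs i. i < length vs \<longrightarrow> linear (\<lambda>v. T (vs[i := v]))" "i < length vs"
  then have "linear (\<lambda>w. T ((v # vs)[Suc i := w]))" by (metis Suc_mono length_Cons)
  then show "linear (\<lambda>w. T (v # vs[i := w]))" by simp
next
  fix T :: "'a list \<Rightarrow> 'b" and v C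
  assume "\<forall>vs. norm (T vs) \<le> C * prod_list (map norm vs)"
  then have "norm (T (v # vs)) \<le> C * norm v * prod_list (map norm vs)" for vs
    by (metis list.simps(9) mult.assoc prod_list.Cons)
  then show "\<exists>C. \<forall>vs. norm (T (v # vs)) \<le> C * prod_list (map norm vs)" by blast
qed

lemma mapply_mcurry [simp]: "mapply (mcurry T v) vs = mapply T (v # vs)"
  by (simp add: mcurry.rep_eq)

lemma linear_mapply_Cons: "linear (\<lambda>v. mapply T (v # vs))"
  using linear_mapply[of 0 "0 # vs" T] by simp

lemma bounded_bilinear_mcurry: "bounded_bilinear mcurry"
proof
  fix T :: "('a, 'b) mlm" and v w :: 'a and r :: real
  show "mcurry T (v + w) = mcurry T v + mcurry T w"
    by (rule mlm_eqI) (simp add: linear_add[OF linear_mapply_Cons])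
  show "mcurry T (r *\<^sub>R v) = r *\<^sub>R mcurry T v"
    by (rule mlm_eqI) (simp add: linear_scale[OF linear_mapply_Cons])
  show "\<exists>K. \<forall>(T::('a, 'b) mlm) v. norm (mcurry T v) \<le> norm T * norm v * K"
    using norm_mapply[of _ "_ # _"]
    by (intro exI[of _ 1] allI norm_mlm_le) (auto simp: mult.assoc)
qed (rule mlm_eqI, simp)+

lemma norm_mcurry: "norm (mcurry T v) \<le> norm T * norm v"
  using norm_mapply[of T "v # _"] by (intro norm_mlm_le) (auto simp: mult.assoc)

text \<open>A right inverse of currying. The component of degree 0 is invisible to
  \<open>mcurry\<close>, so the value on the empty list is set to 0.\<close>

lift_definition muncurry :: "('a::real_normed_vector \<Rightarrow>\<^sub>L ('a, 'b::real_normed_vector) mlm) \<Rightarrow> ('a, 'b) mlm"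
  is "\<lambda>A vs. case vs of [] \<Rightarrow> 0 | v # vs \<Rightarrow> mapply (A v) vs"
proof safe
  fix A :: "'a \<Rightarrow> ('a, 'b) mlm" and vs :: "'a list" and i
  assume A: "bounded_linear A" and i: "i < length vs"
  then obtain w ws where [simp]: "vs = w # ws" by (cases vs) auto
  show "linear (\<lambda>v. case vs[i := v] of [] \<Rightarrow> 0 | v # vs \<Rightarrow> mapply (A v) vs)"
  proof (cases i)
    case 0
    have "linear (\<lambda>v. mapply (A v) ws)"
      using bounded_linear_compose[OF bounded_linear_mapply A] by (rule bounded_linear.linear)
    then show ?thesis using 0 by simp
  next
    case (Suc l)
    then show ?thesis using i linear_mapply[of l ws "A w"] by simp
  qed
next
  fix A :: "'a \<Rightarrow> ('a, 'b) mlm"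
  assume A: "bounded_linear A"
  have "norm (case vs of [] \<Rightarrow> 0 | v # vs \<Rightarrow> mapply (A v) vs) \<le> onorm A * prod_list (map norm vs)" for vs
  proof (cases vs)
    case (Cons v ws)
    have "norm (mapply (A v) ws) \<le> norm (A v) * prod_list (map norm ws)" by (rule norm_mapply)
    also have "\<dots> \<le> (onorm A * norm v) * prod_list (map norm ws)"
      by (intro mult_right_mono onorm A) auto
    finally show ?thesis by (simp add: Cons mult.assoc)
  qed (auto simp: onorm_pos_le A)
  then show "\<exists>C. \<forall>vs. norm (case vs of [] \<Rightarrow> 0 | v # vs \<Rightarrow> mapply (A v) vs) \<le> C * prod_list (map norm vs)"
    by blast
qed

lemma mapply_muncurry [simp]:
  "mapply (muncurry A) [] = 0" "mapply (muncurry A) (v # vs) = mapply (A v) vs"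
  by (simp_all add: muncurry.rep_eq)

lemma mcurry_muncurry [simp]: "mcurry (muncurry A) = blinfun_apply A"
  by (rule ext, rule mlm_eqI) simp

lemma bounded_linear_muncurry: "bounded_linear muncurry"
proof (rule bounded_linear_intro[of _ 1])
  fix A B :: "'a \<Rightarrow>\<^sub>L ('a, 'b) mlm" and r
  show "muncurry (A + B) = muncurry A + muncurry B"
    by (rule mlm_eqI, case_tac vs) (simp_all add: blinfun.add_left)
  show "muncurry (r *\<^sub>R A) = r *\<^sub>R muncurry A"
    by (rule mlm_eqI, case_tac vs) (simp_all add: blinfun.scaleR_left)
  show "norm (muncurry A) \<le> norm A * 1"
  proof (rule norm_mlm_le)
    fix vs
    show "norm (mapply (muncurry A) vs) \<le> norm A * 1 * prod_list (map norm vs)"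
    proof (cases vs)
      case (Cons v ws)
      have "norm (mapply (A v) ws) \<le> norm (A v) * prod_list (map norm ws)" by (rule norm_mapply)
      also have "\<dots> \<le> (norm A * norm v) * prod_list (map norm ws)"
        by (intro mult_right_mono norm_blinfun) auto
      finally show ?thesis by (simp add: Cons mult.assoc)
    qed auto
  qed auto
qed

text \<open>An ordinary map \<open>f\<close> enters the calculus as \<open>mconst\<close> composed
  with \<open>f\<close>; evaluation at the empty list recovers it.\<close>

lift_definition mconst :: "'b::real_normed_vector \<Rightarrow> ('a::real_normed_vector, 'b) mlm"
  is "\<lambda>c vs. if vs = [] then c else 0"
proof safe
  fix c :: 'b
  show "\<exists>C. \<forall>vs::'a list. norm (if vs = [] then c else 0) \<le> C * prod_list (map norm vs)"
    by (rule exI[of _ "norm c"]) auto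
qed (auto simp: linear_iff)

lemma mapply_mconst: "mapply (mconst c) vs = (if vs = [] then c else 0)"
  by (simp add: mconst.rep_eq)

lemma bounded_linear_mconst:
  "bounded_linear (mconst :: 'b \<Rightarrow> ('a::real_normed_vector, 'b::real_normed_vector) mlm)"
proof (rule bounded_linear_intro[of _ 1])
  fix c d :: 'b and r
  show "mconst (c + d) = (mconst c + mconst d :: ('a, 'b) mlm)"
    "mconst (r *\<^sub>R c) = (r *\<^sub>R mconst c :: ('a, 'b) mlm)"
    by (rule mlm_eqI; simp add: mapply_mconst)+
  show "norm (mconst c :: ('a, 'b) mlm) \<le> norm c * 1"
    by (rule norm_mlm_le) (simp_all add: mapply_mconst)
qed


text \<open>All iterated derivatives of \<open>F\<close> take their values in the same space, so that
  statements about \<open>C\<^sup>k\<close> maps can be proved by induction on \<open>k\<close>.\<close>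

primrec mC_on :: "nat \<Rightarrow> 'a::real_normed_vector set \<Rightarrow> ('a \<Rightarrow> ('a, 'b::real_normed_vector) mlm) \<Rightarrow> bool"
  where
  "mC_on 0 S F \<longleftrightarrow> continuous_on S F"
| "mC_on (Suc k) S F \<longleftrightarrow>
     (\<exists>F'. (\<forall>x\<in>S. (F has_derivative mcurry (F' x)) (at x within S)) \<and> mC_on k S F')"

section \<open>Closure properties: linear maps, sums, products and compositions\<close>

lemma mC_on_SucI:
  "(\<And>x. x \<in> S \<Longrightarrow> (F has_derivative mcurry (F' x)) (at x within S)) \<Longrightarrow> mC_on k S F' \<Longrightarrow> mC_on (Suc k) S F"
  by auto

lemma mC_on_continuous: "mC_on k S F \<Longrightarrow> continuous_on S F"
  by (cases k) (auto intro: has_derivative_continuous_on)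

lemma mC_on_Suc: "mC_on (Suc k) S F \<Longrightarrow> mC_on k S F"
proof (induction k arbitrary: F)
  case 0
  then show ?case using mC_on_continuous[of "Suc 0" S F] by simp
next
  case (Suc k)
  then show ?case by (metis mC_on.simps(2))
qed

lemma mC_on_subset: "mC_on k S F \<Longrightarrow> T \<subseteq> S \<Longrightarrow> mC_on k T F"
proof (induction k arbitrary: F)
  case 0
  then show ?case by (auto intro: continuous_on_subset)
next
  case (Suc k)
  then show ?case by simp (meson has_derivative_subset subsetD)
qed

lemma mC_on_cong:
  assumes "\<And>x. x \<in> S \<Longrightarrow> F x = G x" "mC_on k S F"
  shows "mC_on k S G"
proof (cases k)
  case 0
  then show ?thesis using assms continuous_on_cong[of S S F G] by auto
next
  case (Suc l)
  then obtain F' where F': "\<And>x. x \<in> S \<Longrightarrow> (F has_derivative mcurry (F' x)) (at x within S)" "mC_on l S F'"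
    using assms by auto
  have "(G has_derivative mcurry (F' x)) (at x within S)" if "x \<in> S" for x
    by (rule has_derivative_transform[OF that _ F'(1)[OF that]]) (simp add: assms)
  then show ?thesis using Suc F'(2) by auto
qed

text \<open>The derivative of \<open>L (F x)\<close> is the image of \<open>F' x\<close> under
  another bounded linear map, \<open>muncurry\<close> after \<open>B\<close>; hence the induction
  ranges over all \<open>L\<close>.\<close>

lemma mC_on_bounded_linear:
  assumes "bounded_linear L" "mC_on k S F"
  shows "mC_on k S (\<lambda>x. L (F x))"
  using assms
proof (induction k arbitrary: F L)
  case 0
  then show ?case by (auto intro: bounded_linear.continuous_on)
next
  case (Suc k)
  then obtain F' where F': "\<And>x. x \<in> S \<Longrightarrow> (F has_derivative mcurry (F' x)) (at x within S)" "mC_on k S F'"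
    by auto
  interpret L: bounded_linear L by fact
  define B where "B T = Blinfun (\<lambda>h. L (mcurry T h))" for T
  have bl: "bounded_linear (\<lambda>h. L (mcurry T h))" for T
    by (rule bounded_linear_compose[OF Suc.prems(1) bounded_bilinear.bounded_linear_right[OF bounded_bilinear_mcurry]])
  have B: "blinfun_apply (B T) h = L (mcurry T h)" for T h
    by (simp add: B_def bounded_linear_Blinfun_apply bl)
  obtain K where K: "K \<ge> 0" "\<And>x. norm (L x) \<le> norm x * K"
    using L.nonneg_bounded by blast
  have "bounded_linear B"
  proof (rule bounded_linear_intro)
    fix S T r
    show "B (S + T) = B S + B T"
      by (rule blinfun_eqI)
        (simp add: B L.add blinfun.add_left bounded_bilinear.add_left[OF bounded_bilinear_mcurry])
    show "B (r *\<^sub>R T) = r *\<^sub>R B T"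
      by (rule blinfun_eqI)
        (simp add: B L.scaleR blinfun.scaleR_left bounded_bilinear.scaleR_left[OF bounded_bilinear_mcurry])
    show "norm (B T) \<le> norm T * K"
    proof (rule norm_blinfun_bound)
      fix h
      have "norm (B T h) \<le> norm (mcurry T h) * K" unfolding B by (rule K)
      also have "\<dots> \<le> (norm T * norm h) * K" by (intro mult_right_mono norm_mcurry K)
      finally show "norm (B T h) \<le> norm T * K * norm h" by (simp add: mult_ac)
    qed (simp add: K)
  qed
  then have "mC_on k S (\<lambda>x. muncurry (B (F' x)))"
    by (intro Suc.IH[OF _ F'(2)] bounded_linear_compose[OF bounded_linear_muncurry])
  moreover have "((\<lambda>x. L (F x)) has_derivative mcurry (muncurry (B (F' x)))) (at x within S)" if "x \<in> S" for x
    using L.has_derivative[OF F'(1)[OF that]]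
    by (rule has_derivative_eq_rhs) (simp add: fun_eq_iff B)
  ultimately show ?case by (intro mC_on_SucI)
qed

lemma mC_on_const: "mC_on k S (\<lambda>x. c)"
proof (induction k arbitrary: c)
  case (Suc k)
  have "((\<lambda>x. c) has_derivative mcurry 0) (at x within S)" for x
    by (rule has_derivative_eq_rhs[OF has_derivative_const]) (auto intro!: ext mlm_eqI)
  with Suc show ?case by (auto intro!: exI[of _ "\<lambda>_. 0"] simp del: mC_on.simps(1))
qed simp

lemma mC_on_linear: "bounded_linear L \<Longrightarrow> mC_on k S L"
proof (cases k)
  case (Suc l)
  assume L: "bounded_linear L"
  have "mcurry (muncurry (Blinfun L)) = L"
    by (simp add: bounded_linear_Blinfun_apply L)
  then have "\<forall>x\<in>S. (L has_derivative mcurry (muncurry (Blinfun L))) (at x within S)"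
    by (simp only: bounded_linear_imp_has_derivative L simp_thms ball_triv)
  then show ?thesis
    unfolding Suc mC_on.simps by (intro exI[of _ "\<lambda>_. muncurry (Blinfun L)"]) (auto intro: mC_on_const)
qed (auto intro: linear_continuous_on)

lemma mC_on_add:
  assumes "mC_on k S F" "mC_on k S G"
  shows "mC_on k S (\<lambda>x. F x + G x)"
  using assms
proof (induction k arbitrary: F G)
  case (Suc k)
  obtain F' G' where F': "\<And>x. x \<in> S \<Longrightarrow> (F has_derivative mcurry (F' x)) (at x within S)" "mC_on k S F'"
    and G': "\<And>x. x \<in> S \<Longrightarrow> (G has_derivative mcurry (G' x)) (at x within S)" "mC_on k S G'"
    using Suc.prems by auto
  have "((\<lambda>x. F x + G x) has_derivative mcurry (F' x + G' x)) (at x within S)" if "x \<in> S" for x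
    using has_derivative_add[OF F'(1)[OF that] G'(1)[OF that]]
    by (rule has_derivative_eq_rhs) (simp add: fun_eq_iff bounded_bilinear.add_left[OF bounded_bilinear_mcurry])
  then show ?case using Suc.IH[OF F'(2) G'(2)] by (rule mC_on_SucI)
qed (auto intro: continuous_on_add)

lemma bounded_bilinear_compose_linear:
  assumes "bounded_linear L" "bounded_bilinear B"
  shows "bounded_bilinear (\<lambda>x y. L (B x y))"
proof -
  interpret L: bounded_linear L by fact
  interpret B: bounded_bilinear B by fact
  obtain K where K: "K \<ge> 0" "\<And>x. norm (L x) \<le> norm x * K" using L.nonneg_bounded by blast
  obtain K' where K': "K' \<ge> 0" "\<And>x y. norm (B x y) \<le> norm x * norm y * K'" using B.nonneg_bounded by blast
  show ?thesis
  proof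
    have "norm (L (B x y)) \<le> norm x * norm y * (K' * K)" for x y
      using order_trans[OF K(2) mult_right_mono[OF K'(2) K(1)]] by (simp add: mult.assoc)
    then show "\<exists>K. \<forall>x y. norm (L (B x y)) \<le> norm x * norm y * K" by blast
  qed (simp_all add: B.add_left B.add_right B.scaleR_left B.scaleR_right L.add L.scaleR)
qed

text \<open>Each summand of the product rule is bilinear in the stored derivative of one factor and
  the value of the other. One summand is packaged here as a bounded bilinear map; the flipped
  \<open>B\<close> gives the other.\<close>

lemma bounded_bilinear_muncurry_left:
  fixes B :: "('a::real_normed_vector, 'b::real_normed_vector) mlm \<Rightarrow> 'c::real_normed_vector \<Rightarrow>
    ('a, 'd::real_normed_vector) mlm"
  assumes "bounded_bilinear B"
  shows "bounded_bilinear (\<lambda>T c. muncurry (Blinfun (\<lambda>h. B (mcurry T h) c)))"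
    and "mcurry (muncurry (Blinfun (\<lambda>h. B (mcurry T h) c))) h = B (mcurry T h) c"
proof -
  interpret B: bounded_bilinear B by fact
  interpret m: bounded_bilinear mcurry by (rule bounded_bilinear_mcurry)
  have bl: "bounded_linear (\<lambda>h. B (mcurry T h) c)" for T :: "('a, 'b) mlm" and c
    by (rule bounded_linear_compose[OF B.bounded_linear_left m.bounded_linear_right])
  define Bh where "Bh T c = Blinfun (\<lambda>h. B (mcurry T h) c)" for T c
  have [simp]: "blinfun_apply (Bh T c) h = B (mcurry T h) c" for T c h
    by (simp add: Bh_def bounded_linear_Blinfun_apply bl)
  obtain K where K: "K \<ge> 0" "\<And>x y. norm (B x y) \<le> norm x * norm y * K"
    using B.nonneg_bounded by blast
  have "bounded_bilinear (\<lambda>T c. Bh T c)"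
  proof
    fix T T' :: "('a, 'b) mlm" and c c' r
    show "Bh (T + T') c = Bh T c + Bh T' c"
      by (rule blinfun_eqI) (simp add: m.add_left B.add_left blinfun.add_left)
    show "Bh T (c + c') = Bh T c + Bh T c'"
      by (rule blinfun_eqI) (simp add: B.add_right blinfun.add_left)
    show "Bh (r *\<^sub>R T) c = r *\<^sub>R Bh T c"
      by (rule blinfun_eqI) (simp add: m.scaleR_left B.scaleR_left blinfun.scaleR_left)
    show "Bh T (r *\<^sub>R c) = r *\<^sub>R Bh T c"
      by (rule blinfun_eqI) (simp add: B.scaleR_right blinfun.scaleR_left)
    show "\<exists>K. \<forall>T c. norm (Bh (T :: ('a, 'b) mlm) c) \<le> norm T * norm c * K"
    proof (intro exI[of _ K] allI norm_blinfun_bound)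
      fix T :: "('a, 'b) mlm" and c h
      have "norm (B (mcurry T h) c) \<le> norm (mcurry T h) * norm c * K" by (rule K)
      also have "\<dots> \<le> (norm T * norm h) * norm c * K" by (intro mult_right_mono norm_mcurry K norm_ge_zero)
      finally show "norm (Bh T c h) \<le> norm T * norm c * K * norm h" by (simp add: mult_ac)
    qed (simp add: K)
  qed
  then show "bounded_bilinear (\<lambda>T c. muncurry (Blinfun (\<lambda>h. B (mcurry T h) c)))"
    unfolding Bh_def by (rule bounded_bilinear_compose_linear[OF bounded_linear_muncurry])
  show "mcurry (muncurry (Blinfun (\<lambda>h. B (mcurry T h) c))) h = B (mcurry T h) c"
    by (simp flip: Bh_def)
qed

text \<open>By the product rule the derivative is a sum of two bilinear expressions, with new
  bilinear maps \<open>B1\<close> and \<open>B2\<close> in place of \<open>B\<close>; hence the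
  induction is over all \<open>B\<close> at once.\<close>

lemma mC_on_bilinear:
  fixes B :: "('a::real_normed_vector, 'b::real_normed_vector) mlm \<Rightarrow>
    ('a, 'c::real_normed_vector) mlm \<Rightarrow> ('a, 'd::real_normed_vector) mlm"
  assumes "bounded_bilinear B" "mC_on k S F" "mC_on k S G"
  shows "mC_on k S (\<lambda>x. B (F x) (G x))"
  using assms
proof (induction k arbitrary: F G B)
  case 0
  then show ?case by (auto intro: bounded_bilinear.continuous_on)
next
  case (Suc k)
  obtain F' G' where F': "\<And>x. x \<in> S \<Longrightarrow> (F has_derivative mcurry (F' x)) (at x within S)" "mC_on k S F'"
    and G': "\<And>x. x \<in> S \<Longrightarrow> (G has_derivative mcurry (G' x)) (at x within S)" "mC_on k S G'"
    using Suc.prems by auto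
  have flip: "bounded_bilinear (\<lambda>x y. B y x)" by (rule bounded_bilinear.flip) fact
  define B1 where "B1 T c = muncurry (Blinfun (\<lambda>h. B (mcurry T h) c))" for T c
  define B2 where "B2 T c = muncurry (Blinfun (\<lambda>h. B c (mcurry T h)))" for T c
  have B1: "bounded_bilinear B1" "\<And>T c h. mcurry (B1 T c) h = B (mcurry T h) c"
    unfolding B1_def using bounded_bilinear_muncurry_left[OF Suc.prems(1)] by auto
  have B2: "bounded_bilinear B2" "\<And>T c h. mcurry (B2 T c) h = B c (mcurry T h)"
    unfolding B2_def using bounded_bilinear_muncurry_left[OF flip] by auto
  have "mC_on k S (\<lambda>x. B1 (F' x) (G x) + B2 (G' x) (F x))"
    by (rule mC_on_add[OF Suc.IH[OF B1(1) F'(2) mC_on_Suc[OF Suc.prems(3)]]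
          Suc.IH[OF bounded_bilinear.flip[OF B2(1)] mC_on_Suc[OF Suc.prems(2)] G'(2)]])
  moreover have "((\<lambda>x. B (F x) (G x)) has_derivative mcurry (B1 (F' x) (G x) + B2 (G' x) (F x))) (at x within S)"
    if "x \<in> S" for x
  proof -
    have "mcurry (B1 (F' x) (G x) + B2 (G' x) (F x)) h = B (F x) (mcurry (G' x) h) + B (mcurry (F' x) h) (G x)" for h
      unfolding bounded_bilinear.add_left[OF bounded_bilinear_mcurry] B1(2) B2(2) by (rule add.commute)
    with bounded_bilinear.FDERIV[OF Suc.prems(1) F'(1)[OF that] G'(1)[OF that]] show ?thesis by presburger
  qed
  ultimately show ?case by (intro mC_on_SucI)
qed

text \<open>Pullback along \<open>p\<close>. On lists of length n it may multiply norms by the n-th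
  power of the norm of \<open>p\<close>, so a bound valid in all degrees at once asks for a
  contraction; for other \<open>p\<close> the definition is completed by 0.\<close>

lift_definition mpull :: "('a::real_normed_vector \<Rightarrow> 'b::real_normed_vector) \<Rightarrow> ('b, 'c::real_normed_vector) mlm \<Rightarrow> ('a, 'c) mlm"
  is "\<lambda>p T vs. if linear p \<and> (\<forall>v. norm (p v) \<le> norm v) then T (map p vs) else 0"
proof safe
  fix p :: "'a \<Rightarrow> 'b" and T :: "'b list \<Rightarrow> 'c" and vs :: "'a list" and i
  assume T: "\<forall>vs i. i < length vs \<longrightarrow> linear (\<lambda>v. T (vs[i := v]))" and i: "i < length vs"
  show "linear (\<lambda>v. if linear p \<and> (\<forall>v. norm (p v) \<le> norm v) then T (map p (vs[i := v])) else 0)"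
  proof (cases "linear p \<and> (\<forall>v. norm (p v) \<le> norm v)")
    case True
    have "linear (\<lambda>v. T ((map p vs)[i := p v]))"
      using linear_compose[of p "\<lambda>w. T ((map p vs)[i := w])"] T i True by (simp add: o_def)
    then show ?thesis by (simp add: True map_update)
  next
    case False
    show ?thesis by (simp only: False if_False) (simp add: linear_iff)
  qed
next
  fix p :: "'a \<Rightarrow> 'b" and T :: "'b list \<Rightarrow> 'c" and C
  assume "\<forall>vs. norm (T vs) \<le> C * prod_list (map norm vs)"
  then have C: "norm (T vs) \<le> max C 0 * prod_list (map norm vs)" for vs
    by (rule order_trans[OF spec[where x = vs]]) (simp add: mult_right_mono)
  have "prod_list (map norm (map p vs)) \<le> prod_list (map norm vs)" if "\<forall>v. norm (p v) \<le> norm v" for vs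
    using that by (induction vs) (auto intro!: mult_mono simp flip: map_map)
  then have "norm (if linear p \<and> (\<forall>v. norm (p v) \<le> norm v) then T (map p vs) else 0)
    \<le> max C 0 * prod_list (map norm vs)" for vs
    using order_trans[OF C[of "map p vs"] mult_left_mono] by auto
  then show "\<exists>C. \<forall>vs. norm (if linear p \<and> (\<forall>v. norm (p v) \<le> norm v) then T (map p vs) else 0)
    \<le> C * prod_list (map norm vs)" by blast
qed

lemma bounded_linear_mpull: "bounded_linear (mpull p :: ('b::real_normed_vector, 'c::real_normed_vector) mlm \<Rightarrow> ('a::real_normed_vector, 'c) mlm)"
proof (cases "linear p \<and> (\<forall>v. norm (p v) \<le> norm v)")
  case True
  have le: "prod_list (map norm (map p vs)) \<le> prod_list (map norm vs)" for vs
    using True by (induction vs) (auto intro!: mult_mono simp flip: map_map)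
  show ?thesis
  proof (rule bounded_linear_intro[of _ 1])
    fix T :: "('b, 'c) mlm"
    show "norm (mpull p T) \<le> norm T * 1"
    proof (rule norm_mlm_le)
      fix vs
      show "norm (mapply (mpull p T) vs) \<le> norm T * 1 * prod_list (map norm vs)"
        using order_trans[OF norm_mapply[of T "map p vs"] mult_left_mono[OF le, of "norm T" vs]] True
        by (simp add: mpull.rep_eq del: map_map)
    qed simp
  qed (rule mlm_eqI, simp add: mpull.rep_eq)+
next
  case False
  have "mapply (mpull p T) vs = mapply 0 vs" for T :: "('b, 'c) mlm" and vs
    unfolding mpull.rep_eq by (simp only: False if_False mapply_simps)
  then have "mpull p = (\<lambda>T :: ('b, 'c) mlm. 0)" by (intro ext mlm_eqI)
  then show ?thesis by simp
qed

text \<open>Meant for projections from and embeddings into products, which change the space on which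
  the multilinear maps live.\<close>

lemma mC_on_precompose:
  assumes p: "linear p" "\<And>v. norm (p v) \<le> norm v" and "mC_on k S F" "p ` T \<subseteq> S"
  shows "mC_on k T (\<lambda>x. mpull p (F (p x)))"
  using assms(3)
proof (induction k arbitrary: F)
  case 0
  have "bounded_linear p" using p by (intro bounded_linear_intro[of _ 1]) (auto simp: linear_iff)
  then have "continuous_on T p" by (rule linear_continuous_on)
  with 0 show ?case
    by (auto intro!: bounded_linear.continuous_on[OF bounded_linear_mpull] continuous_on_compose2[of S F] assms(4))
next
  case (Suc k)
  then obtain F' where F': "\<And>x. x \<in> S \<Longrightarrow> (F has_derivative mcurry (F' x)) (at x within S)" "mC_on k S F'"
    by auto
  have "bounded_linear p" using p by (intro bounded_linear_intro[of _ 1]) (auto simp: linear_iff)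
  have *: "mpull p (mcurry T (p h)) = mcurry (mpull p T) h" for T :: "('b, 'c) mlm" and h
    by (rule mlm_eqI) (simp add: mpull.rep_eq)
  have "((\<lambda>x. mpull p (F (p x))) has_derivative mcurry (mpull p (F' (p x)))) (at x within T)" if "x \<in> T" for x
  proof -
    have "(F has_derivative mcurry (F' (p x))) (at (p x) within p ` T)"
      using F'(1)[of "p x"] that assms(4) by (meson has_derivative_subset image_subset_iff)
    from has_derivative_in_compose[OF bounded_linear_imp_has_derivative[OF \<open>bounded_linear p\<close>] this]
    have "((\<lambda>x. F (p x)) has_derivative (\<lambda>h. mcurry (F' (p x)) (p h))) (at x within T)" .
    from bounded_linear.has_derivative[OF bounded_linear_mpull this]
    show ?thesis by (rule has_derivative_eq_rhs) (simp add: fun_eq_iff *)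
  qed
  then show ?case using Suc.IH[OF F'(2)] by (rule mC_on_SucI)
qed

lemma linear_mapply_singleton: "bounded_linear (\<lambda>h. mapply T [h])"
  using bounded_linear_compose[OF bounded_linear_mapply[of "[]"]
      bounded_bilinear.bounded_linear_right[OF bounded_bilinear_mcurry, of T]] by simp

text \<open>The chain rule in stored form: if \<open>T\<close> is the derivative of \<open>F\<close>
  at \<open>g x\<close> and \<open>U\<close> that of \<open>mconst\<close> after \<open>g\<close> at
  \<open>x\<close>, this is the derivative of \<open>F\<close> after \<open>g\<close>. Only the
  degree 1 part of \<open>U\<close> enters, since \<open>g\<close> sits in degree 0.\<close>

definition mcompose :: "('b::real_normed_vector, 'c::real_normed_vector) mlm \<Rightarrow> ('b, 'b) mlm \<Rightarrow> ('b, 'c) mlm" where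
  "mcompose T U = muncurry (Blinfun (\<lambda>h. mcurry T (mapply U [h])))"

lemma mcurry_mcompose: "mcurry (mcompose T U) h = mcurry T (mapply U [h])"
  unfolding mcompose_def
  by (simp add: bounded_linear_Blinfun_apply bounded_linear_compose[OF
        bounded_bilinear.bounded_linear_right[OF bounded_bilinear_mcurry] linear_mapply_singleton])

lemma mapply_mcompose: "mapply (mcompose T U) [] = 0" "mapply (mcompose T U) (v # vs) = mapply T (mapply U [v] # vs)"
  using arg_cong[OF mcurry_mcompose[of T U v], of "\<lambda>T. mapply T vs"] by (simp_all add: mcompose_def)

lemma bounded_bilinear_mcompose: "bounded_bilinear mcompose"
proof
  fix T T' :: "('a, 'b) mlm" and U U' :: "('a, 'a) mlm" and r
  show "mcompose (T + T') U = mcompose T U + mcompose T' U"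
    by (rule mlm_eqI, case_tac vs) (simp_all add: mapply_mcompose)
  show "mcompose T (U + U') = mcompose T U + mcompose T U'"
    by (rule mlm_eqI, case_tac vs) (simp_all add: mapply_mcompose linear_add[OF linear_mapply_Cons])
  show "mcompose (r *\<^sub>R T) U = r *\<^sub>R mcompose T U"
    by (rule mlm_eqI, case_tac vs) (simp_all add: mapply_mcompose)
  show "mcompose T (r *\<^sub>R U) = r *\<^sub>R mcompose T U"
    by (rule mlm_eqI, case_tac vs) (simp_all add: mapply_mcompose linear_scale[OF linear_mapply_Cons])
  show "\<exists>K. \<forall>(T :: ('a, 'b) mlm) U. norm (mcompose T U) \<le> norm T * norm U * K"
  proof (intro exI[of _ 1] allI norm_mlm_le)
    fix T :: "('a, 'b) mlm" and U vs
    show "norm (mapply (mcompose T U) vs) \<le> norm T * norm U * 1 * prod_list (map norm vs)"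
    proof (cases vs)
      case (Cons v ws)
      have "norm (mapply T (mapply U [v] # ws)) \<le> norm T * (norm (mapply U [v]) * prod_list (map norm ws))"
        using norm_mapply[of T "mapply U [v] # ws"] by simp
      also have "\<dots> \<le> norm T * ((norm U * norm v) * prod_list (map norm ws))"
        using norm_mapply[of U "[v]"] by (intro mult_left_mono mult_right_mono) auto
      finally show ?thesis by (simp add: Cons mapply_mcompose mult_ac)
    qed (simp add: mapply_mcompose)
  qed simp
qed

lemma has_derivative_mconst:
  "((\<lambda>x. mconst (f x)) has_derivative D) (at x within S) \<Longrightarrow> (f has_derivative (\<lambda>h. mapply (D h) [])) (at x within S)"
  by (drule bounded_linear.has_derivative[OF bounded_linear_mapply[of "[]"]]) (simp add: mapply_mconst)

lemma continuous_on_mconst: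
  "continuous_on S (\<lambda>x. mconst (f x)) \<Longrightarrow> continuous_on S f"
  by (drule bounded_linear.continuous_on[OF bounded_linear_mapply[of "[]"]]) (simp add: mapply_mconst)

text \<open>Since \<open>g\<close> maps the space to itself, \<open>F'\<close> after
  \<open>g\<close> is a composition of the same kind and falls under the induction hypothesis;
  bilinearity of \<open>mcompose\<close> does the rest.\<close>

lemma mC_on_compose:
  fixes F :: "'a::real_normed_vector \<Rightarrow> ('a, 'b::real_normed_vector) mlm"
  assumes "mC_on k S (\<lambda>x. mconst (g x))" "mC_on k T F" "g ` S \<subseteq> T"
  shows "mC_on k S (\<lambda>x. F (g x))"
  using assms(1,2)
proof (induction k arbitrary: F)
  case 0
  then show ?case using assms(3) by (auto intro: continuous_on_compose2 dest!: continuous_on_mconst)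
next
  case (Suc k)
  then obtain F' where F': "\<And>x. x \<in> T \<Longrightarrow> (F has_derivative mcurry (F' x)) (at x within T)" "mC_on k T F'"
    by auto
  obtain G' where G': "\<And>x. x \<in> S \<Longrightarrow> ((\<lambda>x. mconst (g x)) has_derivative mcurry (G' x)) (at x within S)" "mC_on k S G'"
    using Suc.prems by auto
  have "mC_on k S (\<lambda>x. mcompose (F' (g x)) (G' x))"
    by (rule mC_on_bilinear[OF bounded_bilinear_mcompose Suc.IH[OF mC_on_Suc[OF Suc.prems(1)] F'(2)] G'(2)])
  moreover have "((\<lambda>x. F (g x)) has_derivative mcurry (mcompose (F' (g x)) (G' x))) (at x within S)" if "x \<in> S" for x
  proof -
    have "(F has_derivative mcurry (F' (g x))) (at (g x) within g ` S)"
      using F'(1)[of "g x"] that assms(3) by (meson has_derivative_subset image_subset_iff)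
    from has_derivative_in_compose[OF has_derivative_mconst[OF G'(1)[OF that]] this]
    show ?thesis by (rule has_derivative_eq_rhs) (simp add: fun_eq_iff mcurry_mcompose)
  qed
  ultimately show ?case by (intro mC_on_SucI)
qed

lemma mC_on_le: "mC_on k S F \<Longrightarrow> j \<le> k \<Longrightarrow> mC_on j S F"
proof (induction k)
  case (Suc k)
  then show ?case by (cases "j = Suc k") (auto dest: mC_on_Suc simp del: mC_on.simps)
qed simp

section \<open>Comparison with the definition by a tower of derivatives\<close>

lemma mC_on_iff:
  "mC_on k S F \<longleftrightarrow> (\<exists>G. (\<forall>x\<in>S. G 0 x = F x) \<and>
     (\<forall>j<k. \<forall>x\<in>S. (G j has_derivative mcurry (G (Suc j) x)) (at x within S)) \<and> continuous_on S (G k))"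
proof (induction k arbitrary: F)
  case 0
  show ?case
  proof
    assume "mC_on 0 S F"
    then show "\<exists>G. (\<forall>x\<in>S. G 0 x = F x) \<and>
       (\<forall>j<0. \<forall>x\<in>S. (G j has_derivative mcurry (G (Suc j) x)) (at x within S)) \<and> continuous_on S (G 0)"
      by (intro exI[of _ "\<lambda>_. F"]) simp
  next
    assume "\<exists>G. (\<forall>x\<in>S. G 0 x = F x) \<and>
       (\<forall>j<0. \<forall>x\<in>S. (G j has_derivative mcurry (G (Suc j) x)) (at x within S)) \<and> continuous_on S (G 0)"
    then obtain G where "\<forall>x\<in>S. G 0 x = F x" "continuous_on S (G (0::nat))" by (elim exE conjE) (rule that)
    then show "mC_on 0 S F" by (auto intro: continuous_on_eq)
  qed
next
  case (Suc k)
  show ?case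
  proof
    assume "mC_on (Suc k) S F"
    then obtain F' where F': "\<And>x. x \<in> S \<Longrightarrow> (F has_derivative mcurry (F' x)) (at x within S)" "mC_on k S F'"
      by auto
    then obtain G where G: "\<And>x. x \<in> S \<Longrightarrow> G 0 x = F' x"
      "\<And>j x. j < k \<Longrightarrow> x \<in> S \<Longrightarrow> (G j has_derivative mcurry (G (Suc j) x)) (at x within S)"
      "continuous_on S (G k)"
      unfolding Suc.IH by (elim exE conjE) (rule that; simp)
    \<comment> \<open>The tower of \<open>F\<close> is that of \<open>F'\<close> shifted by one,
      with \<open>F\<close> put in front.\<close>
    have "(case_nat F G j has_derivative mcurry (case_nat F G (Suc j) x)) (at x within S)"
      if "j < Suc k" "x \<in> S" for j x
      using that F'(1)[of x] G(1)[of x] G(2)[of "j - 1" x] by (cases j) auto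
    then show "\<exists>G. (\<forall>x\<in>S. G 0 x = F x) \<and>
       (\<forall>j<Suc k. \<forall>x\<in>S. (G j has_derivative mcurry (G (Suc j) x)) (at x within S)) \<and> continuous_on S (G (Suc k))"
      using G(3) by (intro exI[of _ "case_nat F G"]) simp
  next
    assume "\<exists>G. (\<forall>x\<in>S. G 0 x = F x) \<and>
       (\<forall>j<Suc k. \<forall>x\<in>S. (G j has_derivative mcurry (G (Suc j) x)) (at x within S)) \<and> continuous_on S (G (Suc k))"
    then obtain G where G: "\<And>x. x \<in> S \<Longrightarrow> G 0 x = F x"
      "\<And>j x. j < Suc k \<Longrightarrow> x \<in> S \<Longrightarrow> (G j has_derivative mcurry (G (Suc j) x)) (at x within S)"
      "continuous_on S (G (Suc k))"
      by (elim exE conjE) (rule that; simp)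
    show "mC_on (Suc k) S F"
    proof (rule mC_on_SucI)
      show "(F has_derivative mcurry (G 1 x)) (at x within S)" if "x \<in> S" for x
        by (rule has_derivative_transform[OF that]) (use G(1) G(2)[of 0 x] that in auto)
      show "mC_on k S (G 1)"
        unfolding Suc.IH using G(2,3) by (intro exI[of _ "\<lambda>j. G (Suc j)"]) simp
    qed
  qed
qed

definition mdeg :: "nat \<Rightarrow> ('a::real_normed_vector list \<Rightarrow> 'b::real_normed_vector) \<Rightarrow> ('a, 'b) mlm" where
  "mdeg j T = Mlm (\<lambda>vs. if length vs = j then T vs else 0)"

lemma mapply_mdeg:
  assumes "bounded_multilinear j T"
  shows "mapply (mdeg j T) vs = (if length vs = j then T vs else 0)"
proof -
  obtain C where C: "\<And>vs. length vs = j \<Longrightarrow> norm (T vs) \<le> C * prod_list (map norm vs)"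
    using assms unfolding bounded_multilinear_def by blast
  have "norm (if length vs = j then T vs else 0) \<le> max C 0 * prod_list (map norm vs)" for vs
    using order_trans[OF C[of vs] mult_right_mono[of C "max C 0" "prod_list (map norm vs)"]] by simp
  moreover have "linear (\<lambda>v. if length (vs[i := v]) = j then T (vs[i := v]) else 0)" if "i < length vs" for vs i
    using assms that unfolding bounded_multilinear_def by (cases "length vs = j") (auto simp: linear_iff)
  ultimately show ?thesis
    unfolding mdeg_def by (subst Mlm_inverse) blast+
qed

text \<open>Forwards, \<open>D j x\<close> is placed in degree \<open>j\<close> and extended by 0.
  Backwards, a tower in \<open>mlm\<close> may have components of every degree, but
  \<open>C_on\<close> evaluates \<open>D j x\<close> only at lists of length \<open>j\<close>, so
  \<open>mapply\<close> of the tower can be taken as it is.\<close>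

theorem C_on_iff_mC_on: "C_on k S f \<longleftrightarrow> mC_on k S (\<lambda>x. mconst (f x))"
proof
  assume "C_on k S f"
  then obtain D where D': "\<forall>x\<in>S. D 0 x [] = f x" "\<forall>j\<le>k. \<forall>x\<in>S. bounded_multilinear j (D j x)"
    and der': "\<forall>j<k. \<forall>x\<in>S. \<forall>\<epsilon>>0. \<exists>\<delta>>0. \<forall>y\<in>S. norm (y - x) < \<delta> \<longrightarrow>
        multilinear_norm_le j (\<lambda>vs. D j y vs - D j x vs - D (Suc j) x ((y - x) # vs)) (\<epsilon> * norm (y - x))"
    and cont': "\<forall>x\<in>S. \<forall>\<epsilon>>0. \<exists>\<delta>>0. \<forall>y\<in>S. norm (y - x) < \<delta> \<longrightarrow>
        multilinear_norm_le k (\<lambda>vs. D k y vs - D k x vs) \<epsilon>"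
    unfolding C_on_def by (elim exE conjE) (rule that)
  note D = D'(1)[THEN bspec] D'(2)[rule_format]
  note der = der'[THEN spec, THEN mp, THEN bspec, THEN spec, THEN mp]
  note cont = cont'[THEN bspec, THEN spec, THEN mp]
  define G where "G j x = mdeg j (D j x)" for j x
  have G: "mapply (G j x) vs = (if length vs = j then D j x vs else 0)" if "j \<le> k" "x \<in> S" for j x vs
    unfolding G_def using D(2) that by (simp add: mapply_mdeg)
  show "mC_on k S (\<lambda>x. mconst (f x))"
    unfolding mC_on_iff
  proof (intro exI[of _ G] conjI ballI allI impI)
    show "G 0 x = mconst (f x)" if "x \<in> S" for x
      by (rule mlm_eqI) (auto simp: G that mapply_mconst D)
    show "(G j has_derivative mcurry (G (Suc j) x)) (at x within S)" if jx: "j < k" "x \<in> S" for j x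
      unfolding has_derivative_within_alt
    proof (intro conjI allI impI bounded_bilinear.bounded_linear_right[OF bounded_bilinear_mcurry])
      fix e :: real
      assume "e > 0"
      obtain d where d': "d > 0" "\<forall>y\<in>S. norm (y - x) < d \<longrightarrow>
        multilinear_norm_le j (\<lambda>vs. D j y vs - D j x vs - D (Suc j) x ((y - x) # vs)) (e * norm (y - x))"
        using der[OF jx \<open>e > 0\<close>] by (elim exE conjE) (rule that)
      note d = d'(1) d'(2)[THEN bspec, THEN mp]
      have "norm (G j y - G j x - mcurry (G (Suc j) x) (y - x)) \<le> e * norm (y - x)"
        if y: "y \<in> S" "norm (y - x) < d" for y
      proof (rule norm_mlm_le)
        fix vs
        show "norm (mapply (G j y - G j x - mcurry (G (Suc j) x) (y - x)) vs) \<le> e * norm (y - x) * prod_list (map norm vs)"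
        proof (cases "length vs = j")
          case True
          then show ?thesis
            using d(2)[OF y] jx y(1) by (simp add: G multilinear_norm_le_def)
        next
          case False
          then show ?thesis using \<open>e > 0\<close> jx y(1) by (simp add: G)
        qed
      qed (use \<open>e > 0\<close> in simp)
      then show "\<exists>d>0. \<forall>y\<in>S. norm (y - x) < d \<longrightarrow>
        norm (G j y - G j x - mcurry (G (Suc j) x) (y - x)) \<le> e * norm (y - x)"
        using d(1) by (intro exI[of _ d]) simp
    qed
    show "continuous_on S (G k)"
      unfolding continuous_on_iff
    proof (intro ballI allI impI)
      fix x and e :: real
      assume x: "x \<in> S" and "e > 0"
      \<comment> \<open>Halving restores the strict inequality, as
        \<open>multilinear_norm_le\<close> yields a non-strict one.\<close>
      then have "e / 2 > 0" by simp
      obtain d where d': "d > 0" "\<forall>y\<in>S. norm (y - x) < d \<longrightarrow>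
        multilinear_norm_le k (\<lambda>vs. D k y vs - D k x vs) (e / 2)"
        using cont[OF x \<open>e / 2 > 0\<close>] by (elim exE conjE) (rule that)
      note d = d'(1) d'(2)[THEN bspec, THEN mp]
      have "norm (G k y - G k x) \<le> e / 2" if y: "y \<in> S" "norm (y - x) < d" for y
      proof (rule norm_mlm_le)
        fix vs
        show "norm (mapply (G k y - G k x) vs) \<le> e / 2 * prod_list (map norm vs)"
          using d(2)[OF y] x y(1) \<open>e > 0\<close> by (cases "length vs = k") (simp_all add: G multilinear_norm_le_def)
      qed (use \<open>e > 0\<close> in simp)
      then have "dist (G k y) (G k x) < e" if "y \<in> S" "dist y x < d" for y
        using that \<open>e > 0\<close> by (fastforce simp: dist_norm)
      then show "\<exists>d>0. \<forall>y\<in>S. dist y x < d \<longrightarrow> dist (G k y) (G k x) < e"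
        using d(1) by (intro exI[of _ d]) simp
    qed
  qed
next
  assume "mC_on k S (\<lambda>x. mconst (f x))"
  then obtain G where G: "\<And>x. x \<in> S \<Longrightarrow> G 0 x = mconst (f x)"
    "\<And>j x. j < k \<Longrightarrow> x \<in> S \<Longrightarrow> (G j has_derivative mcurry (G (Suc j) x)) (at x within S)"
    "continuous_on S (G k)"
    unfolding mC_on_iff by (elim exE conjE) (rule that; simp)
  show "C_on k S f"
    unfolding C_on_def
  proof (intro exI[of _ "\<lambda>j x. mapply (G j x)"] conjI ballI allI impI)
    show "mapply (G 0 x) [] = f x" if "x \<in> S" for x
      by (simp add: G that mapply_mconst)
    show "bounded_multilinear j (mapply (G j x))" for j x
    proof -
      obtain C where "\<forall>vs. norm (mapply (G j x) vs) \<le> C * prod_list (map norm vs)"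
        using mapply_bound[of "G j x"] by (elim exE conjE)
      then show ?thesis
        unfolding bounded_multilinear_def using linear_mapply[of _ _ "G j x"] by (intro conjI exI[of _ C]) auto
    qed
    show "\<exists>\<delta>>0. \<forall>y\<in>S. norm (y - x) < \<delta> \<longrightarrow> multilinear_norm_le j
      (\<lambda>vs. mapply (G j y) vs - mapply (G j x) vs - mapply (G (Suc j) x) ((y - x) # vs)) (e * norm (y - x))"
      if jx: "j < k" "x \<in> S" and "e > 0" for j x and e :: real
    proof -
      obtain d where d: "d > 0" "\<And>y. y \<in> S \<Longrightarrow> norm (y - x) < d \<Longrightarrow>
        norm (G j y - G j x - mcurry (G (Suc j) x) (y - x)) \<le> e * norm (y - x)"
        using G(2)[OF jx] \<open>e > 0\<close> unfolding has_derivative_within_alt by blast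
      have "multilinear_norm_le j
        (\<lambda>vs. mapply (G j y) vs - mapply (G j x) vs - mapply (G (Suc j) x) ((y - x) # vs)) (e * norm (y - x))"
        if "y \<in> S" "norm (y - x) < d" for y
        unfolding multilinear_norm_le_def
      proof (intro allI impI)
        fix vs :: "'a list"
        show "norm (mapply (G j y) vs - mapply (G j x) vs - mapply (G (Suc j) x) ((y - x) # vs))
          \<le> e * norm (y - x) * prod_list (map norm vs)"
          using norm_mapply[of "G j y - G j x - mcurry (G (Suc j) x) (y - x)" vs]
            mult_right_mono[OF d(2)[OF that] prod_list_map_norm_nonneg[of vs]]
          unfolding minus_mlm.rep_eq mapply_mcurry by (rule order_trans)
      qed
      then show ?thesis using d(1) by (intro exI[of _ d]) simp
    qed
    show "\<exists>\<delta>>0. \<forall>y\<in>S. norm (y - x) < \<delta> \<longrightarrow> multilinear_norm_le k (\<lambda>vs. mapply (G k y) vs - mapply (G k x) vs) e"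
      if xe: "x \<in> S" "e > 0" for x and e :: real
    proof -
      obtain d where d: "d > 0" "\<And>y. y \<in> S \<Longrightarrow> dist y x < d \<Longrightarrow> dist (G k y) (G k x) < e"
        using G(3) xe unfolding continuous_on_iff by blast
      have "multilinear_norm_le k (\<lambda>vs. mapply (G k y) vs - mapply (G k x) vs) e"
        if "y \<in> S" "norm (y - x) < d" for y
        unfolding multilinear_norm_le_def
      proof (intro allI impI)
        fix vs :: "'a list"
        have "norm (G k y - G k x) \<le> e" using d(2)[of y] that by (simp add: dist_norm)
        from norm_mapply[of "G k y - G k x" vs] mult_right_mono[OF this prod_list_map_norm_nonneg[of vs]]
        show "norm (mapply (G k y) vs - mapply (G k x) vs) \<le> e * prod_list (map norm vs)"
          unfolding minus_mlm.rep_eq by (rule order_trans)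
      qed
      then show ?thesis using d(1) by (intro exI[of _ d]) simp
    qed
  qed
qed

lemma C_on_subset: "C_on k S f \<Longrightarrow> T \<subseteq> S \<Longrightarrow> C_on k T f"
  unfolding C_on_iff_mC_on by (rule mC_on_subset)

lemma C_on_cong: "C_on k S f \<Longrightarrow> (\<And>x. x \<in> S \<Longrightarrow> f x = g x) \<Longrightarrow> C_on k S g"
  unfolding C_on_iff_mC_on by (rule mC_on_cong) auto

lemma C_on_le: "C_on k S f \<Longrightarrow> j \<le> k \<Longrightarrow> C_on j S f"
  unfolding C_on_iff_mC_on by (rule mC_on_le)

lemma C_on_continuous: "C_on k S f \<Longrightarrow> continuous_on S f"
  unfolding C_on_iff_mC_on by (rule continuous_on_mconst[OF mC_on_continuous])

definition mder :: "('a::real_normed_vector, 'b::real_normed_vector) mlm \<Rightarrow> 'a \<Rightarrow>\<^sub>L 'b" where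
  "mder T = Blinfun (\<lambda>h. mapply T [h])"

lemma mder_apply [simp]: "mder T h = mapply T [h]"
  by (simp add: mder_def bounded_linear_Blinfun_apply linear_mapply_singleton)

lemma bounded_linear_mder: "bounded_linear mder"
proof (rule bounded_linear_intro[of _ 1])
  fix T :: "('a, 'b) mlm"
  show "norm (mder T) \<le> norm T * 1"
    using norm_mapply[of T "[_]"] by (intro norm_blinfun_bound) auto
qed (rule blinfun_eqI, simp add: blinfun.bilinear_simps)+

lemma C_on_has_derivative:
  assumes "C_on (Suc k) S f"
  obtains D :: "'a::real_normed_vector \<Rightarrow> 'a \<Rightarrow>\<^sub>L 'b::real_normed_vector"
  where "\<And>x. x \<in> S \<Longrightarrow> (f has_derivative D x) (at x within S)" "continuous_on S D"
proof -
  obtain F' where F': "\<And>x. x \<in> S \<Longrightarrow> ((\<lambda>x. mconst (f x)) has_derivative mcurry (F' x)) (at x within S)" "mC_on k S F'"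
    using assms unfolding C_on_iff_mC_on by auto
  define D where "D x = mder (F' x)" for x
  show thesis
  proof
    show "(f has_derivative D x) (at x within S)" if "x \<in> S" for x
      using has_derivative_mconst[OF F'(1)[OF that]]
      by (rule has_derivative_eq_rhs) (simp add: fun_eq_iff D_def)
    show "continuous_on S D"
      unfolding D_def by (rule bounded_linear.continuous_on[OF bounded_linear_mder mC_on_continuous[OF F'(2)]])
  qed
qed

text \<open>Postcomposition with \<open>L\<close> in all degrees. On \<open>mconst\<close> it is
  \<open>L\<close> itself, which carries results on \<open>mlm\<close>-valued maps over to ordinary
  maps.\<close>

lift_definition mpush :: "('b::real_normed_vector \<Rightarrow>\<^sub>L 'c::real_normed_vector) \<Rightarrow> ('a::real_normed_vector, 'b) mlm \<Rightarrow> ('a, 'c) mlm"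
  is "\<lambda>L T vs. L (T vs)"
proof safe
  fix L :: "'b \<Rightarrow> 'c" and T :: "'a list \<Rightarrow> 'b" and vs :: "'a list" and i
  assume "bounded_linear L" "\<forall>vs i. i < length vs \<longrightarrow> linear (\<lambda>v. T (vs[i := v]))" "i < length vs"
  then show "linear (\<lambda>v. L (T (vs[i := v])))"
    using linear_compose[of "\<lambda>v. T (vs[i := v])" L] by (simp add: o_def bounded_linear.linear)
next
  fix L :: "'b \<Rightarrow> 'c" and T :: "'a list \<Rightarrow> 'b" and C
  assume L: "bounded_linear L" and "\<forall>vs. norm (T vs) \<le> C * prod_list (map norm vs)"
  then have "norm (L (T vs)) \<le> onorm L * (C * prod_list (map norm vs))" for vs
    by (intro order_trans[OF onorm[OF L]] mult_left_mono) (auto simp: onorm_pos_le)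
  then show "\<exists>C. \<forall>vs. norm (L (T vs)) \<le> C * prod_list (map norm vs)"
    by (intro exI[of _ "onorm L * C"]) (simp add: mult.assoc)
qed

lemma bounded_linear_mpush:
  "bounded_linear (mpush L :: ('a::real_normed_vector, 'b::real_normed_vector) mlm \<Rightarrow> ('a, 'c::real_normed_vector) mlm)"
proof (rule bounded_linear_intro[of _ "norm L"])
  fix T :: "('a, 'b) mlm"
  show "norm (mpush L T) \<le> norm T * norm L"
  proof (rule norm_mlm_le)
    fix vs
    have "norm (L (mapply T vs)) \<le> norm L * (norm T * prod_list (map norm vs))"
      by (intro order_trans[OF norm_blinfun] mult_left_mono norm_mapply norm_ge_zero)
    then show "norm (mapply (mpush L T) vs) \<le> norm T * norm L * prod_list (map norm vs)"
      by (simp add: mpush.rep_eq mult_ac)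
  qed simp
qed (rule mlm_eqI, simp add: mpush.rep_eq blinfun.bilinear_simps)+

lemma C_on_bounded_linear:
  fixes f :: "'a::real_normed_vector \<Rightarrow> 'b::real_normed_vector" and L :: "'b \<Rightarrow> 'c::real_normed_vector"
  assumes "bounded_linear L" "C_on k S f"
  shows "C_on k S (\<lambda>x. L (f x))"
proof -
  have "mpush (Blinfun L) (mconst c :: ('a, 'b) mlm) = mconst (L c)" for c
    by (rule mlm_eqI) (simp add: mpush.rep_eq mapply_mconst bounded_linear_Blinfun_apply assms(1)
        linear_simps(3)[OF assms(1)])
  with mC_on_bounded_linear[OF bounded_linear_mpush assms(2)[unfolded C_on_iff_mC_on], of "Blinfun L"]
  show ?thesis by (simp add: C_on_iff_mC_on)
qed

lemma C_on_precompose: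
  fixes p :: "'a::real_normed_vector \<Rightarrow> 'b::real_normed_vector" and f :: "'b \<Rightarrow> 'c::real_normed_vector"
  assumes "linear p" "\<And>v. norm (p v) \<le> norm v" "C_on k S f" "p ` T \<subseteq> S"
  shows "C_on k T (\<lambda>x. f (p x))"
proof -
  have "mpull p (mconst c :: ('b, 'c) mlm) = mconst c" for c
    by (rule mlm_eqI) (simp add: mpull.rep_eq mapply_mconst assms(1,2))
  with mC_on_precompose[OF assms(1,2) assms(3)[unfolded C_on_iff_mC_on] assms(4)]
  show ?thesis by (simp add: C_on_iff_mC_on)
qed

lemma C_on_add:
  assumes "C_on k S f" "C_on k S g"
  shows "C_on k S (\<lambda>x. f x + g x)"
  using mC_on_add[OF assms[unfolded C_on_iff_mC_on]]
  by (simp add: C_on_iff_mC_on linear_simps(1)[OF bounded_linear_mconst])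

lemma C_on_linear: "bounded_linear L \<Longrightarrow> C_on k S L"
  unfolding C_on_iff_mC_on by (intro mC_on_linear bounded_linear_compose[OF bounded_linear_mconst])

lemma C_on_const: "C_on k S (\<lambda>x. c)"
  unfolding C_on_iff_mC_on by (rule mC_on_const)

lemma C_on_Pair:
  assumes "C_on k S f" "C_on k S g"
  shows "C_on k S (\<lambda>x. (f x, g x))"
proof -
  have "bounded_linear (\<lambda>a. (a, 0))" "bounded_linear (\<lambda>b. (0, b))"
    by (auto intro!: bounded_linear_Pair bounded_linear_ident bounded_linear_zero)
  from C_on_add[OF C_on_bounded_linear[OF this(1) assms(1)] C_on_bounded_linear[OF this(2) assms(2)]]
  show ?thesis by simp
qed

text \<open>Composition is reduced to that with a self-map of the product space, for which all
  derivatives are multilinear maps on one space.\<close>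

lemma C_on_compose:
  fixes f :: "'a::real_normed_vector \<Rightarrow> 'b::real_normed_vector" and g :: "'b \<Rightarrow> 'c::real_normed_vector"
  assumes f: "C_on k S f" and g: "C_on k T g" and sub: "f ` S \<subseteq> T"
  shows "C_on k S (\<lambda>x. g (f x))"
proof -
  have "C_on k (S \<times> UNIV) (\<lambda>z :: 'a \<times> 'b. f (fst z))"
    by (rule C_on_precompose[OF _ _ f]) (auto simp: norm_fst_le linear_fst)
  then have "C_on k (S \<times> UNIV) (\<lambda>z :: 'a \<times> 'b. (0 :: 'a, f (fst z)))"
    by (rule C_on_Pair[OF C_on_const])
  moreover have "C_on k (UNIV \<times> T) (\<lambda>z :: 'a \<times> 'b. g (snd z))"
    by (rule C_on_precompose[OF _ _ g]) (auto simp: norm_snd_le linear_snd)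
  ultimately have "C_on k (S \<times> UNIV) (\<lambda>z :: 'a \<times> 'b. g (snd (0 :: 'a, f (fst z))))"
    unfolding C_on_iff_mC_on by (rule mC_on_compose) (use sub in auto)
  then have "C_on k (S \<times> UNIV) (\<lambda>z :: 'a \<times> 'b. g (f (fst z)))" by simp
  \<comment> \<open>Pulling back along the contraction \<open>a \<mapsto> (a, 0)\<close> removes the
    auxiliary second factor.\<close>
  from C_on_precompose[where p = "\<lambda>a. (a, 0)", OF _ _ this, of S]
  show ?thesis by (auto simp: linear_iff)
qed

text \<open>As \<open>g\<close> vanishes at \<open>x\<close>, the term
  \<open>B (f y - f x) (g y)\<close> is o(1) times a multiple of \<open>norm (y - x)\<close>; so
  continuity of \<open>f\<close> at \<open>x\<close> replaces differentiability. It serves for the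
  annihilation relation, for changes of trivialization and for inverse operators.\<close>

lemma bounded_bilinear_has_derivative_right:
  assumes B: "bounded_bilinear B" and f: "continuous (at x within S) f"
    and g: "(g has_derivative g') (at x within S)" "g x = 0"
  shows "((\<lambda>y. B (f y) (g y)) has_derivative (\<lambda>h. B (f x) (g' h))) (at x within S)"
proof -
  interpret B: bounded_bilinear B by fact
  have g': "bounded_linear g'" using g(1) by (rule has_derivative_bounded_linear)
  have 1: "((\<lambda>y. B (f x) (g y)) has_derivative (\<lambda>h. B (f x) (g' h))) (at x within S)"
    by (rule bounded_linear.has_derivative[OF B.bounded_linear_right g(1)])
  obtain K where K: "K > 0" "\<And>a b. norm (B a b) \<le> norm a * norm b * K" using B.pos_bounded by blast
  obtain C where C: "C > 0" "\<And>h. norm (g' h) \<le> norm h * C"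
    using bounded_linear.pos_bounded[OF g'] by blast
  obtain d where d: "d > 0" "\<And>y. y \<in> S \<Longrightarrow> norm (y - x) < d \<Longrightarrow> norm (g y - g x - g' (y - x)) \<le> 1 * norm (y - x)"
    using g(1)[unfolded has_derivative_within_alt, THEN conjunct2, rule_format, OF zero_less_one] by auto
  have gb: "norm (g y) \<le> (C + 1) * norm (y - x)" if "y \<in> S" "norm (y - x) < d" for y
  proof -
    have "norm (g y) \<le> norm (g y - g x - g' (y - x)) + norm (g' (y - x))"
      using norm_triangle_ineq[of "g y - g' (y - x)" "g' (y - x)"] g(2) by simp
    also have "\<dots> \<le> 1 * norm (y - x) + norm (y - x) * C" by (intro add_mono d C that)
    finally show ?thesis by (simp add: algebra_simps)
  qed
  have 2: "((\<lambda>y. B (f y - f x) (g y)) has_derivative (\<lambda>h. 0)) (at x within S)"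
    unfolding has_derivative_within_alt
  proof (intro conjI allI impI bounded_linear_zero)
    fix e :: real
    assume e: "e > 0"
    \<comment> \<open>\<open>K\<close> bounds \<open>B\<close>, and \<open>C + 1\<close> bounds the
      growth of \<open>g\<close> near \<open>x\<close>, the 1 coming from its remainder term;
      multiplied together the constants give \<open>e\<close>.\<close>
    define e' where "e' = e / ((C + 1) * K)"
    have e': "e' > 0" "e' * ((C + 1) * K) = e" using e K C by (auto simp: e'_def)
    obtain d' where d': "d' > 0" "\<forall>y\<in>S. dist y x < d' \<longrightarrow> dist (f y) (f x) < e'"
      using f[unfolded continuous_within_eps_delta, rule_format, OF e'(1)] by (elim exE conjE) (rule that)
    have "norm (B (f y - f x) (g y) - B (f x - f x) (g x) - 0) \<le> e * norm (y - x)"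
      if y: "y \<in> S" "norm (y - x) < min d d'" for y
    proof -
      have "norm (B (f y - f x) (g y)) \<le> norm (f y - f x) * norm (g y) * K" by (rule K)
      also have "\<dots> \<le> e' * ((C + 1) * norm (y - x)) * K"
        using d'(2)[THEN bspec, OF y(1)] gb[of y] y K(1) C(1) e'(1)
        by (intro mult_mono) (simp_all add: dist_norm)
      also have "\<dots> = e * norm (y - x)" unfolding e'(2)[symmetric] by (simp add: mult_ac)
      finally show ?thesis by (simp add: B.zero_left)
    qed
    then show "\<exists>d>0. \<forall>y\<in>S. norm (y - x) < d \<longrightarrow>
      norm (B (f y - f x) (g y) - B (f x - f x) (g x) - 0) \<le> e * norm (y - x)"
      using d(1) d'(1) by (intro exI[of _ "min d d'"]) simp
  qed
  from has_derivative_add[OF 1 2] show ?thesis by (simp add: B.diff_left)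
qed

text \<open>In the application \<open>W y\<close> is the inverse of the degree 1 part of
  \<open>U y\<close>, and \<open>inv\<close> is the resolvent identity. With the bound
  \<open>K\<close> it makes \<open>W\<close> continuous, then differentiable with derivative
  \<open>- W U' W\<close>, which is built from \<open>U'\<close> and \<open>W\<close> by bilinear
  maps: this allows induction.\<close>

lemma mC_on_inverse:
  fixes U W :: "'b::real_normed_vector \<Rightarrow> ('b, 'b) mlm"
  assumes U: "mC_on k V U"
    and inv: "\<And>y y'. y \<in> V \<Longrightarrow> y' \<in> V \<Longrightarrow> W y' - W y = - mcompose (W y') (mcompose (U y' - U y) (W y))"
    and K: "\<And>y. y \<in> V \<Longrightarrow> norm (W y) \<le> K"
  shows "mC_on k V W"
proof -
  interpret mc: bounded_bilinear "mcompose :: ('b, 'b) mlm \<Rightarrow> _" by (rule bounded_bilinear_mcompose)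
  obtain C where C: "C \<ge> 0" "\<And>a b. norm (mcompose a b :: ('b, 'b) mlm) \<le> norm a * norm b * C"
    using mc.nonneg_bounded by blast
  have cont: "continuous_on V W"
    unfolding continuous_on_def
  proof
    fix y assume y: "y \<in> V"
    have "norm (W y' - W y) \<le> K * (norm (U y' - U y) * K * C) * C" if y': "y' \<in> V" for y'
    proof -
      have K0: "0 \<le> K" using K[OF y] by (rule order_trans[OF norm_ge_zero])
      have "norm (W y' - W y) \<le> norm (W y') * norm (mcompose (U y' - U y) (W y)) * C"
        unfolding inv[OF y y'] norm_minus_cancel by (rule C)
      also have "\<dots> \<le> K * (norm (U y' - U y) * norm (W y) * C) * C"
        using C K[OF y'] K0 by (intro mult_right_mono mult_mono) auto
      also have "\<dots> \<le> K * (norm (U y' - U y) * K * C) * C"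
        using C K[OF y] K0 by (intro mult_right_mono mult_left_mono) auto
      finally show ?thesis .
    qed
    note bd = this
    have "((\<lambda>y'. K * (norm (U y' - U y) * K * C) * C) \<longlongrightarrow> K * (norm (U y - U y) * K * C) * C) (at y within V)"
      using mC_on_continuous[OF U] y unfolding continuous_on_def by (intro tendsto_intros) simp
    then have lim: "((\<lambda>y'. K * (norm (U y' - U y) * K * C) * C) \<longlongrightarrow> 0) (at y within V)"
      by simp
    have "\<forall>\<^sub>F y' in at y within V. norm (W y' - W y) \<le> K * (norm (U y' - U y) * K * C) * C"
      by (simp add: eventually_at_filter bd)
    then have "((\<lambda>y'. W y' - W y) \<longlongrightarrow> 0) (at y within V)"
      by (rule Lim_null_comparison[OF _ lim])
    then show "(W \<longlongrightarrow> W y) (at y within V)" by (rule LIM_zero_cancel)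
  qed
  show ?thesis
    using U
  proof (induction k)
    case 0
    then show ?case using cont by simp
  next
    case (Suc k)
    obtain U' where U': "\<And>x. x \<in> V \<Longrightarrow> (U has_derivative mcurry (U' x)) (at x within V)" "mC_on k V U'"
      using Suc.prems by auto
    have W: "mC_on k V W" by (rule Suc.IH[OF mC_on_Suc[OF Suc.prems]])
    define B1 :: "('b, 'b) mlm \<Rightarrow> ('b, 'b) mlm \<Rightarrow> ('b, 'b) mlm" where "B1 T c = muncurry (Blinfun (\<lambda>h. mcompose (mcurry T h) c))" for T c
    define B2 :: "('b, 'b) mlm \<Rightarrow> ('b, 'b) mlm \<Rightarrow> ('b, 'b) mlm" where "B2 T c = muncurry (Blinfun (\<lambda>h. mcompose c (mcurry T h)))" for T c
    have B1: "bounded_bilinear B1" "\<And>T c h. mcurry (B1 T c) h = mcompose (mcurry T h) c"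
      unfolding B1_def using bounded_bilinear_muncurry_left[OF bounded_bilinear_mcompose] by auto
    have B2: "bounded_bilinear B2" "\<And>T c h. mcurry (B2 T c) h = mcompose c (mcurry T h)"
      unfolding B2_def using bounded_bilinear_muncurry_left[OF bounded_bilinear.flip[OF bounded_bilinear_mcompose]] by auto
    have "mC_on k V (\<lambda>y. - B2 (B1 (U' y) (W y)) (W y))"
      by (rule mC_on_bounded_linear[OF bounded_linear_minus[OF bounded_linear_ident]
            mC_on_bilinear[OF B2(1) mC_on_bilinear[OF B1(1) U'(2) W] W]])
    moreover have "(W has_derivative mcurry (- B2 (B1 (U' y) (W y)) (W y))) (at y within V)" if y: "y \<in> V" for y
    proof -
      \<comment> \<open>The difference vanishes at \<open>y\<close>, so of the outer factor
        \<open>W y'\<close> only continuity is used.\<close>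
      have "((\<lambda>y'. U y' - U y) has_derivative mcurry (U' y)) (at y within V)"
        using has_derivative_diff[OF U'(1)[OF y] has_derivative_const[of "U y"]] by simp
      from bounded_linear.has_derivative[OF mc.bounded_linear_left[of "W y"] this]
      have "((\<lambda>y'. mcompose (U y' - U y) (W y)) has_derivative (\<lambda>h. mcompose (mcurry (U' y) h) (W y))) (at y within V)" .
      from bounded_bilinear_has_derivative_right[OF bounded_bilinear_mcompose _ this, of W]
      have "((\<lambda>y'. mcompose (W y') (mcompose (U y' - U y) (W y))) has_derivative
        (\<lambda>h. mcompose (W y) (mcompose (mcurry (U' y) h) (W y)))) (at y within V)"
        using cont y by (simp add: continuous_on_eq_continuous_within mc.zero_left)
      from has_derivative_diff[OF has_derivative_const[of "W y"] this]
      have *: "((\<lambda>y'. W y - mcompose (W y') (mcompose (U y' - U y) (W y))) has_derivative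
        (\<lambda>h. 0 - mcompose (W y) (mcompose (mcurry (U' y) h) (W y)))) (at y within V)" .
      have "(W has_derivative (\<lambda>h. 0 - mcompose (W y) (mcompose (mcurry (U' y) h) (W y)))) (at y within V)"
        by (rule has_derivative_transform[OF y _ *]) (use inv[OF y] in \<open>simp add: algebra_simps\<close>)
      moreover have "mcurry (- B2 (B1 (U' y) (W y)) (W y)) = (\<lambda>h. 0 - mcompose (W y) (mcompose (mcurry (U' y) h) (W y)))"
        by (rule ext) (simp add: bounded_bilinear.minus_left[OF bounded_bilinear_mcurry] B1(2) B2(2))
      ultimately show ?thesis by simp
    qed
    ultimately show ?case by (intro mC_on_SucI)
  qed
qed

text \<open>A bootstrap: if \<open>\<Xi>\<close> is of class j below \<open>k\<close>, so is the
  derivative of \<open>\<Theta>\<close> taken along \<open>\<Xi>\<close>, hence so is its inverse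
  \<open>w\<close>, which is the derivative of \<open>\<Xi>\<close>; thus \<open>\<Xi>\<close> is of
  class j + 1.\<close>

lemma C_on_inverse:
  fixes \<Theta> \<Xi> :: "'b::real_normed_vector \<Rightarrow> 'b" and D w :: "'b \<Rightarrow> 'b \<Rightarrow>\<^sub>L 'b"
  assumes C: "C_on k S \<Theta>" and "open S" "open V"
    and sub: "\<Xi> ` V \<subseteq> S" and inv: "\<And>y. y \<in> V \<Longrightarrow> \<Theta> (\<Xi> y) = y" and cont: "continuous_on V \<Xi>"
    and D: "\<And>x. x \<in> S \<Longrightarrow> (\<Theta> has_derivative D x) (at x)"
    and w: "\<And>y. y \<in> V \<Longrightarrow> w y o\<^sub>L D (\<Xi> y) = id_blinfun" "\<And>y. y \<in> V \<Longrightarrow> D (\<Xi> y) o\<^sub>L w y = id_blinfun"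
    and K: "\<And>y. y \<in> V \<Longrightarrow> norm (w y) \<le> K"
  shows "C_on k V \<Xi>"
proof (cases k)
  case 0
  then show ?thesis
    using cont bounded_linear.continuous_on[OF bounded_linear_mconst] by (simp add: C_on_iff_mC_on)
next
  case (Suc l)
  obtain F where F: "\<And>x. x \<in> S \<Longrightarrow> ((\<lambda>x. mconst (\<Theta> x)) has_derivative mcurry (F x)) (at x within S)" "mC_on l S F"
    using C unfolding Suc C_on_iff_mC_on by auto
  have F1: "mapply (F x) [h] = D x h" if "x \<in> S" for x h
  proof -
    have "(\<Theta> has_derivative (\<lambda>h. mapply (mcurry (F x) h) [])) (at x)"
      using has_derivative_mconst[OF F(1)[OF that]] at_within_open[OF that \<open>open S\<close>] by simp
    from has_derivative_unique[OF this D[OF that]] show ?thesis by (simp add: fun_eq_iff)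
  qed
  have der: "(\<Xi> has_derivative w y) (at y)" if y: "y \<in> V" for y
  proof (rule has_derivative_inverse_basic[OF D _ _ _ \<open>open V\<close> y inv])
    show "blinfun_apply (w y) \<circ> blinfun_apply (D (\<Xi> y)) = id"
      using arg_cong[OF w(1)[OF y], of blinfun_apply] by (simp add: fun_eq_iff)
    show "continuous (at y) \<Xi>" using cont \<open>open V\<close> y by (simp add: continuous_on_eq_continuous_at)
    show "bounded_linear (w y)" by (rule blinfun.bounded_linear_right)
    show "\<Xi> y \<in> S" using y sub by blast
  qed
  \<comment> \<open>\<open>w y\<close> in stored form, concentrated in degree 1: the derivative of
    \<open>mconst\<close> after \<open>\<Xi>\<close>.\<close>
  define W where "W y = muncurry (Blinfun (\<lambda>h. mconst (w y h)))" for y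
  have bl: "bounded_linear (\<lambda>h. mconst (w y h))" for y
    by (rule bounded_linear_compose[OF bounded_linear_mconst blinfun.bounded_linear_right])
  have mW: "mcurry (W y) h = mconst (w y h)" for y h
    by (simp add: W_def bounded_linear_Blinfun_apply[OF bl])
  have aW: "mapply (W y) [] = 0" "mapply (W y) (h # vs) = (if vs = [] then w y h else 0)" for y h vs
    by (simp_all add: W_def bounded_linear_Blinfun_apply[OF bl] mapply_mconst)
  have WK: "norm (W y) \<le> K" if "y \<in> V" for y
  proof (rule norm_mlm_le)
    show "0 \<le> K" using K[OF that] by (rule order_trans[OF norm_ge_zero])
    fix vs
    show "norm (mapply (W y) vs) \<le> K * prod_list (map norm vs)"
    proof (cases vs)
      case (Cons h ws)
      have "norm (w y h) \<le> K * norm h"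
        using order_trans[OF norm_blinfun mult_right_mono[OF K[OF that]]] by simp
      then show ?thesis using \<open>0 \<le> K\<close> by (simp add: Cons aW)
    qed (simp add: aW \<open>0 \<le> K\<close>)
  qed
  have WW: "W y' - W y = - mcompose (W y') (mcompose (F (\<Xi> y') - F (\<Xi> y)) (W y))" if "y \<in> V" "y' \<in> V" for y y'
  proof (rule mlm_eqI)
    fix vs
    have D1: "D (\<Xi> y) (w y h) = h" "w y' (D (\<Xi> y') h) = h" for h
      using arg_cong[OF w(2)[OF that(1)], of "\<lambda>L. blinfun_apply L h"]
        arg_cong[OF w(1)[OF that(2)], of "\<lambda>L. blinfun_apply L h"] by simp_all
    show "mapply (W y' - W y) vs = mapply (- mcompose (W y') (mcompose (F (\<Xi> y') - F (\<Xi> y)) (W y))) vs"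
    proof (cases vs)
      case (Cons h ws)
      have "\<Xi> y \<in> S" "\<Xi> y' \<in> S" using that sub by auto
      then show ?thesis
        by (cases "ws = []") (simp_all add: Cons mapply_mcompose aW F1 blinfun.diff_right D1)
    qed (simp add: aW mapply_mcompose)
  qed
  have "mC_on j V (\<lambda>y. mconst (\<Xi> y))" if "j \<le> k" for j
    using that
  proof (induction j)
    case 0
    then show ?case using bounded_linear.continuous_on[OF bounded_linear_mconst cont] by simp
  next
    case (Suc j)
    \<comment> \<open>\<open>F\<close> is one class below \<open>\<Theta>\<close>, which is enough
      since the step ends at \<open>Suc j\<close>, at most \<open>k\<close>.\<close>
    have "mC_on j S F"
      using F(2) Suc.prems \<open>k = Suc l\<close> by (intro mC_on_le[OF F(2)]) simp
    then have "mC_on j V (\<lambda>y. F (\<Xi> y))"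
      using Suc by (intro mC_on_compose[OF Suc.IH _ sub]) simp_all
    then have "mC_on j V W" by (rule mC_on_inverse[OF _ WW WK])
    moreover have "((\<lambda>y. mconst (\<Xi> y)) has_derivative mcurry (W y)) (at y within V)" if "y \<in> V" for y
    proof -
      have "((\<lambda>y. mconst (\<Xi> y)) has_derivative (\<lambda>h. mconst (w y h))) (at y within V)"
        by (rule bounded_linear.has_derivative[OF bounded_linear_mconst has_derivative_at_withinI[OF der[OF that]]])
      then show ?thesis by (rule has_derivative_eq_rhs) (simp add: fun_eq_iff mW)
    qed
    ultimately show ?case by (intro mC_on_SucI)
  qed
  then show ?thesis by (simp add: C_on_iff_mC_on)
qed

section \<open>Inverse and implicit functions in Banach spaces\<close>

lemma blinfun_compose_eq_id: "A o\<^sub>L B = id_blinfun \<Longrightarrow> A (B x) = x"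
  by (metis blinfun_apply_blinfun_compose blinfun_apply_id_blinfun)

text \<open>Banach's inverse theorem. By Baire the closure of the image of some ball has interior,
  so small vectors are attained approximately with control of the norm; iterating on the residual
  yields an exact preimage as a geometrically convergent series.\<close>

theorem bounded_linear_inv:
  fixes T :: "'a::banach \<Rightarrow> 'b::banach"
  assumes T: "bounded_linear T" and bij: "bij T"
  shows "bounded_linear (inv_into UNIV T)"
proof -
  interpret T: bounded_linear T by fact
  define S where "S n = closure (T ` ball 0 (real n))" for n
  have "\<exists>n. interior (S n) \<noteq> {}"
  proof (rule ccontr)
    assume "\<nexists>n. interior (S n) \<noteq> {}"
    have int: "euclidean interior_of S n = {}" for n
    proof (rule ccontr)
      assume "euclidean interior_of S n \<noteq> {}"
      then obtain x T where "open T" "x \<in> T" "T \<subseteq> S n" by (auto simp: interior_of_def)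
      then have "x \<in> interior (S n)" by (rule interiorI)
      with \<open>\<nexists>n. interior (S n) \<noteq> {}\<close> show False by simp
    qed
    have "Met_TC.mtopology interior_of \<Union>(range S) = {}"
    proof (rule Met_TC.metric_Baire_category_alt)
      show "Met_TC.mcomplete TYPE('b)"
        using complete_UNIV[where 'a = 'b] by simp
      show "closedin Met_TC.mtopology T \<and> Met_TC.mtopology interior_of T = {}" if "T \<in> range S" for T
        using that int by (auto simp: S_def)
    qed simp
    moreover have "\<Union>(range S) = UNIV"
    proof -
      have "y \<in> \<Union>(range S)" for y
      proof -
        obtain x where x: "T x = y" using bij by (metis bij_pointE)
        obtain n where "norm x < real n" using reals_Archimedean2 by blast
        then have "y \<in> S n" unfolding S_def using x by (intro subsetD[OF closure_subset]) auto
        then show ?thesis by blast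
      qed
      then show ?thesis by blast
    qed
    ultimately show False by simp
  qed
  then obtain n y0 where "y0 \<in> interior (S n)" by blast
  then obtain r where r: "r > 0" "ball y0 r \<subseteq> S n"
    by (auto simp: mem_interior)
  \<comment> \<open>\<open>z\<close> is the difference of \<open>y0 + z\<close> and
    \<open>y0\<close>, both in the closure of the image of a ball; subtracting approximate preimages
    doubles the radius \<open>n\<close> and the error \<open>r / 8\<close>.\<close>
  have near: "\<exists>x. norm x < 2 * real n \<and> norm (z - T x) < r / 4" if z: "norm z < r" for z
  proof -
    have "y0 + z \<in> S n" "y0 \<in> S n" using r z by (auto simp: subset_iff dist_norm)
    moreover have "\<exists>x. norm x < n \<and> dist (T x) w < r / 8" if "w \<in> S n" for w
      using that[unfolded S_def closure_approachable, rule_format, of "r / 8"] r(1) by auto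
    ultimately obtain x1 x2 where x: "norm x1 < n" "dist (T x1) (y0 + z) < r / 8" "norm x2 < n" "dist (T x2) y0 < r / 8"
      by meson
    have "norm (z - T (x1 - x2)) = norm ((T x2 - y0) - (T x1 - (y0 + z)))"
      by (simp add: T.diff algebra_simps)
    also have "\<dots> \<le> dist (T x2) y0 + dist (T x1) (y0 + z)"
      unfolding dist_norm by (rule norm_triangle_ineq4)
    also have "\<dots> < r / 4" using x by simp
    finally have "norm (z - T (x1 - x2)) < r / 4" .
    moreover have "norm (x1 - x2) < 2 * real n"
      using norm_triangle_ineq4[of x1 x2] x by simp
    ultimately show ?thesis by blast
  qed
  \<comment> \<open>Division by \<open>c = 2 * norm y / r\<close> brings \<open>y\<close> to norm
    \<open>r / 2\<close>. Scaling back turns the radius \<open>2 * n\<close> into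
    \<open>C * norm y\<close> and the error \<open>r / 4\<close> into
    \<open>norm y / 2\<close>.\<close>
  define C where "C = 4 * real n / r"
  have C: "C \<ge> 0" using r by (simp add: C_def)
  have "\<exists>x. norm x \<le> C * norm y \<and> norm (y - T x) \<le> norm y / 2" for y
  proof (cases "y = 0")
    case True
    then show ?thesis by (intro exI[of _ 0]) (simp add: T.zero)
  next
    case False
    define c where "c = 2 * norm y / r"
    have c: "c > 0" using False r by (simp add: c_def)
    have "norm ((1 / c) *\<^sub>R y) = r / 2" using False r by (simp add: c_def field_simps)
    then obtain x where x: "norm x < 2 * real n" "norm ((1 / c) *\<^sub>R y - T x) < r / 4"
      using near[of "(1 / c) *\<^sub>R y"] r(1) by auto
    have "norm (c *\<^sub>R x) \<le> C * norm y"
      using mult_left_mono[OF less_imp_le[OF x(1)], of c] c r(1) by (simp add: c_def C_def mult_ac)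
    moreover have "y - T (c *\<^sub>R x) = c *\<^sub>R ((1 / c) *\<^sub>R y - T x)"
      using c by (simp add: T.scaleR scaleR_diff_right)
    then have "norm (y - T (c *\<^sub>R x)) = c * norm ((1 / c) *\<^sub>R y - T x)" using c by simp
    then have "norm (y - T (c *\<^sub>R x)) \<le> c * (r / 4)"
      using c x(2) by simp
    then have "norm (y - T (c *\<^sub>R x)) \<le> norm y / 2" using r by (simp add: c_def)
    ultimately show ?thesis by blast
  qed
  then obtain h where h: "\<And>y. norm (h y) \<le> C * norm y" "\<And>y. norm (y - T (h y)) \<le> norm y / 2" by metis
  have bound: "norm (inv_into UNIV T y) \<le> norm y * (2 * C)" for y
  proof -
    \<comment> \<open>\<open>Y k\<close> is the residual after \<open>k\<close> corrections; the
      images of the corrections \<open>h (Y k)\<close> telescope.\<close>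
    define Y where "Y k = ((\<lambda>y. y - T (h y)) ^^ k) y" for k
    have Y: "norm (Y k) \<le> norm y * (1 / 2) ^ k" for k
    proof (induction k)
      case (Suc k)
      have "norm (Y (Suc k)) \<le> norm (Y k) / 2" using h(2)[of "Y k"] by (simp add: Y_def)
      with Suc show ?case by simp
    qed (simp add: Y_def)
    have hY: "norm (h (Y k)) \<le> C * norm y * (1 / 2) ^ k" for k
      using order_trans[OF h(1)[of "Y k"] mult_left_mono[OF Y[of k] C]] by (simp add: mult.assoc)
    have geo: "(\<lambda>k. C * norm y * (1 / 2) ^ k) sums (C * norm y * 2)"
      using sums_mult[OF geometric_sums[of "1 / 2 :: real"], of "C * norm y"] by simp
    have sm: "summable (\<lambda>k. norm (h (Y k)))"
      by (rule summable_comparison_test'[OF sums_summable[OF geo], of 0]) (simp add: hY)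
    have le: "norm (\<Sum>k. h (Y k)) \<le> C * norm y * 2"
      using order_trans[OF summable_norm[OF sm] suminf_le[OF hY sm sums_summable[OF geo]]] sums_unique[OF geo] by simp
    have "(\<lambda>k. T (h (Y k))) sums T (\<Sum>k. h (Y k))"
      by (rule T.sums[OF summable_sums[OF summable_norm_cancel[OF sm]]])
    moreover have "(\<Sum>k<m. T (h (Y k))) = y - Y m" for m
      by (induction m) (simp_all add: Y_def)
    moreover have "Y \<longlonglongrightarrow> 0"
    proof (rule Lim_null_comparison[of _ "\<lambda>k. norm y * (1 / 2) ^ k"])
      show "(\<lambda>k. norm y * (1 / 2) ^ k) \<longlonglongrightarrow> 0"
        using tendsto_mult_left[OF LIMSEQ_realpow_zero[of "1 / 2"], of "norm y"] by simp
    qed (simp add: Y)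
    then have "(\<lambda>m. y - Y m) \<longlonglongrightarrow> y" using tendsto_diff[OF tendsto_const[of y], of Y 0] by simp
    ultimately have "T (\<Sum>k. h (Y k)) = y"
      unfolding sums_def using LIMSEQ_unique by auto
    then have "inv_into UNIV T y = (\<Sum>k. h (Y k))" using bij by (metis bij_inv_eq_iff)
    then show ?thesis using le by (simp add: mult_ac)
  qed
  have lin: "inv_into UNIV T (x + y) = inv_into UNIV T x + inv_into UNIV T y" "inv_into UNIV T (c *\<^sub>R x) = c *\<^sub>R inv_into UNIV T x" for x y c
    using bij by (auto simp: bij_inv_eq_iff[OF bij, symmetric] T.add T.scaleR bij_is_surj surj_f_inv_f
        intro!: inv_f_eq bij_is_inj)
  show ?thesis by (rule bounded_linear_intro[OF lin bound])
qed

text \<open>The solution of \<open>E x = y\<close> is the fixed point of the contraction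
  \<open>x \<mapsto> y + (x - E x)\<close>.\<close>

lemma blinfun_inverse_near_id:
  fixes E :: "'a::banach \<Rightarrow>\<^sub>L 'a"
  assumes "norm (id_blinfun - E) \<le> 1 / 2"
  obtains R where "R o\<^sub>L E = id_blinfun" "E o\<^sub>L R = id_blinfun" "norm R \<le> 2"
proof -
  have half: "norm (x - E x) \<le> norm x / 2" for x
    using norm_blinfun[of "id_blinfun - E" x] mult_right_mono[OF assms, of "norm x"]
    by (simp add: blinfun.diff_left)
  have "\<exists>!x. y + (x - E x) = x" for y
  proof (rule banach_fix_type[of "1 / 2"])
    show "\<forall>x x'. dist (y + (x - E x)) (y + (x' - E x')) \<le> 1 / 2 * dist x x'"
    proof (intro allI)
      fix x x'
      have "dist (y + (x - E x)) (y + (x' - E x')) = norm ((x - x') - E (x - x'))"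
        by (simp add: dist_norm blinfun.diff_right algebra_simps)
      then show "dist (y + (x - E x)) (y + (x' - E x')) \<le> 1 / 2 * dist x x'"
        using half[of "x - x'"] by (simp only: dist_norm[of x x'])
    qed
  qed auto
  moreover have "y + (x - E x) = x \<longleftrightarrow> E x = y" for x y by (auto simp: algebra_simps)
  ultimately have ex1: "\<exists>!x. E x = y" for y by simp
  define r where "r y = (THE x. E x = y)" for y
  have r: "E (r y) = y" for y unfolding r_def by (rule theI'[OF ex1])
  have r2: "r (E x) = x" for x unfolding r_def using ex1 by (intro the1_equality) auto
  have lin: "r (x + y) = r x + r y" "r (c *\<^sub>R x) = c *\<^sub>R r x" for x y c
    using r2[of "r x + r y"] r2[of "c *\<^sub>R r x"] by (simp_all add: blinfun.add_right blinfun.scaleR_right r)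
  have b: "norm (r y) \<le> norm y * 2" for y
  proof -
    have "norm (r y) \<le> norm (r y - y) + norm y" using norm_triangle_ineq[of "r y - y" y] by simp
    then show ?thesis using half[of "r y"] by (simp add: r)
  qed
  have bl: "bounded_linear r" by (rule bounded_linear_intro[OF lin b])
  show thesis
  proof
    show "Blinfun r o\<^sub>L E = id_blinfun" by (rule blinfun_eqI) (simp add: bounded_linear_Blinfun_apply bl r2)
    show "E o\<^sub>L Blinfun r = id_blinfun" by (rule blinfun_eqI) (simp add: bounded_linear_Blinfun_apply bl r)
    show "norm (Blinfun r) \<le> 2"
      by (rule norm_blinfun_bound) (use b in \<open>simp_all add: bounded_linear_Blinfun_apply bl mult.commute\<close>)
  qed
qed

text \<open>A simplified Newton iteration: \<open>T x = x - A (\<Theta> x)\<close> has a derivative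
  of norm at most 1/2 near \<open>p\<close>, so that \<open>x \<mapsto> T x + A y\<close> is a
  contraction, and its fixed point solves \<open>\<Theta> x = y\<close>.\<close>

theorem C_inverse_function:
  fixes \<Theta> :: "'a::banach \<Rightarrow> 'a" and A B :: "'a \<Rightarrow>\<^sub>L 'a"
  assumes C: "C_on k S \<Theta>" and k: "k \<ge> 1" and "open S" "p \<in> S"
    and der: "(\<Theta> has_derivative B) (at p)" and AB: "A o\<^sub>L B = id_blinfun" "B o\<^sub>L A = id_blinfun"
  obtains N V \<Xi> where "open N" "p \<in> N" "N \<subseteq> S" "open V" "\<Theta> p \<in> V" "\<Xi> ` V \<subseteq> N"
    "\<And>y. y \<in> V \<Longrightarrow> \<Theta> (\<Xi> y) = y" "\<And>x. x \<in> N \<Longrightarrow> \<Theta> x \<in> V \<Longrightarrow> \<Xi> (\<Theta> x) = x" "C_on k V \<Xi>"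
proof -
  obtain D :: "'a \<Rightarrow> 'a \<Rightarrow>\<^sub>L 'a" where D': "\<And>x. x \<in> S \<Longrightarrow> (\<Theta> has_derivative D x) (at x within S)" "continuous_on S D"
    using C_on_has_derivative[of "k - 1" S \<Theta>] C k by auto
  have D: "(\<Theta> has_derivative D x) (at x)" if "x \<in> S" for x
    using D'(1)[OF that] at_within_open[OF that \<open>open S\<close>] by simp
  have DB: "D p = B"
    using has_derivative_unique[OF D[OF \<open>p \<in> S\<close>] der] by (simp add: blinfun_apply_inject)
  define E where "E x = A o\<^sub>L D x" for x
  have Ep: "E p = id_blinfun" by (simp add: E_def DB AB)
  have "continuous_on S E"
    unfolding E_def
    by (rule bounded_bilinear.continuous_on[OF bounded_bilinear_blinfun_compose continuous_on_const D'(2)])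
  then obtain d where d: "d > 0" "\<And>x. x \<in> S \<Longrightarrow> dist x p < d \<Longrightarrow> dist (E x) (E p) < 1 / 2"
    using \<open>p \<in> S\<close> unfolding continuous_on_iff by (metis half_gt_zero zero_less_one)
  obtain e where e: "e > 0" "cball p e \<subseteq> S"
    using \<open>open S\<close> \<open>p \<in> S\<close> open_contains_cball by blast
  \<comment> \<open>Half of \<open>d\<close>, so that the whole closed ball satisfies the strict
    inequality.\<close>
  define r where "r = min e (d / 2)"
  have r: "r > 0" "cball p r \<subseteq> S" using e d by (auto simp: r_def)
  have E: "norm (id_blinfun - E x) \<le> 1 / 2" if "x \<in> cball p r" for x
    using d(2)[of x] that r d(1) by (auto simp: Ep dist_norm norm_minus_commute r_def)
  define T where "T x = x - A (\<Theta> x)" for x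
  have T: "norm (T x - T y) \<le> 1 / 2 * norm (x - y)" if "x \<in> cball p r" "y \<in> cball p r" for x y
  proof (rule differentiable_bound[OF convex_cball[of p r] _ _ that])
    fix x assume x: "x \<in> cball p r"
    show "(T has_derivative blinfun_apply (id_blinfun - E x)) (at x within cball p r)"
    proof -
      have "(T has_derivative (\<lambda>h. h - A (D x h))) (at x)"
        unfolding T_def
        by (rule has_derivative_diff[OF has_derivative_ident
              bounded_linear.has_derivative[OF blinfun.bounded_linear_right D]]) (use x r in auto)
      moreover have "blinfun_apply (id_blinfun - E x) = (\<lambda>h. h - A (D x h))"
        by (simp add: fun_eq_iff E_def blinfun.diff_left)
      ultimately show ?thesis by (simp only: has_derivative_at_withinI)
    qed
    show "onorm (blinfun_apply (id_blinfun - E x)) \<le> 1 / 2"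
      using E[OF x] by (simp add: norm_blinfun.rep_eq)
  qed
  have Ainj: "A x = A y \<Longrightarrow> x = y" for x y
    using blinfun_compose_eq_id[OF AB(2)] by metis
  \<comment> \<open>Absorbing the contraction on the left gives injectivity on the ball and a
    Lipschitz constant for the inverse.\<close>
  have uni: "norm (x - x') \<le> 2 * norm (A (\<Theta> x - \<Theta> x'))" if "x \<in> cball p r" "x' \<in> cball p r" for x x'
  proof -
    have "x - x' = (T x - T x') + A (\<Theta> x - \<Theta> x')" by (simp add: T_def blinfun.diff_right)
    then have "norm (x - x') \<le> norm (T x - T x') + norm (A (\<Theta> x - \<Theta> x'))" by (metis norm_triangle_ineq)
    then show ?thesis using T[OF that] by simp
  qed
  define N where "N = ball p r"
  \<comment> \<open>Measuring \<open>y\<close> through \<open>A\<close> makes the two halves, one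
    from the contraction and one from \<open>y\<close>, add up to \<open>r\<close> on the closed
    ball.\<close>
  define V where "V = {y. norm (A (y - \<Theta> p)) < r / 2}"
  have pc: "p \<in> cball p r" using r by simp
  have ex: "\<exists>x\<in>N. \<Theta> x = y" if y: "y \<in> V" for y
  proof -
    have "\<exists>!x\<in>cball p r. T x + A y = x"
    proof (rule Banach_fix[of _ "1 / 2"])
      show "(\<lambda>x. T x + A y) ` cball p r \<subseteq> cball p r"
      proof (rule image_subsetI)
        fix x assume x: "x \<in> cball p r"
        have "T x + A y - p = (T x - T p) + A (y - \<Theta> p)" by (simp add: T_def blinfun.diff_right)
        then have "norm (T x + A y - p) \<le> norm (T x - T p) + norm (A (y - \<Theta> p))" by (metis norm_triangle_ineq)
        also have "\<dots> \<le> 1 / 2 * norm (x - p) + r / 2" using T[OF x pc] y by (simp add: V_def)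
        also have "\<dots> \<le> r" using x by (simp add: dist_norm norm_minus_commute)
        finally show "T x + A y \<in> cball p r" by (simp add: dist_norm norm_minus_commute)
      qed
    qed (use T r in \<open>auto simp: dist_norm complete_eq_closed\<close>)
    then obtain x where x: "x \<in> cball p r" "T x + A y = x" by blast
    then have "\<Theta> x = y" by - (rule Ainj, simp add: T_def)
    moreover have "norm (x - p) < r" using uni[OF x(1) pc] \<open>\<Theta> x = y\<close> y by (simp add: V_def)
    ultimately show ?thesis by (intro bexI[of _ x]) (auto simp: N_def dist_norm norm_minus_commute)
  qed
  define \<Xi> where "\<Xi> y = (SOME x. x \<in> N \<and> \<Theta> x = y)" for y
  have \<Xi>: "\<Xi> y \<in> N" "\<Theta> (\<Xi> y) = y" if "y \<in> V" for y
  proof -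
    have "\<exists>x. x \<in> N \<and> \<Theta> x = y" using ex[OF that] by blast
    from someI_ex[OF this] show "\<Xi> y \<in> N" "\<Theta> (\<Xi> y) = y" by (simp_all add: \<Xi>_def)
  qed
  have Nc: "x \<in> cball p r" if "x \<in> N" for x using that by (simp add: N_def)
  have "open V"
    unfolding V_def by (intro open_Collect_less continuous_intros)
  have cont: "continuous_on V \<Xi>"
  proof (rule continuous_on_subset[OF lipschitz_on_continuous_on[of "2 * norm A"]])
    show "(2 * norm A)-lipschitz_on V \<Xi>"
    proof (rule lipschitz_onI)
      fix y y' assume y: "y \<in> V" "y' \<in> V"
      have "norm (\<Xi> y - \<Xi> y') \<le> 2 * norm (A (y - y'))"
        using uni[OF Nc[OF \<Xi>(1)[OF y(1)]] Nc[OF \<Xi>(1)[OF y(2)]]] by (simp add: \<Xi> y)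
      also have "\<dots> \<le> 2 * norm A * norm (y - y')" using norm_blinfun[of A] by simp
      finally show "dist (\<Xi> y) (\<Xi> y') \<le> 2 * norm A * dist y y'" by (simp add: dist_norm)
    qed simp
  qed simp
  \<comment> \<open>\<open>E x\<close> is \<open>A\<close> after \<open>D x\<close> and close to the
    identity; with its inverse \<open>R\<close>, the inverse of \<open>D x\<close> is
    \<open>R\<close> after \<open>A\<close>, bounded uniformly in \<open>x\<close> as the regularity
    of \<open>\<Xi>\<close> requires.\<close>
  have "\<exists>w. w o\<^sub>L D x = id_blinfun \<and> D x o\<^sub>L w = id_blinfun \<and> norm w \<le> 2 * norm A" if xN: "x \<in> N" for x
  proof -
    obtain R where R: "R o\<^sub>L E x = id_blinfun" "E x o\<^sub>L R = id_blinfun" "norm R \<le> 2"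
      by (rule blinfun_inverse_near_id[OF E[OF Nc[OF xN]]])
    have "D x (R (A h)) = h" for h
      using blinfun_compose_eq_id[OF R(2), of "A h"] by - (rule Ainj, simp add: E_def)
    then have "D x o\<^sub>L (R o\<^sub>L A) = id_blinfun" by (intro blinfun_eqI) simp
    moreover have "(R o\<^sub>L A) o\<^sub>L D x = id_blinfun"
      using blinfun_compose_eq_id[OF R(1)] by (intro blinfun_eqI) (simp add: E_def)
    moreover have "norm (R o\<^sub>L A) \<le> 2 * norm A"
      using order_trans[OF norm_blinfun_compose mult_right_mono[OF R(3)]] by simp
    ultimately show ?thesis by blast
  qed
  then obtain w where w: "\<And>x. x \<in> N \<Longrightarrow> w x o\<^sub>L D x = id_blinfun" "\<And>x. x \<in> N \<Longrightarrow> D x o\<^sub>L w x = id_blinfun"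
    "\<And>x. x \<in> N \<Longrightarrow> norm (w x) \<le> 2 * norm A" by metis
  show thesis
  proof
    show "open N" "p \<in> N" using r by (auto simp: N_def)
    show "N \<subseteq> S" using r Nc by blast
    show "open V" by fact
    show "\<Theta> p \<in> V" using r by (simp add: V_def blinfun.zero_right)
    show "\<Xi> ` V \<subseteq> N" "\<And>y. y \<in> V \<Longrightarrow> \<Theta> (\<Xi> y) = y" using \<Xi> by auto
    show "\<Xi> (\<Theta> x) = x" if "x \<in> N" "\<Theta> x \<in> V" for x
      using uni[OF Nc[OF \<Xi>(1)[OF that(2)]] Nc[OF that(1)]] by (simp add: \<Xi> that blinfun.zero_right)
    show "C_on k V \<Xi>"
    proof (rule C_on_inverse[where w = "\<lambda>y. w (\<Xi> y)" and K = "2 * norm A",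
            OF C \<open>open S\<close> \<open>open V\<close> _ \<Xi>(2) cont D])
      show "\<Xi> ` V \<subseteq> S" using \<Xi> r Nc by blast
    qed (simp_all only: w \<Xi>)
  qed
qed

text \<open>Composition with the inverse \<open>J\<close> of the partial derivative brings the
  values back into the domain space, so that \<open>\<Theta> (x, l) = (J (\<Psi> (x, l)), l)\<close>
  is a self-map of the product; zeros of \<open>\<Psi>\<close> over \<open>l\<close> are the
  preimages of \<open>(0, l)\<close>.\<close>

theorem C_implicit_function:
  fixes \<Psi> :: "'e::banach \<times> 'p::banach \<Rightarrow> 'f::banach"
  assumes C: "C_on k S \<Psi>" and k: "k \<ge> 1" and "open S" "(x0, l0) \<in> S" and zero: "\<Psi> (x0, l0) = 0"
    and der: "(\<Psi> has_derivative D) (at (x0, l0))" and bij: "bij (\<lambda>a. D (a, 0))"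
  obtains N W s where "open N" "(x0, l0) \<in> N" "N \<subseteq> S" "open W" "l0 \<in> W" "C_on k W s" "s l0 = x0"
    "\<And>l. l \<in> W \<Longrightarrow> (s l, l) \<in> N \<and> \<Psi> (s l, l) = 0"
    "\<And>x l. (x, l) \<in> N \<Longrightarrow> l \<in> W \<Longrightarrow> \<Psi> (x, l) = 0 \<Longrightarrow> x = s l"
proof -
  interpret D: bounded_linear D using der by (rule has_derivative_bounded_linear)
  have blP: "bounded_linear (\<lambda>a. (a, 0))" "bounded_linear (\<lambda>b. (0, b))"
    by (auto intro!: bounded_linear_Pair bounded_linear_ident bounded_linear_zero)
  have bl1: "bounded_linear (\<lambda>a. D (a, 0))" by (rule bounded_linear_compose[OF D.bounded_linear_axioms blP(1)])
  have bl2: "bounded_linear (\<lambda>b. D (0, b))" by (rule bounded_linear_compose[OF D.bounded_linear_axioms blP(2)])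
  define J where "J = inv_into UNIV (\<lambda>a. D (a, 0))"
  have J: "bounded_linear J" unfolding J_def by (rule bounded_linear_inv[OF bl1 bij])
  interpret J: bounded_linear J by fact
  have J1: "J (D (a, 0)) = a" for a unfolding J_def by (rule inv_f_f[OF bij_is_inj[OF bij]])
  have J2: "D (J y, 0) = y" for y unfolding J_def by (rule surj_f_inv_f[OF bij_is_surj[OF bij]])
  have Dab: "D (a, b) = D (a, 0) + D (0, b)" for a b using D.add[of "(a, 0)" "(0, b)"] by simp
  define \<Theta> where "\<Theta> z = (J (\<Psi> z), snd z)" for z
  define B where "B = Blinfun (\<lambda>z. (J (D z), snd z))"
  \<comment> \<open>\<open>B\<close> is block triangular with identities on the diagonal; this is
    its inverse.\<close>
  define A where "A = Blinfun (\<lambda>z. (fst z - J (D (0, snd z)), snd z))"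
  have blB: "bounded_linear (\<lambda>z. (J (D z), snd z))"
    by (rule bounded_linear_Pair[OF bounded_linear_compose[OF J D.bounded_linear_axioms] bounded_linear_snd])
  have blA: "bounded_linear (\<lambda>z. (fst z - J (D (0, snd z)), snd z))"
    by (rule bounded_linear_Pair[OF bounded_linear_sub[OF bounded_linear_fst
            bounded_linear_compose[OF J bounded_linear_compose[OF bl2 bounded_linear_snd]]] bounded_linear_snd])
  have A: "A z = (fst z - J (D (0, snd z)), snd z)" and B: "B z = (J (D z), snd z)" for z
    by (simp_all only: A_def B_def bounded_linear_Blinfun_apply blA blB)
  have JD: "J (D (a, b)) = a + J (D (0, b))" for a b
    unfolding Dab[of a b] J.add J1 ..
  have AB: "A o\<^sub>L B = id_blinfun" "B o\<^sub>L A = id_blinfun"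
  proof (rule blinfun_eqI)
    fix z
    show "(A o\<^sub>L B) z = id_blinfun z"
      using JD[of "fst z" "snd z"] by (simp add: A B prod_eq_iff)
  next
    show "B o\<^sub>L A = id_blinfun"
    proof (rule blinfun_eqI)
      fix z
      show "(B o\<^sub>L A) z = id_blinfun z"
        using JD[of "fst z - J (D (0, snd z))" "snd z"] by (simp add: A B prod_eq_iff)
    qed
  qed
  have CT: "C_on k S \<Theta>"
    unfolding \<Theta>_def by (rule C_on_Pair[OF C_on_bounded_linear[OF J C] C_on_linear[OF bounded_linear_snd]])
  have derT: "(\<Theta> has_derivative B) (at (x0, l0))"
    unfolding \<Theta>_def B_def bounded_linear_Blinfun_apply[OF blB]
    by (rule has_derivative_Pair[OF bounded_linear.has_derivative[OF J der]
          bounded_linear.has_derivative[OF bounded_linear_snd has_derivative_ident]])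
  obtain N V \<Xi> where NV: "open N" "(x0, l0) \<in> N" "N \<subseteq> S" "open V" "\<Theta> (x0, l0) \<in> V" "\<Xi> ` V \<subseteq> N"
    "\<And>y. y \<in> V \<Longrightarrow> \<Theta> (\<Xi> y) = y" "\<And>x. x \<in> N \<Longrightarrow> \<Theta> x \<in> V \<Longrightarrow> \<Xi> (\<Theta> x) = x" "C_on k V \<Xi>"
    by (rule C_inverse_function[OF CT k \<open>open S\<close> \<open>(x0, l0) \<in> S\<close> derT AB]) (rule that)
  define W where "W = (\<lambda>l. (0, l)) -` V"
  define s where "s l = fst (\<Xi> (0, l))" for l
  have \<Theta>0: "\<Theta> (x, l) = (0, l)" if "\<Psi> (x, l) = 0" for x l by (simp add: \<Theta>_def that J.zero)
  have s: "\<Xi> (0, l) = (s l, l)" "(s l, l) \<in> N" "\<Psi> (s l, l) = 0" if "l \<in> W" for l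
  proof -
    have *: "(0, l) \<in> V" using that by (simp add: W_def)
    have "snd (\<Xi> (0, l)) = l" "J (\<Psi> (\<Xi> (0, l))) = 0"
      using NV(7)[OF *] by (auto simp: \<Theta>_def)
    then show "\<Xi> (0, l) = (s l, l)" by (simp add: s_def prod_eq_iff)
    then show "(s l, l) \<in> N" using NV(6) * by (metis image_subset_iff)
    have "\<Psi> (\<Xi> (0, l)) = 0"
      using J2[of "\<Psi> (\<Xi> (0, l))"] \<open>J (\<Psi> (\<Xi> (0, l))) = 0\<close> D.zero by (simp add: zero_prod_def)
    then show "\<Psi> (s l, l) = 0" by (simp add: \<open>\<Xi> (0, l) = (s l, l)\<close>)
  qed
  have uniq: "x = s l" if "(x, l) \<in> N" "l \<in> W" "\<Psi> (x, l) = 0" for x l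
  proof -
    have "\<Xi> (0, l) = (x, l)"
      using NV(8)[OF that(1)] \<Theta>0[OF that(3)] that(2) by (simp add: W_def)
    then show ?thesis by (simp add: s_def)
  qed
  have l0: "l0 \<in> W" using NV(5) \<Theta>0[OF zero] by (simp add: W_def)
  show thesis
  proof
    show "open W" unfolding W_def by (rule open_vimage[OF \<open>open V\<close>]) (intro continuous_intros)
    show "C_on k W s"
    proof -
      have "C_on k W (\<lambda>l. \<Xi> (0, l))"
        by (rule C_on_precompose[OF _ _ NV(9)]) (auto simp: linear_iff W_def)
      from C_on_bounded_linear[OF bounded_linear_fst this] show ?thesis unfolding s_def .
    qed
    show "s l0 = x0" using uniq[OF NV(2) l0 zero] by simp
    show "(s l, l) \<in> N \<and> \<Psi> (s l, l) = 0" if "l \<in> W" for l using s[OF that] by simp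
    show "open N" "(x0, l0) \<in> N" "N \<subseteq> S" "l0 \<in> W" by (rule NV l0)+
    show "x = s l" if "(x, l) \<in> N" "l \<in> W" "\<Psi> (x, l) = 0" for x l by (rule uniq[OF that])
  qed
qed

section \<open>The zero set near a degenerate zero\<close>

lemma orthonormal_basis_exists:
  fixes b :: "'e::real_vector \<Rightarrow> 'e \<Rightarrow> real"
  assumes lin: "\<And>u. linear (b u)" and sym: "\<And>u v. b u v = b v u" and pos: "\<And>u. u \<noteq> 0 \<Longrightarrow> b u u > 0"
    and "finite B"
  shows "\<exists>U. finite U \<and> span U = span B \<and> (\<forall>u\<in>U. \<forall>v\<in>U. b u v = (if u = v then 1 else 0))"
  using \<open>finite B\<close>
proof (induction B)
  case empty
  then show ?case by (intro exI[of _ "{}"]) simp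
next
  case (insert a B)
  then obtain U where U: "finite U" "span U = span B" "\<And>u v. u \<in> U \<Longrightarrow> v \<in> U \<Longrightarrow> b u v = (if u = v then 1 else 0)"
    by blast
  define s where "s = (\<Sum>u\<in>U. b u a *\<^sub>R u)"
  define a' where "a' = a - s"
  have s: "s \<in> span U" unfolding s_def by (intro span_sum span_scale span_base)
  have orth: "b u a' = 0" if "u \<in> U" for u
  proof -
    have "b u s = (\<Sum>v\<in>U. b v a * b u v)"
      unfolding s_def by (simp add: linear_sum[OF lin] linear_scale[OF lin])
    also have "\<dots> = (\<Sum>v\<in>U. if u = v then b v a else 0)"
      by (rule sum.cong) (simp_all add: U(3) that)
    also have "\<dots> = b u a" using U(1) that by simp
    finally show ?thesis by (simp add: a'_def linear_diff[OF lin])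
  qed
  show ?case
  \<comment> \<open>\<open>a'\<close> is the component of \<open>a\<close> orthogonal to
    \<open>U\<close>; if it vanishes, \<open>a\<close> adds nothing to the span.\<close>
  proof (cases "a' = 0")
    case True
    then have "a \<in> span B" using s U(2) by (simp add: a'_def)
    then have "span (insert a B) = span B" by (rule span_redundant)
    with U show ?thesis by metis
  next
    case False
    define c where "c = 1 / sqrt (b a' a')"
    have c: "c > 0" "c * c * b a' a' = 1"
      using pos[OF False] by (simp_all add: c_def power_divide flip: power2_eq_square)
    define u0 where "u0 = c *\<^sub>R a'"
    have b0: "b u0 u0 = 1"
      using c(2) by (simp add: u0_def linear_scale[OF lin] sym[of "c *\<^sub>R a'"])
    have orth0: "b u u0 = 0" "b u0 u = 0" if "u \<in> U" for u
      using orth[OF that] by (simp_all add: u0_def linear_scale[OF lin] sym[of "c *\<^sub>R a'"])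
    have "u0 \<notin> U" using orth0(1)[of u0] b0 by auto
    have "span (insert u0 U) = span (insert a U)"
    proof (rule span_eq[THEN iffD2], intro conjI subsetI)
      fix x assume "x \<in> insert u0 U"
      moreover have "u0 \<in> span (insert a U)"
      proof -
        have "s \<in> span (insert a U)" using s span_mono[OF subset_insertI[of U a]] by blast
        then show ?thesis
          unfolding u0_def a'_def by (intro span_scale span_diff[OF span_base]) simp_all
      qed
      ultimately show "x \<in> span (insert a U)" by (auto intro: span_base)
    next
      fix x assume "x \<in> insert a U"
      moreover have "a \<in> span (insert u0 U)"
      proof -
        have "s \<in> span (insert u0 U)" using s span_mono[OF subset_insertI[of U u0]] by blast
        then have "(1 / c) *\<^sub>R u0 + s \<in> span (insert u0 U)"
          by (rule span_add[OF span_scale[OF span_base[OF insertI1]]])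
        moreover have "a = (1 / c) *\<^sub>R u0 + s" using c by (simp add: u0_def a'_def)
        ultimately show ?thesis by simp
      qed
      ultimately show "x \<in> span (insert u0 U)" by (auto intro: span_base)
    qed
    also have "\<dots> = span (insert a B)"
      using U(2) by (simp add: span_insert)
    finally have "span (insert u0 U) = span (insert a B)" .
    moreover have "b u v = (if u = v then 1 else 0)" if "u \<in> insert u0 U" "v \<in> insert u0 U" for u v
      using that U(3)[of u v] orth0 b0 \<open>u0 \<notin> U\<close> by auto
    ultimately show ?thesis using U(1) by (intro exI[of _ "insert u0 U"]) simp
  qed
qed

text \<open>An index type for a Euclidean space that maps onto \<open>'h\<close>: a finite-dimensional normed space is not
  of class \<open>euclidean_space\<close>, for which alone Brouwer's theorem is available.  The element \<open>None\<close>
  makes the type nonempty.\<close>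

typedef (overloaded) ('h::real_vector) idx =
  "insert None (if \<exists>B::'h set. finite B \<and> span B = UNIV
     then Some ` (SOME B::'h set. finite B \<and> span B = UNIV) else {})"
  by blast

lemma finite_idx_set: "finite (insert None (if \<exists>B::'h::real_vector set. finite B \<and> span B = UNIV
     then Some ` (SOME B::'h set. finite B \<and> span B = UNIV) else {}))"
proof (cases "\<exists>B::'h set. finite B \<and> span B = UNIV")
  case True
  then show ?thesis using finite_imageI[OF conjunct1[OF someI_ex[OF True]], of Some] by simp
next
  case False
  then show ?thesis by (simp only: if_False finite.intros)
qed

instance idx :: (real_vector) finite
proof
  show "finite (UNIV :: 'a idx set)"
    using finite_imageI[OF finite_idx_set[where 'h = 'a], of Abs_idx]
    unfolding type_definition.Abs_image[OF type_definition_idx] .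
qed

lemma euclidean_surjection:
  assumes "\<exists>B::'h::real_normed_vector set. finite B \<and> span B = UNIV"
  obtains R :: "(real, 'h::real_normed_vector idx) vec \<Rightarrow> 'h" where "linear R" "surj R"
proof -
  define B where "B = (SOME B::'h set. finite B \<and> span B = UNIV)"
  have B: "finite B" "span B = UNIV" using someI_ex[OF assms] by (simp_all add: B_def)
  define ix where "ix b = Abs_idx (Some b)" for b :: 'h
  have ix: "Rep_idx (ix b) = Some b" if "b \<in> B" for b
    unfolding ix_def using that assms by (intro Abs_idx_inverse) (simp add: B_def)
  \<comment> \<open>A linear combination of the basis fixed in the type \<open>idx\<close>; the
    coordinate of index \<open>None\<close> is dropped.\<close>
  define R where "R r = (\<Sum>b\<in>B. (r $ ix b) *\<^sub>R b)" for r :: "(real, 'h idx) vec"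
  show thesis
  proof
    show "linear R"
      unfolding R_def by (rule linearI) (simp_all add: scaleR_add_left sum.distrib scaleR_sum_right)
    have "h \<in> range R" for h
    proof -
      have "h \<in> span B" using B by simp
      then obtain u where u: "h = (\<Sum>b\<in>B. u b *\<^sub>R b)" using span_finite[OF B(1)] by auto
      have "R (\<chi> i. u (the (Rep_idx i))) = h"
        unfolding R_def u by (rule sum.cong) (simp_all add: ix)
      then show ?thesis by (metis rangeI)
    qed
    then show "surj R" by blast
  qed
qed

text \<open>\<open>Q\<close> after \<open>T\<close> is the identity on \<open>range Q\<close>, so
  there \<open>r - Q (y x r - x0)\<close> is \<open>- Q\<close> of the remainder
  \<open>y x r - x0 - T r\<close>; elsewhere the linear parts need not cancel. The remainder is
  small relative to the radius, by differentiability at 0 for \<open>x0\<close> and by joint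
  continuity for nearby \<open>x\<close>. So a ball of \<open>range Q\<close> is mapped to
  itself.\<close>

lemma brouwer_slice:
  fixes y :: "'e::real_normed_vector \<Rightarrow> 'n::euclidean_space \<Rightarrow> 'e" and Q :: "'e \<Rightarrow> 'n"
  assumes "open O1" "x0 \<in> O1" "open O2" "0 \<in> O2" and cont: "continuous_on (O1 \<times> O2) (\<lambda>(x, r). y x r)"
    and der: "(y x0 has_derivative T) (at 0)" and y0: "y x0 0 = x0"
    and Q: "bounded_linear Q" and QTQ: "\<And>v. Q (T (Q v)) = Q v" and "open N2" "x0 \<in> N2"
  obtains N1 where "open N1" "x0 \<in> N1" "N1 \<subseteq> O1" "\<And>x. x \<in> N1 \<Longrightarrow> \<exists>r\<in>O2. y x r \<in> N2 \<and> Q (y x r - x0) = 0"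
proof -
  interpret Q: bounded_linear Q by fact
  obtain K where K: "K > 0" "\<And>v. norm (Q v) \<le> norm v * K" using Q.pos_bounded by blast
  obtain e where e: "e > 0" "ball x0 e \<subseteq> N2"
    using \<open>open N2\<close> \<open>x0 \<in> N2\<close> by (meson open_contains_ball)
  obtain e2 where e2: "e2 > 0" "cball 0 e2 \<subseteq> O2"
    using \<open>open O2\<close> \<open>0 \<in> O2\<close> by (meson open_contains_cball)
  have "1 / (2 * K) > 0" using K by simp
  then obtain d1 where d1: "d1 > 0"
    "\<And>r. norm (r - 0) < d1 \<Longrightarrow> norm (y x0 r - y x0 0 - T (r - 0)) \<le> 1 / (2 * K) * norm (r - 0)"
    using der[unfolded has_derivative_at_alt, THEN conjunct2, rule_format, OF \<open>1 / (2 * K) > 0\<close>] by blast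
  have "isCont (y x0) 0" by (rule has_derivative_continuous[OF der])
  then obtain d2 where d2: "d2 > 0" "\<And>r. dist r 0 < d2 \<Longrightarrow> dist (y x0 r) (y x0 0) < e / 2"
    unfolding continuous_at_eps_delta using half_gt_zero[OF e(1)] by blast
  define r0 where "r0 = min e2 (min (d1 / 2) (d2 / 2))"
  have r0: "r0 > 0" "cball 0 r0 \<subseteq> O2" "r0 < d1" "r0 < d2"
    using e2 d1(1) d2(1) by (auto simp: r0_def)
  define C where "C = cball 0 r0 \<inter> range Q"
  have sub: "subspace (range Q)" by (rule linear_subspace_image[OF Q.linear_axioms subspace_UNIV])
  have "compact C" unfolding C_def by (intro compact_Int_closed compact_cball closed_subspace sub)
  have "convex C" unfolding C_def by (intro convex_Int convex_cball subspace_imp_convex sub)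
  have "0 \<in> C" using r0(1) by (auto simp: C_def intro: subspace_0[OF sub])
  have CO2: "C \<subseteq> O2" using r0 by (auto simp: C_def)
  \<comment> \<open>\<open>r0 / (2 * K)\<close> is half of what the remainder may amount to before
    \<open>Q\<close> multiplies it by at most \<open>K\<close>; the other half goes to the error of
    differentiation. \<open>e / 4\<close> and the \<open>e / 2\<close> from \<open>d2\<close>
    together stay below \<open>e\<close>.\<close>
  define \<epsilon> where "\<epsilon> = min (e / 4) (r0 / (2 * K))"
  have "\<epsilon> > 0" using e r0 K by (simp add: \<epsilon>_def)
  have "continuous_on (O1 \<times> C) (\<lambda>(x, r). y x r)"
    using CO2 by (intro continuous_on_subset[OF cont]) auto
  \<comment> \<open>Compactness of \<open>C\<close> makes one neighbourhood of \<open>x0\<close>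
    work for all \<open>r\<close> in \<open>C\<close>.\<close>
  then obtain X0 where X0': "x0 \<in> X0" "open X0"
    "\<forall>x\<in>X0 \<inter> O1. \<forall>r\<in>C. dist ((\<lambda>(x, r). y x r) (x, r)) ((\<lambda>(x, r). y x r) (x0, r)) \<le> \<epsilon>"
    by (rule continuous_on_prod_compactE[OF _ \<open>compact C\<close> \<open>x0 \<in> O1\<close> \<open>\<epsilon> > 0\<close>]) (rule that)
  have X0: "x0 \<in> X0" "open X0" "\<And>x r. x \<in> X0 \<inter> O1 \<Longrightarrow> r \<in> C \<Longrightarrow> dist (y x r) (y x0 r) \<le> \<epsilon>"
    using X0'(1,2) X0'(3)[THEN bspec, THEN bspec] by simp_all
  show thesis
  proof
    show "open (X0 \<inter> O1)" "x0 \<in> X0 \<inter> O1" "X0 \<inter> O1 \<subseteq> O1" using X0 assms by auto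
    fix x assume x: "x \<in> X0 \<inter> O1"
    define \<Gamma> where "\<Gamma> r = r - Q (y x r - x0)" for r
    have "continuous_on C (y x)"
      using x CO2 by (intro continuous_on_compose2[OF cont, of C "\<lambda>r. (x, r)", simplified] continuous_intros) auto
    then have "continuous_on C \<Gamma>"
      unfolding \<Gamma>_def by (intro continuous_intros bounded_linear.continuous_on[OF Q])
    moreover have "\<Gamma> r \<in> C" if rC: "r \<in> C" for r
    proof -
      obtain v where v: "r = Q v" using rC unfolding C_def by blast
      have "norm r \<le> r0" using rC by (simp add: C_def)
      have 1: "\<Gamma> r = - Q (y x r - x0 - T r)"
        by (simp add: \<Gamma>_def Q.diff v QTQ)
      have 2: "y x r - x0 - T r = (y x r - y x0 r) + (y x0 r - y x0 0 - T (r - 0))" by (simp add: y0)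
      have "norm (\<Gamma> r) \<le> norm ((y x r - y x0 r) + (y x0 r - y x0 0 - T (r - 0))) * K"
        unfolding 1 norm_minus_cancel 2 by (rule K(2))
      also have "\<dots> \<le> (norm (y x r - y x0 r) + norm (y x0 r - y x0 0 - T (r - 0))) * K"
        by (rule mult_right_mono[OF norm_triangle_ineq]) (use K(1) in simp)
      finally have G: "norm (\<Gamma> r) \<le> (norm (y x r - y x0 r) + norm (y x0 r - y x0 0 - T (r - 0))) * K" .
      have "norm (y x r - y x0 r) \<le> r0 / (2 * K)"
        using X0(3)[OF x rC] by (simp add: dist_norm \<epsilon>_def)
      moreover have "norm (y x0 r - y x0 0 - T (r - 0)) \<le> r0 / (2 * K)"
      proof (rule order_trans[OF d1(2)])
        show "norm (r - 0) < d1" using \<open>norm r \<le> r0\<close> r0 by simp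
        show "1 / (2 * K) * norm (r - 0) \<le> r0 / (2 * K)"
          using \<open>norm r \<le> r0\<close> K(1) by (simp add: divide_right_mono)
      qed
      ultimately have "norm (\<Gamma> r) \<le> (r0 / (2 * K) + r0 / (2 * K)) * K"
        using K(1) by (intro order_trans[OF G mult_right_mono]) auto
      also have "\<dots> = r0" using K by simp
      finally have "norm (\<Gamma> r) \<le> r0" .
      moreover have "\<Gamma> r \<in> range Q"
        unfolding \<Gamma>_def v by (intro subspace_diff[OF sub]) auto
      ultimately show ?thesis by (simp add: C_def)
    qed
    ultimately obtain r where r: "r \<in> C" "\<Gamma> r = r"
      using brouwer[OF \<open>compact C\<close> \<open>convex C\<close>, of \<Gamma>] \<open>0 \<in> C\<close> by blast
    have "dist (y x r) x0 \<le> dist (y x r) (y x0 r) + dist (y x0 r) (y x0 0)"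
      using dist_triangle y0 by metis
    also have "\<dots> < e"
      using X0(3)[OF x r(1)] d2(2)[of r] r(1) r0 e(1) by (auto simp: C_def \<epsilon>_def)
    finally have "y x r \<in> N2" using e(2) by (auto simp: dist_commute)
    then show "\<exists>r\<in>O2. y x r \<in> N2 \<and> Q (y x r - x0) = 0"
      using r CO2 by (intro bexI[of _ r]) (auto simp: \<Gamma>_def)
  qed
qed

section \<open>Index zero, the range of the linearization and the local zero set\<close>

lemma codim_attained:
  assumes "fredholm T"
  obtains C where "finite C" "card C = codim (range T)" "span (range T \<union> C) = UNIV"
proof -
  have "\<exists>n C. finite C \<and> card C = n \<and> span (range T \<union> C) = UNIV"
    using assms unfolding fredholm_def by blast
  then have "\<exists>C. finite C \<and> card C = codim (range T) \<and> span (range T \<union> C) = UNIV"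
    unfolding codim_def by (rule LeastI_ex)
  then show thesis using that by blast
qed

text \<open>In the application \<open>J\<close> and \<open>I\<close> represent \<open>j\<close> and \<open>i\<close> over \<open>x0\<close>, \<open>J'\<close> represents \<open>j'\<close>, \<open>s\<close> the
  extension of \<open>\<kappa> \<circ> d\<beta>(1)\<close>, and \<open>\<beta>\<close> the derivative at 1 of the orbit map of \<open>x0\<close>.  The map \<open>R\<close>
  only serves to pass to a space of class \<open>euclidean_space\<close>.\<close>

locale degenerate_zero =
  fixes k :: nat and \<Phi> :: "'e::banach \<times> 'p::banach \<Rightarrow> 'f::banach" and U :: "'e set" and W :: "'p set"
    and x0 :: 'e and l0 :: 'p and L :: "'e \<Rightarrow>\<^sub>L 'f" and J :: "'f \<Rightarrow>\<^sub>L 'e \<Rightarrow>\<^sub>L real" and I :: "'e \<Rightarrow>\<^sub>L 'f"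
    and J' :: "'e \<Rightarrow> 'f \<Rightarrow>\<^sub>L 'y::banach \<Rightarrow>\<^sub>L real" and s :: "'e \<Rightarrow> 'h::banach \<Rightarrow>\<^sub>L 'y" and \<beta> :: "'h \<Rightarrow> 'e"
    and R :: "'n::euclidean_space \<Rightarrow> 'h"
  assumes k: "k \<ge> 1" and UW: "open U" "open W" "x0 \<in> U" "l0 \<in> W"
    and C: "C_on k (U \<times> W) \<Phi>" and zero: "\<Phi> (x0, l0) = 0"
    and L: "((\<lambda>x. \<Phi> (x, l0)) has_derivative L) (at x0)" and fred: "fredholm L" "fredholm_index L = 0"
    and sym: "\<And>u v. J (I u) v = J (I v) u" and pos: "\<And>u. u \<noteq> 0 \<Longrightarrow> J (I u) u > 0"
    and cont: "continuous_on U J'" "continuous_on U s"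
    and ann: "\<And>x l w. x \<in> U \<Longrightarrow> l \<in> W \<Longrightarrow> J' x (\<Phi> (x, l)) (s x w) = 0"
    and J': "\<And>e w. J' x0 e (s x0 w) = J e (\<beta> w)"
    and \<beta>: "linear \<beta>" "range \<beta> = {v. L v = 0}"
    and R: "linear R" "surj R"
begin

text \<open>The identity \<open>ann\<close> can be differentiated at \<open>x0\<close> although \<open>J'\<close> and \<open>s\<close> are merely continuous,
  because \<open>\<Phi>\<close> vanishes there.\<close>

lemma J_L: "J (L h) (\<beta> w) = 0"
proof -
  have cJ: "isCont J' x0" and cs: "isCont s x0"
    using cont UW by (simp_all add: continuous_on_eq_continuous_at)
  have 1: "((\<lambda>x. J' x (\<Phi> (x, l0))) has_derivative (\<lambda>h. J' x0 (L h))) (at x0)"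
    by (rule bounded_bilinear_has_derivative_right[OF bounded_bilinear_blinfun_apply cJ L zero])
  have "isCont (\<lambda>x. s x w) x0"
    using bounded_linear.continuous[OF blinfun.bounded_linear_left cs] .
  from bounded_bilinear_has_derivative_right[OF bounded_bilinear.flip[OF bounded_bilinear_blinfun_apply] this 1]
  have 2: "((\<lambda>x. J' x (\<Phi> (x, l0)) (s x w)) has_derivative (\<lambda>h. J' x0 (L h) (s x0 w))) (at x0)"
    by (simp add: zero)
  have "((\<lambda>x. J' x (\<Phi> (x, l0)) (s x w)) has_derivative (\<lambda>h. 0)) (at x0)"
    by (rule has_derivative_transform_within_open[OF has_derivative_const[of 0] UW(1,3)]) (simp add: ann UW(4))
  from has_derivative_unique[OF 2 this] show ?thesis by (simp add: fun_eq_iff J')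
qed

lemma kernel_basis:
  obtains B where "finite B" "span B = {v. L v = 0}"
    "\<And>u v. u \<in> B \<Longrightarrow> v \<in> B \<Longrightarrow> J (I u) v = (if u = v then 1 else 0)"
proof -
  obtain B0 where B0: "finite B0" "span B0 = {v. L v = 0}" using fred(1) unfolding fredholm_def by blast
  have "linear (blinfun_apply (J (I u)))" for u
    by (rule bounded_linear.linear[OF blinfun.bounded_linear_right])
  then have "\<exists>B. finite B \<and> span B = span B0 \<and> (\<forall>u\<in>B. \<forall>v\<in>B. J (I u) v = (if u = v then 1 else 0))"
    by (intro orthonormal_basis_exists B0(1) sym pos)
  then obtain B where "finite B" "span B = span B0" "\<forall>u\<in>B. \<forall>v\<in>B. J (I u) v = (if u = v then 1 else 0)"
    by (elim exE conjE) (rule that)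
  then show thesis using B0(2) by (intro that[of B]) simp_all
qed

lemma J_L_kernel: "L v = 0 \<Longrightarrow> J (L h) v = 0"
  using J_L[of h] \<beta>(2) by (metis (mono_tags, lifting) mem_Collect_eq rangeE)

text \<open>\<open>q\<close> kills the range of \<open>L\<close> and fixes the \<open>card B\<close>
  independent vectors \<open>I u\<close>. A smallest set \<open>C\<close> spanning the space
  together with the range also has \<open>card B\<close> elements, by index 0, and its image under
  \<open>q\<close> spans all \<open>I u\<close>. So \<open>q\<close> is injective on the span of
  \<open>C\<close>, and a vector killed by \<open>q\<close> has no component there.\<close>

lemma range_L:
  assumes B: "finite B" "span B = {v. L v = 0}"
    and on: "\<And>u v. u \<in> B \<Longrightarrow> v \<in> B \<Longrightarrow> J (I u) v = (if u = v then 1 else 0)"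
    and e: "\<And>u. u \<in> B \<Longrightarrow> J e u = 0"
  shows "e \<in> range L"
proof -
  define q where "q e = (\<Sum>u\<in>B. J e u *\<^sub>R I u)" for e
  have linq: "linear q"
    unfolding q_def by (rule linearI)
      (simp_all add: blinfun.bilinear_simps scaleR_add_left sum.distrib scaleR_sum_right)
  have qI: "q (I u) = I u" if "u \<in> B" for u
  proof -
    have "q (I u) = (\<Sum>v\<in>B. if v = u then I v else 0)"
      unfolding q_def by (rule sum.cong) (simp_all add: on that)
    then show ?thesis using B(1) that by simp
  qed
  have qL: "q (L h) = 0" for h
    unfolding q_def using J_L_kernel B(2) span_base[of _ B] by (intro sum.neutral) auto
  \<comment> \<open>Orthonormality reads off coefficients; both independence statements below rest
    on this.\<close>
  have J0: "J (\<Sum>u\<in>B. c u *\<^sub>R I u) v = c v" if "v \<in> B" for c v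
  proof -
    have "J (\<Sum>u\<in>B. c u *\<^sub>R I u) v = (\<Sum>u\<in>B. if u = v then c u else 0)"
      unfolding blinfun.sum_right blinfun.sum_left blinfun.scaleR_right blinfun.scaleR_left
      by (rule sum.cong) (simp_all add: on that)
    then show ?thesis using B(1) that by simp
  qed
  have inj: "inj_on I B"
    using on by (intro inj_onI) (metis zero_neq_one)
  have indB: "independent B"
  proof (rule independent_if_scalars_zero[OF B(1)])
    fix c v assume "(\<Sum>x\<in>B. c x *\<^sub>R x) = 0" "v \<in> B"
    then have "I (\<Sum>x\<in>B. c x *\<^sub>R x) = 0" by (simp add: blinfun.zero_right)
    then have "(\<Sum>x\<in>B. c x *\<^sub>R I x) = 0" by (simp add: blinfun.sum_right blinfun.scaleR_right)
    with J0[OF \<open>v \<in> B\<close>, of c] show "c v = 0" by (simp add: blinfun.zero_right blinfun.zero_left)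
  qed
  have indI: "independent (I ` B)"
  proof (rule independent_if_scalars_zero[OF finite_imageI[OF B(1)]])
    fix c w assume *: "(\<Sum>x\<in>I ` B. c x *\<^sub>R x) = 0" "w \<in> I ` B"
    then obtain v where v: "v \<in> B" "w = I v" by blast
    have "(\<Sum>x\<in>B. c (I x) *\<^sub>R I x) = 0"
      using *(1) by (simp add: sum.reindex[OF inj])
    with J0[OF v(1), of "\<lambda>x. c (I x)"] show "c w = 0" by (simp add: v blinfun.zero_right blinfun.zero_left)
  qed
  have "dim {v. L v = 0} = card B"
    using dim_span_eq_card_independent[OF indB] B(2) by simp
  then have "codim (range L) = card B" using fred(2) by (simp add: fredholm_index_def)
  then obtain C where C: "finite C" "card C = card B" "span (range L \<union> C) = UNIV"
    using codim_attained[OF fred(1)] by metis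
  have subL: "span (range L) = range L"
    using linear_subspace_image[OF bounded_linear.linear[OF blinfun.bounded_linear_right] subspace_UNIV]
    by (simp add: span_eq_iff)
  have dec: "\<exists>h c. e = L h + (\<Sum>x\<in>C. c x *\<^sub>R x)" for e
  proof -
    have "e \<in> span (range L \<union> C)" using C(3) by simp
    then show ?thesis unfolding span_Un subL span_finite[OF C(1)] by auto
  qed
  have qsum: "q (L h + (\<Sum>x\<in>C. c x *\<^sub>R x)) = (\<Sum>x\<in>C. c x *\<^sub>R q x)" for h c
    by (simp add: linear_add[OF linq] linear_sum[OF linq] linear_scale[OF linq] qL)
  \<comment> \<open>With a nonzero coefficient, \<open>q x\<close> would depend on the other images,
    and fewer than \<open>card B\<close> vectors would span the independent
    \<open>I u\<close>.\<close>
  have zero_coeff: "c x = 0" if sum0: "(\<Sum>x\<in>C. c x *\<^sub>R q x) = 0" and x: "x \<in> C" for c x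
  proof (rule ccontr)
    assume cx: "c x \<noteq> 0"
    have "q x = (1 / c x) *\<^sub>R (c x *\<^sub>R q x)" using cx by simp
    also have "c x *\<^sub>R q x = - (\<Sum>z\<in>C - {x}. c z *\<^sub>R q z)"
      using sum0 sum.remove[OF C(1) x, of "\<lambda>z. c z *\<^sub>R q z"] by (simp add: eq_neg_iff_add_eq_0)
    finally have qx_eq: "q x = (1 / c x) *\<^sub>R - (\<Sum>z\<in>C - {x}. c z *\<^sub>R q z)" .
    have qx: "q x \<in> span (q ` (C - {x}))"
      unfolding qx_eq by (intro span_scale span_neg span_sum span_base) simp
    have "I ` B \<subseteq> span (q ` (C - {x}))"
    proof
      fix w assume "w \<in> I ` B"
      then obtain u where u: "u \<in> B" "w = I u" by blast
      obtain h d where wd: "w = L h + (\<Sum>x\<in>C. d x *\<^sub>R x)" using dec[of w] by (elim exE)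
      have "w = q w" using qI[OF u(1)] u(2) by simp
      also have "\<dots> = (\<Sum>z\<in>C. d z *\<^sub>R q z)" unfolding wd by (rule qsum)
      finally have "w = (\<Sum>z\<in>C. d z *\<^sub>R q z)" .
      also have "\<dots> \<in> span (q ` (C - {x}))"
      proof (intro span_sum span_scale)
        fix z assume "z \<in> C"
        then show "q z \<in> span (q ` (C - {x}))"
          using qx by (cases "z = x") (auto intro: span_base)
      qed
      finally show "w \<in> span (q ` (C - {x}))" .
    qed
    then have "card (I ` B) \<le> card (q ` (C - {x}))"
      using independent_span_bound[OF _ indI, of "q ` (C - {x})"] C(1) by auto
    also have "\<dots> \<le> card (C - {x})" by (rule card_image_le) (use C in auto)
    also have "\<dots> < card C" by (rule card_Diff1_less[OF C(1) x])
    finally show False using card_image[OF inj] C(2) by simp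
  qed
  obtain h c where hc: "e = L h + (\<Sum>x\<in>C. c x *\<^sub>R x)" using dec[of e] by (elim exE)
  have "q e = 0" unfolding q_def by (rule sum.neutral) (simp add: e)
  then have "(\<Sum>x\<in>C. c x *\<^sub>R q x) = 0" unfolding hc qsum .
  then have "(\<Sum>x\<in>C. c x *\<^sub>R x) = 0" using zero_coeff by (intro sum.neutral) simp
  then show ?thesis using hc by simp
qed

text \<open>\<open>P\<close> is the orthogonal projection onto \<open>ker L\<close>,
  \<open>q\<close> the projection onto \<open>I (ker L)\<close> along the range of \<open>L\<close>,
  and \<open>Q\<close> lifts \<open>P\<close> to group parameters:
  \<open>\<beta> (R (Q v)) = P v\<close>. Thus \<open>Q (x - x0) = 0\<close> is the slice condition
  \<open>P (x - x0) = 0\<close>.\<close>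

theorem zero_set:
  obtains Q :: "'e \<Rightarrow> 'n" and N V \<sigma> where "bounded_linear Q" "\<And>v. Q (\<beta> (R (Q v))) = Q v"
    "open N" "(x0, l0) \<in> N" "N \<subseteq> U \<times> W" "open V" "l0 \<in> V" "C_on k V \<sigma>" "\<sigma> l0 = x0"
    "\<And>l. l \<in> V \<Longrightarrow> (\<sigma> l, l) \<in> N \<and> \<Phi> (\<sigma> l, l) = 0"
    "\<And>x l. (x, l) \<in> N \<Longrightarrow> l \<in> V \<Longrightarrow> \<Phi> (x, l) = 0 \<Longrightarrow> Q (x - x0) = 0 \<Longrightarrow> x = \<sigma> l"
proof -
  obtain B where B: "finite B" "span B = {v. L v = 0}"
    and on: "\<And>u v. u \<in> B \<Longrightarrow> v \<in> B \<Longrightarrow> J (I u) v = (if u = v then 1 else 0)"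
    by (rule kernel_basis) (rule that)
  have BL: "L u = 0" if "u \<in> B" for u using B(2) span_base[OF that] by auto
  \<comment> \<open>\<open>\<beta>\<close> may have a kernel; any choice of preimages
    serves.\<close>
  have "\<exists>w. \<beta> w = u" if "u \<in> B" for u
    using BL[OF that] \<beta>(2) by (metis (mono_tags, lifting) mem_Collect_eq rangeE)
  then obtain w where w: "\<And>u. u \<in> B \<Longrightarrow> \<beta> (w u) = u" by metis
  obtain r where r: "\<And>h. R (r h) = h" using R(2) by (metis surjD)
  define P where "P v = (\<Sum>u\<in>B. J (I u) v *\<^sub>R u)" for v
  define Q where "Q v = (\<Sum>u\<in>B. J (I u) v *\<^sub>R r (w u))" for v
  define q where "q e = (\<Sum>u\<in>B. J e u *\<^sub>R I u)" for e
  have blP: "bounded_linear P" and blQ: "bounded_linear Q"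
    unfolding P_def Q_def
    by (rule bounded_linear_sum[OF bounded_linear_scaleR_const[OF blinfun.bounded_linear_right]])+
  have blq: "bounded_linear q"
    unfolding q_def
    by (rule bounded_linear_sum[OF bounded_linear_scaleR_const[OF
            bounded_linear_compose[OF blinfun.bounded_linear_left blinfun.bounded_linear_right]]])
  have Jq: "J (q e) v = J e v" if "v \<in> B" for e v
  proof -
    have "J (q e) v = (\<Sum>u\<in>B. if u = v then J e u else 0)"
      unfolding q_def blinfun.sum_right blinfun.sum_left blinfun.scaleR_right blinfun.scaleR_left
      by (rule sum.cong) (simp_all add: on that)
    then show ?thesis using B(1) that by simp
  qed
  have bP: "J (I u) (P v) = J (I u) v" if "u \<in> B" for u v
  proof -
    have "J (I u) (P v) = (\<Sum>u'\<in>B. if u' = u then J (I u') v else 0)"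
      unfolding P_def blinfun.sum_right blinfun.scaleR_right by (rule sum.cong) (simp_all add: on that)
    then show ?thesis using B(1) that by simp
  qed
  have QP: "Q (P v) = Q v" for v unfolding Q_def by (rule sum.cong) (simp_all add: bP)
  have TQ: "\<beta> (R (Q v)) = P v" for v
    unfolding Q_def P_def
    by (simp add: linear_sum[OF R(1)] linear_scale[OF R(1)] linear_sum[OF \<beta>(1)] linear_scale[OF \<beta>(1)] r w)
  have PB: "P v \<in> span B" for v unfolding P_def by (intro span_sum span_scale span_base)
  have LP: "L (P v) = 0" for v using PB B(2) by blast
  have Pid: "P v = v" if "L v = 0" for v
  proof -
    have "P u = u" if "u \<in> B" for u
    proof -
      have "P u = (\<Sum>u'\<in>B. if u' = u then u' else 0)"
        unfolding P_def by (rule sum.cong) (simp_all add: on that)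
      then show ?thesis using B(1) that by simp
    qed
    then have "span B \<subseteq> {v. P v = v}"
      by (intro span_minimal subspaceI) (auto simp: linear_simps[OF blP])
    then show ?thesis using that B(2) by blast
  qed
  have qI: "q (I v) = I (P v)" if "L v = 0" for v
    unfolding q_def P_def using sym by (simp add: blinfun.sum_right blinfun.scaleR_right)
  have qL: "q (L h) = 0" for h
    unfolding q_def using J_L_kernel BL by (intro sum.neutral) auto
  have qq: "q (q e) = q e" for e unfolding q_def[of "q e"] q_def[of e] using Jq by (simp add: q_def)
  have I0: "v = 0" if "I v = 0" for v
    using pos[of v] that by (cases "v = 0") (auto simp: blinfun.zero_right blinfun.zero_left)
  \<comment> \<open>This will be the partial derivative of \<open>\<Psi>\<close>: \<open>L\<close>
    maps the kernel of \<open>P\<close> bijectively to the range of \<open>L\<close>, and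
    \<open>I\<close> maps \<open>ker L\<close> to the complement \<open>I (ker L)\<close>.\<close>
  define D where "D = (\<lambda>v. L v + I (P v))"
  have "bij D"
  proof (rule bijI)
    have blD: "linear D"
      unfolding D_def by (intro bounded_linear.linear bounded_linear_add blinfun.bounded_linear_right
          bounded_linear_compose[OF blinfun.bounded_linear_right blP])
    have "v = 0" if "D v = 0" for v
    proof -
      have "q (D v) = I (P v)"
        using qI[OF LP, of v] Pid[OF LP, of v] by (simp add: D_def linear_simps(1)[OF blq] qL)
      then have "P v = 0" using that I0 by (simp add: linear_simps(3)[OF blq])
      then have "L v = 0" using that by (simp add: D_def blinfun.zero_right)
      then show ?thesis using Pid \<open>P v = 0\<close> by metis
    qed
    then show "inj D" using linear_injective_0[OF blD] by blast
    show "surj D"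
    proof (rule surjI)
      fix e
      \<comment> \<open>Surjectivity: \<open>e - q e\<close> pairs to 0 with the kernel and hence is
        some \<open>L v\<close>; replacing the kernel component of \<open>v\<close> by
        \<open>u\<close> produces the missing \<open>q e\<close>.\<close>
      have "J (e - q e) u = 0" if "u \<in> B" for u
        using Jq[OF that] by (simp add: blinfun.diff_right blinfun.diff_left)
      then have "e - q e \<in> range L" by (intro range_L[OF B]) (simp_all add: on)
      then obtain v where v: "e - q e = L v" by blast
      define u where "u = (\<Sum>u\<in>B. J e u *\<^sub>R u)"
      have "u \<in> span B" unfolding u_def by (intro span_sum span_scale span_base)
      then have "L u = 0" using B(2) by blast
      have "I u = q e" by (simp add: u_def q_def blinfun.sum_right blinfun.scaleR_right)
      have "P (v - P v + u) = u"
        using Pid[OF LP, of v] Pid[OF \<open>L u = 0\<close>] by (simp add: linear_simps[OF blP])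
      then have "D (v - P v + u) = L v + q e"
        by (simp add: D_def blinfun.add_right blinfun.diff_right LP \<open>L u = 0\<close> \<open>I u = q e\<close>)
      also have "\<dots> = e" using v by (simp add: algebra_simps)
      finally show "D ((\<lambda>e. SOME v. D v = e) e) = e" by (metis (mono_tags, lifting) someI)
    qed
  qed
  \<comment> \<open>Two equations in one: the first summand lies in the kernel of \<open>q\<close>
    and the second in its range, so \<open>\<Psi> = 0\<close> makes both vanish.\<close>
  define \<Psi> where "\<Psi> z = (\<Phi> z - q (\<Phi> z)) + (I (P (fst z)) - I (P x0))" for z
  have blq': "bounded_linear (\<lambda>e. e - q e)" by (rule bounded_linear_sub[OF bounded_linear_ident blq])
  have blIP: "bounded_linear (\<lambda>z. I (P (fst z)))"
    by (rule bounded_linear_compose[OF blinfun.bounded_linear_right bounded_linear_compose[OF blP bounded_linear_fst]])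
  have C\<Psi>: "C_on k (U \<times> W) \<Psi>"
  proof -
    have "C_on k (U \<times> W) (\<lambda>z. I (P (fst z)) + - I (P x0))"
      by (rule C_on_add[OF C_on_linear[OF blIP] C_on_const])
    then have "C_on k (U \<times> W) (\<lambda>z. I (P (fst z)) - I (P x0))" by simp
    from C_on_add[OF C_on_bounded_linear[OF blq' C] this] show ?thesis unfolding \<Psi>_def .
  qed
  have "open (U \<times> W)" using UW by (simp add: open_Times)
  have z0: "(x0, l0) \<in> U \<times> W" using UW by simp
  obtain D\<Phi> :: "'e \<times> 'p \<Rightarrow> ('e \<times> 'p) \<Rightarrow>\<^sub>L 'f" where
    "\<And>z. z \<in> U \<times> W \<Longrightarrow> (\<Phi> has_derivative D\<Phi> z) (at z within U \<times> W)"
    by (rule C_on_has_derivative[of "k - 1" "U \<times> W" \<Phi>]) (use C k in simp, rule that)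
  then have D\<Phi>: "(\<Phi> has_derivative D\<Phi> (x0, l0)) (at (x0, l0))"
    using z0 at_within_open[OF z0 \<open>open (U \<times> W)\<close>] by metis
  define D' where "D' z = (D\<Phi> (x0, l0) z - q (D\<Phi> (x0, l0) z)) + (I (P (fst z)) - 0)" for z
  have der: "(\<Psi> has_derivative D') (at (x0, l0))"
    unfolding \<Psi>_def D'_def
    by (rule has_derivative_add[OF has_derivative_diff[OF D\<Phi> bounded_linear.has_derivative[OF blq D\<Phi>]]
          has_derivative_diff[OF bounded_linear_imp_has_derivative[OF blIP] has_derivative_const]])
  have partial: "D\<Phi> (x0, l0) (a, 0) = L a" for a
  proof -
    have "((\<lambda>x. (x, l0)) has_derivative (\<lambda>a. (a, 0))) (at x0)"
      by (rule has_derivative_Pair[OF has_derivative_ident has_derivative_const])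
    from has_derivative_compose[OF this D\<Phi>] have "((\<lambda>x. \<Phi> (x, l0)) has_derivative (\<lambda>a. D\<Phi> (x0, l0) (a, 0))) (at x0)" .
    from has_derivative_unique[OF this L] show ?thesis by (simp add: fun_eq_iff)
  qed
  have "(\<lambda>a. D' (a, 0)) = D" by (simp add: fun_eq_iff D'_def D_def partial qL)
  then have bij': "bij (\<lambda>a. D' (a, 0))" using \<open>bij D\<close> by simp
  have zero\<Psi>: "\<Psi> (x0, l0) = 0" by (simp add: \<Psi>_def zero linear_simps(3)[OF blq])
  \<comment> \<open>The matrix of the annihilation relation on \<open>I (ker L)\<close>. At
    \<open>x0\<close> it is the identity; entries within \<open>1 / (card B + 1)\<close> of it keep
    it nondegenerate, and the added 1 also covers an empty basis.\<close>
  define m where "m u v x = J' x (I u) (s x (w v))" for u v x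
  define \<epsilon> where "\<epsilon> = 1 / (real (card B) + 1)"
  have \<epsilon>: "\<epsilon> > 0" by (simp add: \<epsilon>_def)
  define O1 where "O1 = U \<inter> (\<Inter>u\<in>B. \<Inter>v\<in>B. {x \<in> U. dist (m u v x) (m u v x0) < \<epsilon>})"
  have "open O1"
  proof -
    have cm: "continuous_on U (m u v)" for u v
      unfolding m_def
      by (rule bounded_bilinear.continuous_on[OF bounded_bilinear_blinfun_apply
            bounded_linear.continuous_on[OF blinfun.bounded_linear_left cont(1)]
            bounded_linear.continuous_on[OF blinfun.bounded_linear_left cont(2)]])
    have "open {x \<in> U. dist (m u v x) (m u v x0) < \<epsilon>}" for u v
    proof -
      have "{x \<in> U. dist (m u v x) (m u v x0) < \<epsilon>} = U \<inter> m u v -` ball (m u v x0) \<epsilon>"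
        by (auto simp: dist_commute)
      then show ?thesis
        using continuous_open_preimage[OF cm UW(1) open_ball[of "m u v x0" \<epsilon>]] by simp
    qed
    then show ?thesis unfolding O1_def using B(1) UW(1) by (intro open_Int open_INT ballI)
  qed
  have "x0 \<in> O1" using UW \<epsilon> by (simp add: O1_def)
  have nondeg: "e = 0" if x: "x \<in> O1" and e: "e = q e" and an: "\<And>v. v \<in> B \<Longrightarrow> J' x e (s x (w v)) = 0" for x e
  proof -
    define c where "c u = J e u" for u
    have ec: "e = (\<Sum>u\<in>B. c u *\<^sub>R I u)" using e by (simp add: q_def c_def)
    define S where "S = (\<Sum>u\<in>B. \<bar>c u\<bar>)"
    have S0: "S \<ge> 0" by (simp add: S_def sum_nonneg)
    have le: "\<bar>c v\<bar> \<le> S * \<epsilon>" if v: "v \<in> B" for v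
    proof -
      have "J' x (\<Sum>u\<in>B. c u *\<^sub>R I u) (s x (w v)) = 0" using an[OF v] ec by metis
      then have 0: "(\<Sum>u\<in>B. c u * m u v x) = 0"
        by (simp add: blinfun.sum_right blinfun.sum_left blinfun.scaleR_right blinfun.scaleR_left m_def)
      have m0: "m u v x0 = (if u = v then 1 else 0)" if "u \<in> B" for u
        using on[OF that v] by (simp add: m_def J' w v)
      have "(\<Sum>u\<in>B. c u * m u v x0) = (\<Sum>u\<in>B. if u = v then c u else 0)"
        by (rule sum.cong) (simp_all add: m0)
      then have "c v = (\<Sum>u\<in>B. c u * m u v x0) - (\<Sum>u\<in>B. c u * m u v x)"
        using 0 B(1) v by simp
      also have "\<dots> = (\<Sum>u\<in>B. c u * (m u v x0 - m u v x))"
        by (simp add: sum_subtractf right_diff_distrib)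
      finally have "\<bar>c v\<bar> \<le> (\<Sum>u\<in>B. \<bar>c u * (m u v x0 - m u v x)\<bar>)" by (simp add: sum_abs)
      also have "\<dots> \<le> (\<Sum>u\<in>B. \<bar>c u\<bar> * \<epsilon>)"
      proof (rule sum_mono)
        fix u assume "u \<in> B"
        then have "dist (m u v x) (m u v x0) < \<epsilon>" using x v by (simp add: O1_def)
        then show "\<bar>c u * (m u v x0 - m u v x)\<bar> \<le> \<bar>c u\<bar> * \<epsilon>"
          unfolding abs_mult dist_real_def by (intro mult_left_mono) (simp_all add: abs_minus_commute)
      qed
      finally show ?thesis by (simp add: S_def sum_distrib_right)
    qed
    \<comment> \<open>Here \<open>card B * \<epsilon>\<close> is less than 1, which leaves only
      \<open>S = 0\<close>.\<close>
    have "S \<le> (\<Sum>v\<in>B. S * \<epsilon>)" unfolding S_def by (rule sum_mono) (use le S_def in simp)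
    then have "S * (real (card B) + 1) \<le> S * real (card B)"
      by (simp add: \<epsilon>_def field_simps)
    then have "S = 0" using S0 by (simp add: algebra_simps)
    then have "c u = 0" if "u \<in> B" for u using le[OF that] by simp
    then show ?thesis using ec by simp
  qed
  have \<Psi>0: "\<Phi> (x, l) = 0 \<and> P (x - x0) = 0" if z: "\<Psi> (x, l) = 0" "x \<in> O1" "l \<in> W" for x l
  proof -
    have e1: "(\<Phi> (x, l) - q (\<Phi> (x, l))) + I (P (x - x0)) = 0"
      using z(1) by (simp add: \<Psi>_def linear_simps(2)[OF blP] blinfun.diff_right)
    then have "q ((\<Phi> (x, l) - q (\<Phi> (x, l))) + I (P (x - x0))) = 0"
      by (simp add: linear_simps(3)[OF blq])
    then have "I (P (x - x0)) = 0"
      using qI[OF LP] Pid[OF LP] by (simp add: linear_simps(1,2)[OF blq] qq)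
    then have P0: "P (x - x0) = 0" by (rule I0)
    then have "\<Phi> (x, l) = q (\<Phi> (x, l))" using e1 by (simp add: blinfun.zero_right)
    moreover have "x \<in> U" using z(2) by (simp add: O1_def)
    ultimately show ?thesis using nondeg[OF z(2)] ann z(3) P0 by metis
  qed
  obtain N V \<sigma> where IFT: "open N" "(x0, l0) \<in> N" "N \<subseteq> O1 \<times> W" "open V" "l0 \<in> V" "C_on k V \<sigma>" "\<sigma> l0 = x0"
    "\<And>l. l \<in> V \<Longrightarrow> (\<sigma> l, l) \<in> N \<and> \<Psi> (\<sigma> l, l) = 0"
    "\<And>x l. (x, l) \<in> N \<Longrightarrow> l \<in> V \<Longrightarrow> \<Psi> (x, l) = 0 \<Longrightarrow> x = \<sigma> l"
  \<comment> \<open>Over \<open>O1\<close> the annihilation relation is nondegenerate at every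
    solution obtained.\<close>
  proof (rule C_implicit_function[OF _ k _ _ zero\<Psi> der bij', of "O1 \<times> W"])
    show "C_on k (O1 \<times> W) \<Psi>" by (rule C_on_subset[OF C\<Psi>]) (auto simp: O1_def)
    show "open (O1 \<times> W)" using \<open>open O1\<close> UW by (simp add: open_Times)
    show "(x0, l0) \<in> O1 \<times> W" using \<open>x0 \<in> O1\<close> UW by simp
  qed (rule that)
  show thesis
  proof
    show "bounded_linear Q" by (rule blQ)
    show "Q (\<beta> (R (Q v))) = Q v" for v by (simp add: TQ QP)
    show "open N" "(x0, l0) \<in> N" "open V" "l0 \<in> V" "C_on k V \<sigma>" "\<sigma> l0 = x0" by (fact IFT)+
    show "N \<subseteq> U \<times> W" using IFT(3) by (auto simp: O1_def)
    show "(\<sigma> l, l) \<in> N \<and> \<Phi> (\<sigma> l, l) = 0" if "l \<in> V" for l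
    proof -
      have "(\<sigma> l, l) \<in> N" "\<Psi> (\<sigma> l, l) = 0" using IFT(8)[OF that] by simp_all
      then show ?thesis using \<Psi>0[of "\<sigma> l" l] IFT(3) by blast
    qed
    show "x = \<sigma> l" if "(x, l) \<in> N" "l \<in> V" "\<Phi> (x, l) = 0" "Q (x - x0) = 0" for x l
    proof (rule IFT(9)[OF that(1,2)])
      have "P (x - x0) = 0"
        using TQ[of "x - x0"] that(4) linear_0[OF R(1)] linear_0[OF \<beta>(1)] by simp
      then have "I (P x) - I (P x0) = 0"
        by (simp add: linear_simps(2)[OF blP] flip: blinfun.diff_right)
      then show "\<Psi> (x, l) = 0" by (simp add: \<Psi>_def that(3) linear_simps(3)[OF blq])
    qed
  qed
qed

end

section \<open>Charts, tangent vectors and derivatives\<close>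

lemma coord_map_apply:
  assumes "inj_on (snd c) (fst c)" "p \<in> fst c"
  shows "coord_map c d f (snd c p) = snd d (f p)"
  using assms by (simp add: coord_map_def)

lemma manifoldD:
  assumes "manifold k A" "c \<in> A"
  shows "inj_on (snd c) (fst c)" "open (snd c ` fst c)"
    and "d \<in> A \<Longrightarrow> open (snd c ` (fst c \<inter> fst d))"
    and "d \<in> A \<Longrightarrow> C_on k (snd c ` (fst c \<inter> fst d)) (coord_map c d (\<lambda>x. x))"
  using assms unfolding manifold_def by auto

lemma topspace_mtop [simp]: "topspace (mtop A) = points A"
proof -
  have "\<Union> {fst c \<inter> snd c -` W |c W. c \<in> A \<and> open W} = points A"
    unfolding points_def
  proof safe
    fix x a b assume "(a, b) \<in> A" "x \<in> fst (a, b)"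
    moreover have "fst (a, b) \<inter> snd (a, b) -` UNIV \<in> {fst c \<inter> snd c -` W |c W. c \<in> A \<and> open W}"
      using \<open>(a, b) \<in> A\<close> open_UNIV by blast
    ultimately show "x \<in> \<Union> {fst c \<inter> snd c -` W |c W. c \<in> A \<and> open W}"
      by (intro UnionI) simp_all
  qed force
  then show ?thesis by (simp add: mtop_def)
qed

lemma openin_mtop_chart: "c \<in> A \<Longrightarrow> open W \<Longrightarrow> openin (mtop A) (fst c \<inter> snd c -` W)"
  unfolding mtop_def by (rule topology_generated_by_Basis) blast

lemma openin_mtop_domain: "c \<in> A \<Longrightarrow> openin (mtop A) (fst c)"
  using openin_mtop_chart[of c A UNIV] by simp

text \<open>Induction over the generation of the topology. Injectivity of the chart handles
  intersections; for a basic set of another chart the image is a preimage under the continuous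
  change of charts.\<close>

lemma open_chart_image:
  assumes man: "manifold k A" and c: "c \<in> A" and V: "openin (mtop A) V"
  shows "open (snd c ` (fst c \<inter> V))"
proof -
  note mc = manifoldD[OF man c]
  have "generate_topology_on {fst c \<inter> snd c -` W |c W. c \<in> A \<and> open W} V"
    using V unfolding mtop_def by (rule openin_topology_generated_by)
  then show ?thesis
  proof induction
    case Empty
    then show ?case by simp
  next
    case (Int a b)
    have "snd c ` (fst c \<inter> (a \<inter> b)) = snd c ` (fst c \<inter> a) \<inter> snd c ` (fst c \<inter> b)"
      using mc(1) by (subst inj_on_image_Int[OF mc(1), symmetric]) (auto intro!: arg_cong[where f = "image (snd c)"])
    with Int.IH show ?case by (simp add: open_Int)
  next
    case (UN K)
    have "snd c ` (fst c \<inter> \<Union>K) = (\<Union>a\<in>K. snd c ` (fst c \<inter> a))" by blast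
    with UN.IH show ?case by (simp add: open_UN)
  next
    case (Basis V)
    then obtain d W where d: "V = fst d \<inter> snd d -` W" "d \<in> A" "open W" by blast
    have "snd c ` (fst c \<inter> V) = snd c ` (fst c \<inter> fst d) \<inter> coord_map c d (\<lambda>x. x) -` W"
      by (auto simp: d(1) coord_map_apply[OF mc(1)])
    moreover have "open \<dots>"
      using continuous_open_preimage[OF C_on_continuous[OF mc(4)[OF d(2)]] mc(3)[OF d(2)] d(3)] by simp
    ultimately show ?case by simp
  qed
qed

lemma continuous_map_chart:
  assumes "c \<in> A"
  shows "continuous_map (subtopology (mtop A) (fst c)) euclidean (snd c)"
proof -
  have "topspace (subtopology (mtop A) (fst c)) = fst c"
    using openin_subset[OF openin_mtop_domain[OF assms]] by auto
  moreover have "openin (subtopology (mtop A) (fst c)) {x \<in> fst c. snd c x \<in> W}" if "open W" for W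
    using openin_mtop_chart[OF assms that] by (subst openin_open_subtopology[OF openin_mtop_domain[OF assms]]) (auto simp: vimage_def Int_def)
  ultimately show ?thesis by (simp add: continuous_map_def)
qed

lemma continuous_map_chart_inverse:
  assumes man: "manifold k A" and c: "c \<in> A"
  shows "continuous_map (top_of_set (snd c ` fst c)) (mtop A) (inv_into (fst c) (snd c))"
proof -
  have "openin (top_of_set (snd c ` fst c)) {e \<in> snd c ` fst c. inv_into (fst c) (snd c) e \<in> V}"
    if "openin (mtop A) V" for V
  proof -
    have "{e \<in> snd c ` fst c. inv_into (fst c) (snd c) e \<in> V} = snd c ` (fst c \<inter> V)"
      using manifoldD(1)[OF man c] by (auto simp: inv_into_f_f)
    then show ?thesis
      using open_chart_image[OF man c that] by (metis Int_lower1 image_mono open_openin_trans openin_open_eq manifoldD(2)[OF man c] )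
  qed
  moreover have "inv_into (fst c) (snd c) e \<in> points A" if "e \<in> snd c ` fst c" for e
    using inv_into_into[OF that] c by (auto simp: points_def)
  ultimately show ?thesis by (simp add: continuous_map_def)
qed

section \<open>Changes of charts and tangent vectors\<close>

lemma coord_map_trans:
  assumes man: "manifold k A" and c: "c \<in> A" "d \<in> A" and e: "e \<in> snd c ` (fst c \<inter> fst d)"
  shows "coord_map c d' f e = coord_map d d' f (coord_map c d (\<lambda>x. x) e)"
proof -
  obtain q where "q \<in> fst c" "q \<in> fst d" "e = snd c q" using e by blast
  then show ?thesis
    by (simp add: coord_map_apply[OF manifoldD(1)[OF man c(1)]] coord_map_apply[OF manifoldD(1)[OF man c(2)]])
qed

lemma frechet_derivative_worksI:
  "f differentiable net \<Longrightarrow> (f has_derivative frechet_derivative f net) net"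
  by (simp add: frechet_derivative_works)

lemma frechet_derivative_eqI: "(f has_derivative D) (at x) \<Longrightarrow> frechet_derivative f (at x) = D"
  by (rule sym[OF frechet_derivative_at])

lemma C_on_imp_differentiable:
  assumes "C_on k S f" "k \<ge> 1" "open S" "x \<in> S"
  shows "f differentiable at x"
proof -
  obtain D where "\<And>x. x \<in> S \<Longrightarrow> (f has_derivative blinfun_apply (D x)) (at x within S)"
    by (rule C_on_has_derivative[of "k - 1" S f]) (use assms in simp, rule that)
  then show ?thesis
    using at_within_open[OF assms(4,3)] assms(4) unfolding differentiable_def by metis
qed

lemma chart_change_differentiable:
  assumes man: "manifold k A" and k: "k \<ge> 1" and c: "c \<in> charts_at A p" "d \<in> charts_at A p"
  shows "coord_map c d (\<lambda>x. x) differentiable at (snd c p)"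
proof (rule C_on_imp_differentiable[OF _ k])
  have "c \<in> A" "p \<in> fst c" "d \<in> A" "p \<in> fst d" using c by (auto simp: charts_at_def)
  then show "C_on k (snd c ` (fst c \<inter> fst d)) (coord_map c d (\<lambda>x. x))"
    "open (snd c ` (fst c \<inter> fst d))" "snd c p \<in> snd c ` (fst c \<inter> fst d)"
    using manifoldD(3,4)[OF man] by auto
qed

lemma has_derivative_chart_change:
  assumes man: "manifold k A" and k: "k \<ge> 1" and c: "c \<in> charts_at A p" "d \<in> charts_at A p"
    and D: "(coord_map d d' f has_derivative D) (at (snd d p))"
  shows "(coord_map c d' f has_derivative (\<lambda>v. D (frechet_derivative (coord_map c d (\<lambda>x. x)) (at (snd c p)) v))) (at (snd c p))"
proof -
  have cA: "c \<in> A" "p \<in> fst c" "d \<in> A" "p \<in> fst d" using c by (auto simp: charts_at_def)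
  have "coord_map c d (\<lambda>x. x) (snd c p) = snd d p"
    by (rule coord_map_apply[OF manifoldD(1)[OF man cA(1)] cA(2)])
  with has_derivative_compose[OF frechet_derivative_worksI[OF chart_change_differentiable[OF man k c]], of "coord_map d d' f" D] D
  have "((\<lambda>e. coord_map d d' f (coord_map c d (\<lambda>x. x) e)) has_derivative
    (\<lambda>v. D (frechet_derivative (coord_map c d (\<lambda>x. x)) (at (snd c p)) v))) (at (snd c p))" by simp
  then show ?thesis
    by (rule has_derivative_transform_within_open[OF _ manifoldD(3)[OF man cA(1,3)]])
      (use cA in \<open>auto simp: coord_map_trans[OF man cA(1,3), of _ d' f]\<close>)
qed

lemma tangent_outside: "v \<in> tangent A p \<Longrightarrow> c \<notin> charts_at A p \<Longrightarrow> v c = 0"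
  unfolding tangent_def by (elim CollectE conjE) (erule allE[of _ c], erule mp)

lemma tangent_chart_change:
  "v \<in> tangent A p \<Longrightarrow> c \<in> charts_at A p \<Longrightarrow> d \<in> charts_at A p \<Longrightarrow>
     v d = frechet_derivative (coord_map c d (\<lambda>x. x)) (at (snd c p)) (v c)"
  unfolding tangent_def by (elim CollectE conjE) (drule (1) bspec, drule (1) bspec, assumption)

text \<open>\<open>mderiv\<close> evaluates in a chart of its own choosing; the chain rule and the
  transformation law of \<open>v\<close> cancel the choice, so that any convenient chart may be
  used.\<close>

lemma mderiv_eq:
  assumes man: "manifold k A" and k: "k \<ge> 1" and c: "c \<in> charts_at A p" and d: "d \<in> charts_at B (f p)"
    and diff: "\<And>c. c \<in> charts_at A p \<Longrightarrow> coord_map c d f differentiable at (snd c p)"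
    and v: "v \<in> tangent A p"
  shows "mderiv A B f p v d = frechet_derivative (coord_map c d f) (at (snd c p)) (v c)"
proof -
  define c' where "c' = (SOME c. c \<in> charts_at A p)"
  have c': "c' \<in> charts_at A p" unfolding c'_def by (rule someI) (rule c)
  have "(coord_map c d f has_derivative (\<lambda>v. frechet_derivative (coord_map c' d f) (at (snd c' p))
    (frechet_derivative (coord_map c c' (\<lambda>x. x)) (at (snd c p)) v))) (at (snd c p))"
    by (rule has_derivative_chart_change[OF man k c c' frechet_derivative_worksI[OF diff[OF c']]])
  moreover have "v c' = frechet_derivative (coord_map c c' (\<lambda>x. x)) (at (snd c p)) (v c)"
    by (rule tangent_chart_change[OF v c c'])
  ultimately show ?thesis using d by (simp add: mderiv_def Let_def c'_def[symmetric] frechet_derivative_eqI)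
qed

text \<open>The tangent vector represented by \<open>a\<close> in the chart \<open>c\<close>; it
  gives the inverse of the coordinate \<open>v \<mapsto> v c\<close>.\<close>

definition tangent_vec :: "('m, 'e::banach) atlas \<Rightarrow> 'm \<Rightarrow> ('m, 'e) chart \<Rightarrow> 'e \<Rightarrow> (('m, 'e) chart \<Rightarrow> 'e)" where
  "tangent_vec A p c a = (\<lambda>d. if d \<in> charts_at A p
     then frechet_derivative (coord_map c d (\<lambda>x. x)) (at (snd c p)) a else 0)"

lemma tangent_vec:
  assumes man: "manifold k A" and k: "k \<ge> 1" and c: "c \<in> charts_at A p"
  shows "tangent_vec A p c a \<in> tangent A p" "tangent_vec A p c a c = a"
proof -
  have cA: "c \<in> A" "p \<in> fst c" using c by (auto simp: charts_at_def)
  show "tangent_vec A p c a c = a"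
  proof -
    have "(coord_map c c (\<lambda>x. x) has_derivative (\<lambda>a. a)) (at (snd c p))"
      by (rule has_derivative_transform_within_open[OF has_derivative_ident manifoldD(2)[OF man cA(1)]])
        (use cA in \<open>auto simp: coord_map_apply[OF manifoldD(1)[OF man cA(1)]]\<close>)
    then show ?thesis using c by (simp add: tangent_vec_def frechet_derivative_eqI)
  qed
  show "tangent_vec A p c a \<in> tangent A p"
    unfolding tangent_def
  proof (intro CollectI conjI allI impI ballI)
    fix d d' assume d: "d \<in> charts_at A p" "d' \<in> charts_at A p"
    have "frechet_derivative (coord_map c d' (\<lambda>x. x)) (at (snd c p)) =
      (\<lambda>v. frechet_derivative (coord_map d d' (\<lambda>x. x)) (at (snd d p))
        (frechet_derivative (coord_map c d (\<lambda>x. x)) (at (snd c p)) v))"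
      by (rule frechet_derivative_eqI[OF has_derivative_chart_change[OF man k c d(1)
              frechet_derivative_worksI[OF chart_change_differentiable[OF man k d]]]])
    then show "tangent_vec A p c a d' =
      frechet_derivative (coord_map d d' (\<lambda>x. x)) (at (snd d p)) (tangent_vec A p c a d)"
      using d by (simp add: tangent_vec_def)
  qed (simp add: tangent_vec_def)
qed

lemma tangent_eqI:
  assumes "v \<in> tangent A p" "w \<in> tangent A p" "c \<in> charts_at A p" "v c = w c"
  shows "v = w"
proof
  fix d
  show "v d = w d"
  proof (cases "d \<in> charts_at A p")
    case True
    then show ?thesis
      using tangent_chart_change[OF assms(1,3)] tangent_chart_change[OF assms(2,3)] assms(4) by simp
  next
    case False
    then show ?thesis
      using tangent_outside[OF assms(1)] tangent_outside[OF assms(2)] by simp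
  qed
qed

lemma inv_into_tangent:
  assumes man: "manifold k A" and k: "k \<ge> 1" and c: "c \<in> charts_at A p"
  shows "inv_into (tangent A p) (\<lambda>v. v c) a = tangent_vec A p c a"
proof -
  have "inj_on (\<lambda>v. v c) (tangent A p)" by (intro inj_onI) (rule tangent_eqI[OF _ _ c])
  then show ?thesis
    using inv_into_f_f[of "\<lambda>v. v c" "tangent A p" "tangent_vec A p c a"] tangent_vec[OF man k c] by simp
qed

text \<open>\<open>coord_map c d f\<close> has its meaning only where \<open>f\<close> takes values
  in the domain of \<open>d\<close>. Continuity at \<open>p\<close> ensures this on an open set of
  coordinates, on which identities between coordinate maps can be differentiated.\<close>

lemma mdifferentiable_coord_open:
  assumes man: "manifold k A" and c: "c \<in> charts_at A p" and d: "d \<in> charts_at B (f p)"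
    and f: "topcontinuous_at (mtop A) (mtop B) f p"
  obtains S where "open S" "snd c p \<in> S" "S \<subseteq> snd c ` fst c"
    "\<And>q. q \<in> fst c \<Longrightarrow> snd c q \<in> S \<Longrightarrow> f q \<in> fst d"
proof -
  have cA: "c \<in> A" "p \<in> fst c" "d \<in> B" "f p \<in> fst d" using c d by (auto simp: charts_at_def)
  obtain O1 where O1: "openin (mtop A) O1" "p \<in> O1" "\<And>q. q \<in> O1 \<Longrightarrow> f q \<in> fst d"
    using f[unfolded topcontinuous_at_def, THEN conjunct2, THEN conjunct2, THEN spec, THEN mp,
        OF conjI[OF openin_mtop_domain[OF cA(3)] cA(4)]] by (elim exE conjE) (rule that, auto)
  show thesis
  proof (rule that[of "snd c ` (fst c \<inter> O1)"])
    show "open (snd c ` (fst c \<inter> O1))" by (rule open_chart_image[OF man cA(1) O1(1)])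
    show "f q \<in> fst d" if "q \<in> fst c" "snd c q \<in> snd c ` (fst c \<inter> O1)" for q
      using that O1(3) manifoldD(1)[OF man cA(1)] by (auto dest: inj_onD)
  qed (use cA O1 in auto)
qed

text \<open>The chain rule for a change of charts in the target is the transformation law that
  defines tangent vectors.\<close>

lemma mderiv_in_tangent:
  assumes A: "manifold k A" and B: "manifold n B" and k: "k \<ge> 1" "n \<ge> 1"
    and f: "mdifferentiable_at A B f p" and v: "v \<in> tangent A p" and c: "c \<in> charts_at A p"
  shows "mderiv A B f p v \<in> tangent B (f p)"
  unfolding tangent_def
proof (intro CollectI conjI allI impI ballI)
  fix d d' assume d: "d \<in> charts_at B (f p)" "d' \<in> charts_at B (f p)"
  have diff: "coord_map c d f differentiable at (snd c p)" if "c \<in> charts_at A p" "d \<in> charts_at B (f p)" for c d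
    using f that unfolding mdifferentiable_at_def by blast
  have cA: "c \<in> A" "p \<in> fst c" "d \<in> B" "f p \<in> fst d" using c d by (auto simp: charts_at_def)
  obtain S where S: "open S" "snd c p \<in> S" "S \<subseteq> snd c ` fst c" "\<And>q. q \<in> fst c \<Longrightarrow> snd c q \<in> S \<Longrightarrow> f q \<in> fst d"
    using f unfolding mdifferentiable_at_def by (elim conjE) (rule mdifferentiable_coord_open[where B = B and f = f, OF A c d(1)], assumption, rule that)
  note ap = coord_map_apply[OF manifoldD(1)[OF A cA(1)]] coord_map_apply[OF manifoldD(1)[OF B cA(3)]]
  have "coord_map c d f (snd c p) = snd d (f p)" by (rule ap(1)[OF cA(2)])
  with has_derivative_compose[OF frechet_derivative_worksI[OF diff[OF c d(1)]], of "coord_map d d' (\<lambda>x. x)"]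
    frechet_derivative_worksI[OF chart_change_differentiable[OF B k(2) d]]
  have "((\<lambda>e. coord_map d d' (\<lambda>x. x) (coord_map c d f e)) has_derivative
     (\<lambda>v. frechet_derivative (coord_map d d' (\<lambda>x. x)) (at (snd d (f p))) (frechet_derivative (coord_map c d f) (at (snd c p)) v)))
     (at (snd c p))" by simp
  then have "(coord_map c d' f has_derivative
     (\<lambda>v. frechet_derivative (coord_map d d' (\<lambda>x. x)) (at (snd d (f p))) (frechet_derivative (coord_map c d f) (at (snd c p)) v)))
     (at (snd c p))"
  proof (rule has_derivative_transform_within_open[OF _ S(1,2)])
    fix e assume e: "e \<in> S"
    then obtain q where q: "q \<in> fst c" "e = snd c q" using S(3) by blast
    then have "f q \<in> fst d" using S(4) e by blast
    then show "coord_map d d' (\<lambda>x. x) (coord_map c d f e) = coord_map c d' f e"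
      using q by (simp add: ap)
  qed
  from frechet_derivative_eqI[OF this]
  show "mderiv A B f p v d' = frechet_derivative (coord_map d d' (\<lambda>x. x)) (at (snd d (f p))) (mderiv A B f p v d)"
    using mderiv_eq[OF A k(1) c d(1) diff[OF _ d(1)] v] mderiv_eq[OF A k(1) c d(2) diff[OF _ d(2)] v] by simp
qed (simp add: mderiv_def)

section \<open>Coordinate representations\<close>

lemma inj_on_prod_chart:
  "inj_on (snd c) (fst c) \<Longrightarrow> inj_on (snd b) (fst b) \<Longrightarrow> inj_on (snd (prod_chart c b)) (fst (prod_chart c b))"
  by (auto simp: prod_chart_def inj_on_def)

text \<open>Expresses the coordinate map of a product chart by the inverses of its two factors; the
  set \<open>X\<close> keeps the values within the domain of \<open>d\<close>.\<close>

lemma C_map_prod_chart: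
  assumes h: "C_map k (prod_atlas A B) (points A \<times> points B) C h"
    and c: "c \<in> A" "inj_on (snd c) (fst c)" and b: "b \<in> B" "inj_on (snd b) (fst b)" and d: "d \<in> C"
    and X: "X \<subseteq> fst c" "\<And>x l. x \<in> X \<Longrightarrow> l \<in> fst b \<Longrightarrow> h (x, l) \<in> fst d"
  shows "C_on k (snd c ` X \<times> snd b ` fst b)
    (\<lambda>z. snd d (h (inv_into (fst c) (snd c) (fst z), inv_into (fst b) (snd b) (snd z))))"
proof (rule C_on_cong[OF C_on_subset])
  have "prod_chart c b \<in> prod_atlas A B" using c b unfolding prod_atlas_def by blast
  then show "C_on k (snd (prod_chart c b) ` (fst (prod_chart c b) \<inter> (points A \<times> points B) \<inter> h -` fst d))
    (coord_map (prod_chart c b) d h)"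
    using h d unfolding C_map_def by blast
  have pts: "fst c \<subseteq> points A" "fst b \<subseteq> points B" using c b by (auto simp: points_def)
  show "snd c ` X \<times> snd b ` fst b \<subseteq>
    snd (prod_chart c b) ` (fst (prod_chart c b) \<inter> (points A \<times> points B) \<inter> h -` fst d)"
  proof
    fix z assume "z \<in> snd c ` X \<times> snd b ` fst b"
    then obtain x l where z: "x \<in> X" "l \<in> fst b" "z = (snd c x, snd b l)" by auto
    then have "z = snd (prod_chart c b) (x, l)" by (simp add: prod_chart_def)
    moreover have "(x, l) \<in> fst (prod_chart c b) \<inter> (points A \<times> points B) \<inter> h -` fst d"
      using z(1,2) X pts by (auto simp: prod_chart_def)
    ultimately show "z \<in> snd (prod_chart c b) ` (fst (prod_chart c b) \<inter> (points A \<times> points B) \<inter> h -` fst d)"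
      by (rule image_eqI)
  qed
  fix z assume "z \<in> snd c ` X \<times> snd b ` fst b"
  then obtain x l where z: "x \<in> X" "l \<in> fst b" "z = (snd c x, snd b l)" by auto
  have "coord_map (prod_chart c b) d h (snd (prod_chart c b) (x, l)) = snd d (h (x, l))"
    by (rule coord_map_apply[OF inj_on_prod_chart[OF c(2) b(2)]]) (use z X in \<open>auto simp: prod_chart_def\<close>)
  moreover have "x \<in> fst c" using z X by blast
  ultimately show "coord_map (prod_chart c b) d h z =
    snd d (h (inv_into (fst c) (snd c) (fst z), inv_into (fst b) (snd b) (snd z)))"
    using z by (simp add: prod_chart_def inv_into_f_f c b)
qed

lemma C_map_prod_slice_differentiable:
  assumes h: "C_map k (prod_atlas A B) (points A \<times> points B) C h"
    and c: "c \<in> A" "inj_on (snd c) (fst c)" and b: "b \<in> B" "inj_on (snd b) (fst b)" and d: "d \<in> C"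
    and X: "X \<subseteq> fst c" "\<And>x l. x \<in> X \<Longrightarrow> l \<in> fst b \<Longrightarrow> h (x, l) \<in> fst d"
    and op: "open (snd c ` X)" "open (snd b ` fst b)" and k: "k \<ge> 1" and x: "x \<in> X" and l: "l \<in> fst b"
  shows "coord_map c d (\<lambda>x. h (x, l)) differentiable at (snd c x)"
proof -
  let ?h = "\<lambda>z. snd d (h (inv_into (fst c) (snd c) (fst z), inv_into (fst b) (snd b) (snd z)))"
  have "?h differentiable at (snd c x, snd b l)"
    by (rule C_on_imp_differentiable[OF C_map_prod_chart[OF h c b d X] k open_Times[OF op]]) (use x l in auto)
  then have D: "(?h has_derivative frechet_derivative ?h (at (snd c x, snd b l))) (at (snd c x, snd b l))"
    by (rule frechet_derivative_worksI)
  have P: "((\<lambda>e. (e, snd b l)) has_derivative (\<lambda>a. (a, 0))) (at (snd c x))"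
    by (rule has_derivative_Pair[OF has_derivative_ident has_derivative_const])
  from has_derivative_compose[OF P D]
  have "((\<lambda>e. snd d (h (inv_into (fst c) (snd c) e, l))) has_derivative
    (\<lambda>a. frechet_derivative ?h (at (snd c x, snd b l)) (a, 0))) (at (snd c x))"
    using l by (simp add: inv_into_f_f b)
  moreover have "coord_map c d (\<lambda>x. h (x, l)) = (\<lambda>e. snd d (h (inv_into (fst c) (snd c) e, l)))"
    by (rule ext) (simp add: coord_map_def)
  ultimately show ?thesis by (simp add: differentiableI)
qed

lemma C_map_space_chart:
  fixes T :: "'m \<Rightarrow> 'n::banach"
  assumes "C_map k A S space_atlas T" "c \<in> A"
  shows "C_on k (snd c ` (fst c \<inter> S)) (\<lambda>e. T (inv_into (fst c) (snd c) e))"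
proof -
  have "(UNIV, \<lambda>x :: 'n. x) \<in> space_atlas" by (simp add: space_atlas_def)
  then have "C_on k (snd c ` (fst c \<inter> S \<inter> T -` fst (UNIV, \<lambda>x :: 'n. x))) (coord_map c (UNIV, \<lambda>x :: 'n. x) T)"
    using assms unfolding C_map_def by blast
  moreover have "coord_map c (UNIV, \<lambda>x :: 'n. x) T = (\<lambda>e. T (inv_into (fst c) (snd c) e))"
    by (rule ext) (simp add: coord_map_def)
  ultimately show ?thesis by simp
qed

section \<open>Morphisms and fibers in trivializations\<close>

lemma vb_morphism_rep:
  assumes "vb_morphism k A B B' h" "t \<in> trivs B" "t' \<in> trivs B'"
  obtains T where "C_map k A (fst t \<inter> fst t') space_atlas T"
    "\<And>x v. x \<in> fst t \<inter> fst t' \<Longrightarrow> v \<in> fib B x \<Longrightarrow> snd t' x (h x v) = blinfun_apply (T x) (snd t x v)"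
  using assms(1)[unfolded vb_morphism_def, THEN conjunct2, THEN bspec, OF assms(2), THEN bspec, OF assms(3)]
  by (elim exE conjE) (rule that, assumption, blast)

lemma vb_morphism_in: "vb_morphism k A B B' h \<Longrightarrow> x \<in> points A \<Longrightarrow> v \<in> fib B x \<Longrightarrow> h x v \<in> fib B' x"
  unfolding vb_morphism_def by blast

text \<open>\<open>Blinfun\<close> is meaningful for bounded linear maps only; membership in the
  fiber supplies this.\<close>

lemma Lin_bundle_rep:
  assumes "h \<in> fib (Lin_bundle B B') x" "t \<in> trivs_at B x" "t' \<in> trivs_at B' x"
  shows "blinfun_apply (Blinfun (fib_rep B x t x t' h)) a = snd t' x (h (inv_into (fib B x) (snd t x) a))"
proof -
  have "fib_bounded_linear B x B' x h" using assms(1) by (simp add: Lin_bundle_def)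
  then have "bounded_linear (fib_rep B x t x t' h)"
    using assms(2,3) unfolding fib_bounded_linear_def by blast
  then show ?thesis by (simp add: bounded_linear_Blinfun_apply) (simp add: fib_rep_def)
qed

lemma Lin_bundle_triv:
  "t \<in> trivs B \<Longrightarrow> t' \<in> trivs B' \<Longrightarrow>
     (fst t \<inter> fst t', \<lambda>x h. Blinfun (fib_rep B x t x t' h)) \<in> trivs (Lin_bundle B B')"
  unfolding Lin_bundle_def by (simp only: vbundle.simps) blast

lemma Lin_bundle_in: "h \<in> fib (Lin_bundle B B') x \<Longrightarrow> v \<in> fib B x \<Longrightarrow> h v \<in> fib B' x"
  by (auto simp: Lin_bundle_def fib_bounded_linear_def)

lemma Lin_bundle_eqI:
  assumes "h \<in> fib (Lin_bundle B B') x" "h' \<in> fib (Lin_bundle B B') x" "\<And>v. v \<in> fib B x \<Longrightarrow> h v = h' v"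
  shows "h = h'"
  using assms by (intro extensionalityI[of h "fib B x"]) (auto simp: Lin_bundle_def)

lemma tangent_bundle_simps [simp]:
  "fib (tangent_bundle A) = tangent A" "c \<in> A \<Longrightarrow> (fst c, \<lambda>x v. v c) \<in> trivs (tangent_bundle A)"
  unfolding tangent_bundle_def by (simp_all only: vbundle.simps) blast

lemma tangent_bundle_triv_at: "c \<in> charts_at A p \<Longrightarrow> (fst c, \<lambda>x v. v c) \<in> trivs_at (tangent_bundle A) p"
  by (simp add: trivs_at_def charts_at_def)

lemma real_bundle_triv: "(points A, \<lambda>x r. r) \<in> trivs (real_bundle A)"
  by (simp add: real_bundle_def)

lemma vector_bundle_bij:
  "vector_bundle k A B \<Longrightarrow> t \<in> trivs_at B x \<Longrightarrow> bij_betw (snd t x) (fib B x) UNIV"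
  unfolding vector_bundle_def trivs_at_def by blast

lemma vector_bundle_inv:
  assumes "vector_bundle k A B" "t \<in> trivs_at B x"
  shows "inv_into (fib B x) (snd t x) a \<in> fib B x" "snd t x (inv_into (fib B x) (snd t x) a) = a"
    and "v \<in> fib B x \<Longrightarrow> inv_into (fib B x) (snd t x) (snd t x v) = v"
  using vector_bundle_bij[OF assms]
  by (auto simp: bij_betw_def inv_into_into f_inv_into_f)

lemma vector_bundle_openin: "vector_bundle k A B \<Longrightarrow> t \<in> trivs B \<Longrightarrow> openin (mtop A) (fst t)"
  unfolding vector_bundle_def by blast

text \<open>Transition maps are linear, so a vector that vanishes in one trivialization vanishes in
  all; this makes the description in \<open>fib_zero\<close> one of a unique vector.\<close>

lemma fib_zero_iff:
  assumes B: "vector_bundle k A B" and t: "t \<in> trivs_at B x" and v: "v \<in> fib B x"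
  shows "v = fib_zero B x \<longleftrightarrow> snd t x v = 0"
proof -
  let ?z = "inv_into (fib B x) (snd t x) 0"
  note inv = vector_bundle_inv[OF B t]
  have "fib_zero B x = ?z"
    unfolding fib_zero_def
  proof (rule the_equality)
    have "snd t' x ?z = 0" if t': "t' \<in> trivs_at B x" for t'
    proof -
      have "vb_morphism k A B B (\<lambda>x v. v)" using B unfolding vector_bundle_def by blast
      then obtain T where "\<And>x v. x \<in> fst t \<inter> fst t' \<Longrightarrow> v \<in> fib B x \<Longrightarrow> snd t' x v = blinfun_apply (T x) (snd t x v)"
        using t t' unfolding trivs_at_def by (elim CollectE conjE) (rule vb_morphism_rep, assumption+, rule that)
      from this[of x ?z] show ?thesis using t t' inv by (simp add: trivs_at_def blinfun.zero_right)
    qed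
    then show "?z \<in> fib B x \<and> (\<forall>t\<in>trivs_at B x. snd t x ?z = 0)" using inv by blast
    show "v = ?z" if "v \<in> fib B x \<and> (\<forall>t\<in>trivs_at B x. snd t x v = 0)" for v
      using that t inv(3)[of v] by auto
  qed
  then show ?thesis using inv(2)[of 0] inv(3)[OF v] by metis
qed

text \<open>Links positivity in (D3), which is stated with \<open>fib_zero\<close>, to nonzero
  coordinate vectors.\<close>

lemma fib_zero_tangent:
  assumes man: "manifold k A" and k: "k \<ge> 1" and c: "c \<in> charts_at A p"
  shows "fib_zero (tangent_bundle A) p = tangent_vec A p c 0"
  unfolding fib_zero_def
proof (rule the_equality)
  note tv = tangent_vec[OF man k c]
  have "tangent_vec A p c 0 d = 0" if "d \<in> charts_at A p" for d
    using that linear_0[OF linear_frechet_derivative[OF chart_change_differentiable[OF man k c that]]]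
    by (simp add: tangent_vec_def)
  then show "tangent_vec A p c 0 \<in> fib (tangent_bundle A) p \<and>
    (\<forall>t\<in>trivs_at (tangent_bundle A) p. snd t p (tangent_vec A p c 0) = 0)"
    using tv(1)[of 0] by (auto simp: trivs_at_def tangent_bundle_def charts_at_def)
  show "v = tangent_vec A p c 0"
    if v: "v \<in> fib (tangent_bundle A) p \<and> (\<forall>t\<in>trivs_at (tangent_bundle A) p. snd t p v = 0)" for v
  proof (rule tangent_eqI[OF _ tv(1) c])
    show "v \<in> tangent A p" using v by simp
    have "snd (fst c, \<lambda>x v. v c) p v = 0"
      using v tangent_bundle_triv_at[OF c] by blast
    then show "v c = tangent_vec A p c 0 c" by (simp add: tv)
  qed
qed

lemma charts_at_space [simp]: "charts_at space_atlas r = {(UNIV, \<lambda>x. x)}"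
  by (auto simp: charts_at_def space_atlas_def)

lemma charts_at_total_chart:
  "c \<in> charts_at A x \<Longrightarrow> t \<in> trivs_at B x \<Longrightarrow> v \<in> fib B x \<Longrightarrow> total_chart B c t \<in> charts_at (total_atlas A B) (x, v)"
proof -
  assume a: "c \<in> charts_at A x" "t \<in> trivs_at B x" "v \<in> fib B x"
  then have "total_chart B c t \<in> total_atlas A B"
    unfolding charts_at_def trivs_at_def total_atlas_def by blast
  with a show ?thesis by (auto simp: charts_at_def trivs_at_def total_chart_def)
qed

section \<open>The equivariant problem\<close>

text \<open>Fixes, besides the data, one extension \<open>s\<close> as in (F2) and one chart or
  trivialization at each base point: \<open>c0\<close> and \<open>b0\<close> at the critical point,
  \<open>a0\<close> at the unit of \<open>G\<close>, \<open>t0\<close> and \<open>y0\<close> for the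
  bundles.\<close>

locale equivariant_setting =
  fixes k :: nat
    and M :: "('m, 'e::banach) atlas"
    and Lam :: "('l, 'p::banach) atlas"
    and G :: "('g, 'z) monoid_scheme"
    and AG :: "('g, 'h::banach) atlas"
    and act :: "'g \<Rightarrow> 'm \<Rightarrow> 'm"
    and f :: "'m \<times> 'l \<Rightarrow> real"
    and M' :: "'m set"
    and E :: "('m, 'u, 'f::banach) vbundle"
    and i :: "'m \<Rightarrow> (('m, 'e) chart \<Rightarrow> 'e) \<Rightarrow> 'u"
    and j :: "'m \<Rightarrow> 'u \<Rightarrow> (('m, 'e) chart \<Rightarrow> 'e) \<Rightarrow> real"
    and \<delta>f :: "'m \<times> 'l \<Rightarrow> 'u"
    and Y :: "('m, 'w, 'y::banach) vbundle"
    and j' :: "'m \<Rightarrow> 'u \<Rightarrow> 'w \<Rightarrow> real"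
    and \<kappa> :: "'m \<Rightarrow> (('m, 'e) chart \<Rightarrow> 'e) \<Rightarrow> 'w"
    and s :: "'m \<Rightarrow> (('g, 'h) chart \<Rightarrow> 'h) \<Rightarrow> 'w"
    and x0 :: 'm and l0 :: 'l
    and L :: "(('m, 'e) chart \<Rightarrow> 'e) \<Rightarrow> 'u"
    and c0 :: "('m, 'e) chart" and b0 :: "('l, 'p) chart" and a0 :: "('g, 'h) chart"
    and t0 :: "('m, 'u, 'f) triv" and y0 :: "('m, 'w, 'y) triv"
  assumes k: "k \<ge> 1"
    and A1: "manifold (Suc k) M" "manifold (Suc k) Lam"
    and A2: "lie_group G AG" "continuous_action G AG M act"
    and A3: "C_map (Suc k) (prod_atlas M Lam) (points M \<times> points Lam) space_atlas f"
      "\<forall>g\<in>carrier G. \<forall>x\<in>points M. \<forall>l\<in>points Lam. f (act g x, l) = f (x, l)"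
    and B: "M' \<subseteq> points M" "mtop M closure_of M' = points M"
      "\<forall>x\<in>M'. mdifferentiable_at AG M (\<lambda>g. act g x) \<one>\<^bsub>G\<^esub>"
    and C: "\<forall>l\<in>points Lam. \<forall>g\<in>carrier G. \<forall>x\<in>points M.
        critical M f x l \<longrightarrow> critical M f (act g x) l"
    and D1: "vector_bundle k M E"
    and D2: "vb_morphism k M (tangent_bundle M) E i"
      "vb_morphism k M E (dual_bundle M (tangent_bundle M)) j"
      "\<forall>x\<in>points M. inj_on (j x) (fib E x)"
    and D3: "\<forall>x\<in>points M. \<forall>u\<in>tangent M x. \<forall>v\<in>tangent M x. j x (i x u) v = j x (i x v) u"
      "\<forall>x\<in>points M. \<forall>u\<in>tangent M x. u \<noteq> fib_zero (tangent_bundle M) x \<longrightarrow> j x (i x u) u > 0"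
    and D4: "\<forall>x\<in>points M. \<forall>l\<in>points Lam. \<delta>f (x, l) \<in> fib E x"
      "C_map k (prod_atlas M Lam) (points M \<times> points Lam) (total_atlas M E)
         (\<lambda>(x, l). (x, \<delta>f (x, l)))"
      "\<forall>x\<in>points M. \<forall>l\<in>points Lam. j x (\<delta>f (x, l)) = partial1 M f x l"
    and F: "vector_bundle k M Y"
      "vb_morphism k M E (dual_bundle M Y) j'"
      "vb_morphism k M (tangent_bundle M) Y \<kappa>"
    and F1: "\<forall>x\<in>points M. \<forall>e\<in>fib E x. fib_adjoint (tangent_bundle M) \<kappa> x (j' x e) = j x e"
    and F2: "\<forall>x\<in>points M. s x \<in> fib (Lin_bundle (const_bundle M (tangent_bundle AG) \<one>\<^bsub>G\<^esub>) Y) x"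
      "continuous_map (mtop M)
         (mtop (total_atlas M (Lin_bundle (const_bundle M (tangent_bundle AG) \<one>\<^bsub>G\<^esub>) Y))) (\<lambda>x. (x, s x))"
      "\<forall>x\<in>M'. \<forall>v\<in>tangent AG \<one>\<^bsub>G\<^esub>. s x v = \<kappa> x (orbit_deriv G AG M act x v)"
    and base: "x0 \<in> M'" "l0 \<in> points Lam"
    and crit: "critical M f x0 l0"
    and L: "L = (\<lambda>v. vert_proj M E x0
        (mderiv M (total_atlas M E) (\<lambda>x. (x, \<delta>f (x, l0))) x0 v))"
    and G1: "fib_fredholm (tangent_bundle M) x0 E x0 0 L"
    and G2: "{v \<in> tangent M x0. L v = fib_zero E x0} =
        orbit_deriv G AG M act x0 ` tangent AG \<one>\<^bsub>G\<^esub>"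
    and at: "c0 \<in> charts_at M x0" "b0 \<in> charts_at Lam l0" "a0 \<in> charts_at AG \<one>\<^bsub>G\<^esub>"
      "t0 \<in> trivs_at E x0" "y0 \<in> trivs_at Y x0"
begin

section \<open>Coordinates at the base points\<close>

definition "chi = inv_into (fst c0) (snd c0)"
definition "bi = inv_into (fst b0) (snd b0)"
definition "D = fst c0 \<inter> fst t0 \<inter> fst y0"
definition "U = snd c0 ` D"
definition "W = snd b0 ` fst b0"
text \<open>The fiber component of the section in a bundle chart; its base component is the identity
  and is dropped.\<close>

definition "\<Phi> = (\<lambda>z. snd t0 (chi (fst z)) (\<delta>f (chi (fst z), bi (snd z))))"

sublocale group_action G "points M" act
  using A2(2) unfolding continuous_action_def by blast

sublocale G: group G
  using A2(1) unfolding lie_group_def by blast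

lemma manAG: "manifold n AG"
  using A2(1) unfolding lie_group_def by blast

lemma sk: "Suc k \<ge> 1" by simp

lemma at_mem: "c0 \<in> M" "x0 \<in> fst c0" "b0 \<in> Lam" "l0 \<in> fst b0" "a0 \<in> AG" "\<one>\<^bsub>G\<^esub> \<in> fst a0"
  "t0 \<in> trivs E" "x0 \<in> fst t0" "y0 \<in> trivs Y" "x0 \<in> fst y0"
  using at by (auto simp: charts_at_def trivs_at_def)

lemma x0_D: "x0 \<in> D" using at_mem by (simp add: D_def)

lemma D_mem:
  assumes "x \<in> D"
  shows "x \<in> points M" "x \<in> fst c0" "x \<in> fst t0" "x \<in> fst y0"
    "c0 \<in> charts_at M x" "t0 \<in> trivs_at E x" "y0 \<in> trivs_at Y x"
  using assms at_mem by (auto simp: D_def points_def charts_at_def trivs_at_def)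

lemma Lam_points: "l \<in> fst b0 \<Longrightarrow> l \<in> points Lam"
  using at_mem by (auto simp: points_def)

lemmas inj_c0 = manifoldD(1)[OF A1(1) at_mem(1)]
lemmas inj_b0 = manifoldD(1)[OF A1(2) at_mem(3)]

lemma chi [simp]: "x \<in> fst c0 \<Longrightarrow> chi (snd c0 x) = x"
  by (simp add: chi_def inv_into_f_f inj_c0)

lemma bi [simp]: "l \<in> fst b0 \<Longrightarrow> bi (snd b0 l) = l"
  by (simp add: bi_def inv_into_f_f inj_b0)

lemma U_E:
  assumes "e \<in> U"
  shows "chi e \<in> D" "snd c0 (chi e) = e"
  using assms by (auto simp: U_def D_def)

lemma openin_D: "openin (mtop M) D"
  unfolding D_def
  by (intro openin_Int openin_mtop_domain at_mem vector_bundle_openin[OF D1] vector_bundle_openin[OF F(1)])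

lemma open_U: "open U"
proof -
  have "fst c0 \<inter> D = D" by (auto simp: D_def)
  then show ?thesis using open_chart_image[OF A1(1) at_mem(1) openin_D] by (simp add: U_def)
qed

lemma open_W: "open W"
  unfolding W_def by (rule manifoldD(2)[OF A1(2) at_mem(3)])

lemma \<Phi>_C: "C_on k (U \<times> W) \<Phi>"
proof -
  have tc: "total_chart E c0 t0 \<in> total_atlas M E"
    using at_mem unfolding total_atlas_def by blast
  have X: "(\<lambda>(x, l). (x, \<delta>f (x, l))) (x, l) \<in> fst (total_chart E c0 t0)" if "x \<in> D" "l \<in> fst b0" for x l
    using D_mem[OF that(1)] Lam_points[OF that(2)] D4(1) by (simp add: total_chart_def)
  have "D \<subseteq> fst c0" by (auto simp: D_def)
  from C_on_bounded_linear[OF bounded_linear_snd C_map_prod_chart[OF D4(2) at_mem(1) inj_c0 at_mem(3) inj_b0 tc this X]]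
  show ?thesis by (simp add: \<Phi>_def U_def W_def chi_def bi_def total_chart_def)
qed

lemma f_differentiable:
  assumes c: "c \<in> charts_at M x" and l: "l \<in> points Lam"
  shows "coord_map c (UNIV, \<lambda>r. r) (\<lambda>y. f (y, l)) differentiable at (snd c x)"
proof -
  obtain b where b: "b \<in> Lam" "l \<in> fst b" using l by (auto simp: points_def)
  have cM: "c \<in> M" "x \<in> fst c" using c by (auto simp: charts_at_def)
  show ?thesis
    by (rule C_map_prod_slice_differentiable[OF A3(1) cM(1) manifoldD(1)[OF A1(1) cM(1)] b(1)
          manifoldD(1)[OF A1(2) b(1)] _ order_refl _ manifoldD(2)[OF A1(1) cM(1)] manifoldD(2)[OF A1(2) b(1)]
          sk cM(2) b(2)]) (simp_all add: space_atlas_def)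
qed

lemma partial1_eq:
  assumes c: "c \<in> charts_at M x" and l: "l \<in> points Lam" and v: "v \<in> tangent M x"
  shows "partial1 M f x l v = frechet_derivative (coord_map c (UNIV, \<lambda>r. r) (\<lambda>y. f (y, l))) (at (snd c x)) (v c)"
proof -
  have "(UNIV, \<lambda>r. r) \<in> charts_at space_atlas (f (x, l))" by simp
  from mderiv_eq[where f = "\<lambda>y. f (y, l)", OF A1(1) sk c this f_differentiable[OF _ l] v]
  show ?thesis using v by (simp add: partial1_def)
qed

section \<open>Orbit maps and the invariance of \<open>f\<close>\<close>

lemma act_one: "x \<in> points M \<Longrightarrow> act \<one>\<^bsub>G\<^esub> x = x"
  using id_eq_one by (metis restrict_apply')

lemma orbit_tangent:
  assumes x: "x \<in> M'" and w: "w \<in> tangent AG \<one>\<^bsub>G\<^esub>"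
  shows "orbit_deriv G AG M act x w \<in> tangent M x"
  using mderiv_in_tangent[OF manAG[of 1] A1(1) order_refl sk B(3)[THEN bspec, OF x] w at(3)] act_one x B(1)
  by (auto simp: orbit_deriv_def)

lemma orbit_deriv_eq:
  assumes x: "x \<in> M'" and w: "w \<in> tangent AG \<one>\<^bsub>G\<^esub>" and c: "c \<in> charts_at M x"
  shows "orbit_deriv G AG M act x w c = frechet_derivative (coord_map a0 c (\<lambda>g. act g x)) (at (snd a0 \<one>\<^bsub>G\<^esub>)) (w a0)"
proof -
  have c': "c \<in> charts_at M (act \<one>\<^bsub>G\<^esub> x)" using c act_one x B(1) by auto
  have "coord_map a c (\<lambda>g. act g x) differentiable at (snd a \<one>\<^bsub>G\<^esub>)" if "a \<in> charts_at AG \<one>\<^bsub>G\<^esub>" for a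
    using B(3) x that c' unfolding mdifferentiable_at_def by blast
  from mderiv_eq[where f = "\<lambda>g. act g x", OF manAG[of 1] order_refl at(3) c' this w]
  show ?thesis by (simp add: orbit_deriv_def)
qed

text \<open>\<open>f\<close> is constant along the orbit map, which for points of \<open>M'\<close>
  is differentiable at 1; near 1 the orbit stays in one chart, and the chain rule applies.\<close>

lemma partial1_orbit:
  assumes x: "x \<in> M'" and w: "w \<in> tangent AG \<one>\<^bsub>G\<^esub>" and l: "l \<in> points Lam"
  shows "partial1 M f x l (orbit_deriv G AG M act x w) = 0"
proof -
  have xM: "x \<in> points M" using x B(1) by blast
  then obtain c where "c \<in> M" "x \<in> fst c" by (auto simp: points_def)
  then have c: "c \<in> charts_at M x" and c': "c \<in> charts_at M (act \<one>\<^bsub>G\<^esub> x)"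
    by (simp_all add: charts_at_def act_one xM)
  have md: "mdifferentiable_at AG M (\<lambda>g. act g x) \<one>\<^bsub>G\<^esub>" using B(3) x by blast
  let ?\<beta> = "coord_map a0 c (\<lambda>g. act g x)" and ?F = "coord_map c (UNIV, \<lambda>r. r) (\<lambda>y. f (y, l))"
  let ?p = "snd a0 \<one>\<^bsub>G\<^esub>"
  note inj_a0 = manifoldD(1)[OF manAG at_mem(5)]
  have "?\<beta> differentiable at ?p"
    using md at(3) c' unfolding mdifferentiable_at_def by blast
  then have 1: "(?\<beta> has_derivative frechet_derivative ?\<beta> (at ?p)) (at ?p)" by (rule frechet_derivative_worksI)
  have \<beta>p: "?\<beta> ?p = snd c x"
    by (simp add: coord_map_apply[OF inj_a0 at_mem(6)] act_one xM)
  have 2: "(?F has_derivative frechet_derivative ?F (at (snd c x))) (at (?\<beta> ?p))"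
    unfolding \<beta>p by (rule frechet_derivative_worksI[OF f_differentiable[OF c l]])
  obtain S where S: "open S" "?p \<in> S" "S \<subseteq> snd a0 ` fst a0" "\<And>g. g \<in> fst a0 \<Longrightarrow> snd a0 g \<in> S \<Longrightarrow> act g x \<in> fst c"
    by (rule mdifferentiable_coord_open[where B = M and f = "\<lambda>g. act g x", OF manAG[of 1] at(3) c'
          md[unfolded mdifferentiable_at_def, THEN conjunct1]]) (rule that)
  have 3: "((\<lambda>e. ?F (?\<beta> e)) has_derivative (\<lambda>h. 0)) (at ?p)"
  proof (rule has_derivative_transform_within_open[OF has_derivative_const[of "f (x, l)"] S(1,2)])
    fix e assume e: "e \<in> S"
    then obtain g where g: "g \<in> fst a0" "e = snd a0 g" using S(3) by blast
    have gx: "act g x \<in> fst c" using S(4)[OF g(1)] e g(2) by simp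
    have "g \<in> carrier G" using A2(1) g(1) at_mem(5) unfolding lie_group_def by (auto simp: points_def)
    then have "f (act g x, l) = f (x, l)" using A3(2) xM l by blast
    then show "f (x, l) = ?F (?\<beta> e)"
      using coord_map_apply[OF manifoldD(1)[OF A1(1) \<open>c \<in> M\<close>] gx, of "(UNIV, \<lambda>r. r)" "\<lambda>y. f (y, l)"]
      by (simp add: g(2) coord_map_apply[OF inj_a0 g(1)])
  qed
  have "frechet_derivative ?F (at (snd c x)) (frechet_derivative ?\<beta> (at ?p) h) = 0" for h
    using has_derivative_unique[OF has_derivative_compose[OF 1 2] 3] by (simp add: fun_eq_iff)
  then show ?thesis
    by (simp add: partial1_eq[OF c l orbit_tangent[OF x w]] orbit_deriv_eq[OF x w c])
qed

lemma j'_\<kappa>: "x \<in> points M \<Longrightarrow> e \<in> fib E x \<Longrightarrow> v \<in> tangent M x \<Longrightarrow> j' x e (\<kappa> x v) = j x e v"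
  using F1[THEN bspec, THEN bspec, of x e] by (auto simp: fib_adjoint_def fun_eq_iff split: if_splits)

text \<open>On \<open>M'\<close> the section \<open>s\<close> is \<open>\<kappa>\<close> of an orbit
  direction, so (F1) and (D4) turn the left-hand side into a derivative of \<open>f\<close> along
  the orbit.\<close>

lemma annihilates:
  assumes x: "x \<in> M'" and w: "w \<in> tangent AG \<one>\<^bsub>G\<^esub>" and l: "l \<in> points Lam"
  shows "j' x (\<delta>f (x, l)) (s x w) = 0"
proof -
  have xM: "x \<in> points M" using x B(1) by blast
  have "j' x (\<delta>f (x, l)) (s x w) = j x (\<delta>f (x, l)) (orbit_deriv G AG M act x w)"
    using F2(3) x w j'_\<kappa>[OF xM _ orbit_tangent[OF x w]] D4(1) xM l by simp
  then show ?thesis using D4(3) xM l partial1_orbit[OF x w l] by simp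
qed

section \<open>The bundle morphisms in the chosen trivializations\<close>

lemma J'_rep:
  obtains J' :: "'m \<Rightarrow> 'f \<Rightarrow>\<^sub>L 'y \<Rightarrow>\<^sub>L real" where "continuous_on U (\<lambda>e. J' (chi e))"
    "\<And>x v \<eta>. x \<in> D \<Longrightarrow> v \<in> fib E x \<Longrightarrow> \<eta> \<in> fib Y x \<Longrightarrow> J' x (snd t0 x v) (snd y0 x \<eta>) = j' x v \<eta>"
proof -
  note tr = Lin_bundle_triv[OF at_mem(9) real_bundle_triv[of M]]
  obtain T :: "'m \<Rightarrow> 'f \<Rightarrow>\<^sub>L 'y \<Rightarrow>\<^sub>L real" where
    T: "C_map k M (fst t0 \<inter> (fst y0 \<inter> points M)) space_atlas T"
    "\<And>x v. x \<in> fst t0 \<inter> (fst y0 \<inter> points M) \<Longrightarrow> v \<in> fib E x \<Longrightarrow>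
      Blinfun (fib_rep Y x y0 x (points M, \<lambda>x r. r) (j' x v)) = T x (snd t0 x v)"
    by (rule vb_morphism_rep[OF F(2)[unfolded dual_bundle_def] at_mem(7) tr, unfolded fst_conv snd_conv]) (rule that)
  show thesis
  proof
    have "U \<subseteq> snd c0 ` (fst c0 \<inter> (fst t0 \<inter> (fst y0 \<inter> points M)))"
      using D_mem by (auto simp: U_def)
    from continuous_on_subset[OF C_on_continuous[OF C_map_space_chart[OF T(1) at_mem(1)]] this]
    show "continuous_on U (\<lambda>e. T (chi e))" by (simp add: chi_def)
    fix x v \<eta> assume x: "x \<in> D" and v: "v \<in> fib E x" and \<eta>: "\<eta> \<in> fib Y x"
    have jv: "j' x v \<in> fib (Lin_bundle Y (real_bundle M)) x"
      using vb_morphism_in[OF F(2) D_mem(1)[OF x] v] by (simp add: dual_bundle_def)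
    have rt: "(points M, \<lambda>x r. r) \<in> trivs_at (real_bundle M) x"
      using D_mem(1)[OF x] by (simp add: trivs_at_def real_bundle_def)
    have "T x (snd t0 x v) = Blinfun (fib_rep Y x y0 x (points M, \<lambda>x r. r) (j' x v))"
      using T(2)[of x v] D_mem[OF x] v by simp
    then show "T x (snd t0 x v) (snd y0 x \<eta>) = j' x v \<eta>"
      using Lin_bundle_rep[OF jv D_mem(7)[OF x] rt, of "snd y0 x \<eta>"]
        vector_bundle_inv(3)[OF F(1) D_mem(7)[OF x] \<eta>] by simp
  qed
qed

lemma inv_tangent_c0: "x \<in> D \<Longrightarrow> inv_into (tangent M x) (\<lambda>v. v c0) a = tangent_vec M x c0 a"
  by (rule inv_into_tangent[OF A1(1) sk D_mem(5)])

lemmas tvec = tangent_vec[OF A1(1) sk D_mem(5)]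

lemma tvec_c0: "x \<in> D \<Longrightarrow> u \<in> tangent M x \<Longrightarrow> tangent_vec M x c0 (u c0) = u"
  by (rule tangent_eqI[OF tvec(1) _ D_mem(5)]) (simp_all add: tvec)

lemma J_rep:
  obtains J :: "'m \<Rightarrow> 'f \<Rightarrow>\<^sub>L 'e \<Rightarrow>\<^sub>L real" where
    "\<And>x v u. x \<in> D \<Longrightarrow> v \<in> fib E x \<Longrightarrow> u \<in> tangent M x \<Longrightarrow> J x (snd t0 x v) (u c0) = j x v u"
proof -
  note tr = Lin_bundle_triv[OF tangent_bundle_simps(2)[OF at_mem(1)] real_bundle_triv[of M]]
  obtain T :: "'m \<Rightarrow> 'f \<Rightarrow>\<^sub>L 'e \<Rightarrow>\<^sub>L real" where
    T: "\<And>x v. x \<in> fst t0 \<inter> (fst c0 \<inter> points M) \<Longrightarrow> v \<in> fib E x \<Longrightarrow>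
      Blinfun (fib_rep (tangent_bundle M) x (fst c0, \<lambda>x v. v c0) x (points M, \<lambda>x r. r) (j x v)) = T x (snd t0 x v)"
    by (rule vb_morphism_rep[OF D2(2)[unfolded dual_bundle_def] at_mem(7) tr, unfolded fst_conv snd_conv]) (rule that)
  show thesis
  proof
    fix x v u assume x: "x \<in> D" and v: "v \<in> fib E x" and u: "u \<in> tangent M x"
    have jv: "j x v \<in> fib (Lin_bundle (tangent_bundle M) (real_bundle M)) x"
      using vb_morphism_in[OF D2(2) D_mem(1)[OF x] v] by (simp add: dual_bundle_def)
    have rt: "(points M, \<lambda>x r. r) \<in> trivs_at (real_bundle M) x"
      using D_mem(1)[OF x] by (simp add: trivs_at_def real_bundle_def)
    have "T x (snd t0 x v) = Blinfun (fib_rep (tangent_bundle M) x (fst c0, \<lambda>x v. v c0) x (points M, \<lambda>x r. r) (j x v))"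
      using T[of x v] D_mem[OF x] v by simp
    then show "T x (snd t0 x v) (u c0) = j x v u"
      using Lin_bundle_rep[OF jv tangent_bundle_triv_at[OF D_mem(5)[OF x]] rt, of "u c0"] x u
      by (simp add: inv_tangent_c0 tvec_c0)
  qed
qed

lemma I_rep:
  obtains I :: "'m \<Rightarrow> 'e \<Rightarrow>\<^sub>L 'f" where
    "\<And>x u. x \<in> D \<Longrightarrow> u \<in> tangent M x \<Longrightarrow> snd t0 x (i x u) = I x (u c0)"
proof -
  obtain T :: "'m \<Rightarrow> 'e \<Rightarrow>\<^sub>L 'f" where
    "\<And>x v. x \<in> fst c0 \<inter> fst t0 \<Longrightarrow> v \<in> tangent M x \<Longrightarrow> snd t0 x (i x v) = T x (v c0)"
    by (rule vb_morphism_rep[OF D2(1) tangent_bundle_simps(2)[OF at_mem(1)] at_mem(7),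
          unfolded fst_conv snd_conv tangent_bundle_simps(1)]) (rule that)
  then show thesis using D_mem(2,3) by (intro that[of T]) simp
qed

lemma i_in: "x \<in> points M \<Longrightarrow> u \<in> tangent M x \<Longrightarrow> i x u \<in> fib E x"
  using vb_morphism_in[OF D2(1)] by simp

lemma const_bundle_triv:
  "(points M, \<lambda>x v. v a0) \<in> trivs (const_bundle M (tangent_bundle AG) \<one>\<^bsub>G\<^esub>)"
proof -
  have "(points M, \<lambda>x. snd (fst a0, \<lambda>x v. v a0) \<one>\<^bsub>G\<^esub>) \<in> trivs (const_bundle M (tangent_bundle AG) \<one>\<^bsub>G\<^esub>)"
    using tangent_bundle_triv_at[OF at(3)] unfolding const_bundle_def vbundle.simps by blast
  then show ?thesis by simp
qed

text \<open>Continuity into the total space, read in the bundle chart over \<open>c0\<close>, is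
  continuity of the representing operator in the operator norm.\<close>

lemma s_rep:
  obtains sl :: "'e \<Rightarrow> 'h \<Rightarrow>\<^sub>L 'y" where "continuous_on U sl"
    "\<And>x w. x \<in> D \<Longrightarrow> w \<in> tangent AG \<one>\<^bsub>G\<^esub> \<Longrightarrow> sl (snd c0 x) (w a0) = snd y0 x (s x w)"
proof -
  let ?C = "const_bundle M (tangent_bundle AG) \<one>\<^bsub>G\<^esub>"
  let ?t = "(points M, \<lambda>x v. v a0) :: ('m, ('g, 'h) chart \<Rightarrow> 'h, 'h) triv"
  let ?\<tau> = "(fst ?t \<inter> fst y0, \<lambda>x h. Blinfun (fib_rep ?C x ?t x y0 h))"
  have \<tau>: "?\<tau> \<in> trivs (Lin_bundle ?C Y)" by (rule Lin_bundle_triv[OF const_bundle_triv at_mem(9)])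
  let ?tc = "total_chart (Lin_bundle ?C Y) c0 ?\<tau>"
  have tc: "?tc \<in> total_atlas M (Lin_bundle ?C Y)" using \<tau> at_mem unfolding total_atlas_def by blast
  have in_tc: "(x, s x) \<in> fst ?tc" if "x \<in> D" for x
    using D_mem[OF that] F2(1) by (simp add: total_chart_def)
  have 1: "continuous_map (subtopology (mtop M) D) (subtopology (mtop (total_atlas M (Lin_bundle ?C Y))) (fst ?tc)) (\<lambda>x. (x, s x))"
    using in_tc by (intro continuous_map_into_subtopology continuous_map_from_subtopology F2(2)) auto
  have "continuous_map (top_of_set U) (mtop M) chi"
    unfolding chi_def
    by (rule continuous_map_from_subtopology_mono[OF continuous_map_chart_inverse[OF A1(1) at_mem(1)]])
      (auto simp: U_def D_def)
  then have 2: "continuous_map (top_of_set U) (subtopology (mtop M) D) chi"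
    using U_E(1) by (intro continuous_map_into_subtopology) auto
  from continuous_map_compose[OF continuous_map_compose[OF 2 1] continuous_map_chart[OF tc]]
  have "continuous_on U (snd ?tc \<circ> ((\<lambda>x. (x, s x)) \<circ> chi))" by simp
  then have cont: "continuous_on U (\<lambda>e. snd (snd ?tc (chi e, s (chi e))))"
    by (intro continuous_on_snd) (simp add: o_def)
  define sl where "sl e = Blinfun (fib_rep ?C (chi e) ?t (chi e) y0 (s (chi e)))" for e
  show thesis
  proof
    show "continuous_on U sl" using cont by (simp add: sl_def total_chart_def)
    fix x w assume x: "x \<in> D" and w: "w \<in> tangent AG \<one>\<^bsub>G\<^esub>"
    have "?t \<in> trivs_at ?C x" using const_bundle_triv D_mem(1)[OF x] by (simp add: trivs_at_def)
    from Lin_bundle_rep[OF F2(1)[THEN bspec, OF D_mem(1)[OF x]] this D_mem(7)[OF x], of "w a0"]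
    have "sl (snd c0 x) (w a0) = snd y0 x (s x (inv_into (tangent AG \<one>\<^bsub>G\<^esub>) (\<lambda>v. v a0) (w a0)))"
      using D_mem(2)[OF x] by (simp add: sl_def) (simp add: const_bundle_def)
    also have "inv_into (tangent AG \<one>\<^bsub>G\<^esub>) (\<lambda>v. v a0) (w a0) = w"
      unfolding inv_into_tangent[OF manAG[of 1] order_refl at(3)]
      by (rule tangent_eqI[OF tangent_vec(1)[OF manAG[of 1] order_refl at(3)] w at(3)])
        (rule tangent_vec(2)[OF manAG[of 1] order_refl at(3)])
    finally show "sl (snd c0 x) (w a0) = snd y0 x (s x w)" .
  qed
qed

text \<open>By (D4) criticality means that \<open>j\<close> kills \<open>\<delta>f\<close>; as
  \<open>j\<close> is linear and injective on fibers, this says that the fiber component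
  vanishes.\<close>

lemma critical_iff:
  assumes x: "x \<in> D" and l: "l \<in> fst b0"
  shows "critical M f x l \<longleftrightarrow> \<Phi> (snd c0 x, snd b0 l) = 0"
proof -
  obtain J :: "'m \<Rightarrow> 'f \<Rightarrow>\<^sub>L 'e \<Rightarrow>\<^sub>L real" where
    J: "\<And>x v u. x \<in> D \<Longrightarrow> v \<in> fib E x \<Longrightarrow> u \<in> tangent M x \<Longrightarrow> J x (snd t0 x v) (u c0) = j x v u"
    by (rule J_rep) (rule that)
  note xM = D_mem(1)[OF x] and lL = Lam_points[OF l]
  have \<delta>: "\<delta>f (x, l) \<in> fib E x" using D4(1) xM lL by blast
  have \<Phi>: "\<Phi> (snd c0 x, snd b0 l) = snd t0 x (\<delta>f (x, l))"
    using D_mem(2)[OF x] l by (simp add: \<Phi>_def)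
  have c: "critical M f x l \<longleftrightarrow> (\<forall>v\<in>tangent M x. j x (\<delta>f (x, l)) v = 0)"
    unfolding critical_def using D4(3) xM lL by simp
  show ?thesis
  proof
    assume "\<Phi> (snd c0 x, snd b0 l) = 0"
    then show "critical M f x l"
      unfolding c using J[OF x \<delta>] by (simp add: \<Phi> blinfun.zero_right blinfun.zero_left)
  next
    assume cr: "critical M f x l"
    let ?z = "inv_into (fib E x) (snd t0 x) 0"
    note z = vector_bundle_inv(1,2)[OF D1 D_mem(6)[OF x], of 0]
    have "j x ?z v = 0" if "v \<in> tangent M x" for v
      using J[OF x z(1) that] by (simp add: z(2) blinfun.zero_right blinfun.zero_left)
    then have "j x (\<delta>f (x, l)) = j x ?z"
      using cr[unfolded c]
      by (intro Lin_bundle_eqI[OF vb_morphism_in[OF D2(2) xM \<delta>, unfolded dual_bundle_def]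
            vb_morphism_in[OF D2(2) xM z(1), unfolded dual_bundle_def]]) simp
    then have "\<delta>f (x, l) = ?z" using D2(3) xM \<delta> z(1) by (auto dest: inj_onD)
    then show "\<Phi> (snd c0 x, snd b0 l) = 0" using z(2) by (simp add: \<Phi>)
  qed
qed

section \<open>The linearization and its kernel in coordinates\<close>

lemma zero_at_base: "\<Phi> (snd c0 x0, snd b0 l0) = 0"
  using critical_iff[OF x0_D at_mem(4)] crit by simp

text \<open>\<open>c\<close> and \<open>t\<close> vary because \<open>vert_proj\<close> quantifies
  over all of them, whereas the domain is always read in \<open>c0\<close>; the vertical component
  then depends on \<open>t\<close> alone.\<close>

lemma vertical_derivative:
  fixes c :: "('m, 'e) chart" and t :: "('m, 'u, 'f) triv"
  assumes c: "c \<in> charts_at M x0" and t: "t \<in> trivs_at E x0" and v: "v \<in> tangent M x0"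
  defines "\<psi> \<equiv> \<lambda>e. snd t (chi e) (\<delta>f (chi e, l0))"
  shows "\<psi> differentiable at (snd c0 x0)"
    and "snd (mderiv M (total_atlas M E) (\<lambda>x. (x, \<delta>f (x, l0))) x0 v (total_chart E c t)) =
      frechet_derivative \<psi> (at (snd c0 x0)) (v c0)"
proof -
  let ?tc = "total_chart E c t" and ?\<zeta> = "\<lambda>x. (x, \<delta>f (x, l0))"
  have mem: "c \<in> M" "x0 \<in> fst c" "t \<in> trivs E" "x0 \<in> fst t" using c t by (auto simp: charts_at_def trivs_at_def)
  have x0M: "x0 \<in> points M" using x0_D D_mem by blast
  have tc: "?tc \<in> total_atlas M E" using mem unfolding total_atlas_def by blast
  have tc_at: "?tc \<in> charts_at (total_atlas M E) (x0, \<delta>f (x0, l0))"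
    by (rule charts_at_total_chart[OF c t]) (use D4(1) x0M base in blast)
  \<comment> \<open>For every chart \<open>c'\<close>, since \<open>mderiv\<close> evaluates in one
    of its own choosing.\<close>
  have diff: "coord_map c' ?tc ?\<zeta> differentiable at (snd c' x0)" if c': "c' \<in> charts_at M x0" for c'
  proof -
    have m': "c' \<in> M" "x0 \<in> fst c'" using c' by (auto simp: charts_at_def)
    have "openin (mtop M) (fst c \<inter> fst t)"
      by (intro openin_Int openin_mtop_domain mem vector_bundle_openin[OF D1])
    then have op: "open (snd c' ` (fst c' \<inter> (fst c \<inter> fst t)))" by (rule open_chart_image[OF A1(1) m'(1)])
    have X: "(\<lambda>(x, l). (x, \<delta>f (x, l))) (x, l) \<in> fst ?tc" if "x \<in> fst c' \<inter> (fst c \<inter> fst t)" "l \<in> fst b0" for x l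
    proof -
      have "x \<in> points M" using that(1) m'(1) by (auto simp: points_def)
      then show ?thesis using that D4(1) Lam_points[OF that(2)] by (simp add: total_chart_def)
    qed
    have "coord_map c' ?tc (\<lambda>x. (\<lambda>(x, l). (x, \<delta>f (x, l))) (x, l0)) differentiable at (snd c' x0)"
      by (rule C_map_prod_slice_differentiable[OF D4(2) m'(1) manifoldD(1)[OF A1(1) m'(1)] at_mem(3) inj_b0 tc
            Int_lower1 X op manifoldD(2)[OF A1(2) at_mem(3)] k _ at_mem(4)]) (use m' mem in simp_all)
    then show ?thesis by simp
  qed
  have \<psi>: "\<psi> = (\<lambda>e. snd (coord_map c0 ?tc ?\<zeta> e))"
    by (rule ext) (simp add: \<psi>_def coord_map_def total_chart_def chi_def)
  have "(\<psi> has_derivative (\<lambda>a. snd (frechet_derivative (coord_map c0 ?tc ?\<zeta>) (at (snd c0 x0)) a))) (at (snd c0 x0))"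
    unfolding \<psi> by (rule bounded_linear.has_derivative[OF bounded_linear_snd frechet_derivative_worksI[OF diff[OF at(1)]]])
  then show "\<psi> differentiable at (snd c0 x0)"
    "snd (mderiv M (total_atlas M E) ?\<zeta> x0 v ?tc) = frechet_derivative \<psi> (at (snd c0 x0)) (v c0)"
    using mderiv_eq[where f = ?\<zeta>, OF A1(1) sk at(1) tc_at diff v]
    by (simp_all add: frechet_derivative_eqI differentiableI)
qed

definition "L' = Blinfun (frechet_derivative (\<lambda>e. \<Phi> (e, snd b0 l0)) (at (snd c0 x0)))"

lemma \<Phi>_slice: "(\<lambda>e. \<Phi> (e, snd b0 l0)) = (\<lambda>e. snd t0 (chi e) (\<delta>f (chi e, l0)))"
  using at_mem(4) by (simp add: \<Phi>_def)

lemma has_derivative_L': "((\<lambda>e. \<Phi> (e, snd b0 l0)) has_derivative L') (at (snd c0 x0))"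
proof -
  have "((\<lambda>e. \<Phi> (e, snd b0 l0)) has_derivative frechet_derivative (\<lambda>e. \<Phi> (e, snd b0 l0)) (at (snd c0 x0))) (at (snd c0 x0))"
    unfolding \<Phi>_slice
    by (rule frechet_derivative_worksI[OF vertical_derivative(1)[OF at(1) at(4) tvec(1)[OF x0_D]]])
  then show ?thesis
    unfolding L'_def by (simp add: bounded_linear_Blinfun_apply has_derivative_bounded_linear)
qed

text \<open>Where the section vanishes, its derivatives in two trivializations differ by the transition
  map; this identifies \<open>vert_proj\<close> there.\<close>

lemma L_rep:
  assumes v: "v \<in> tangent M x0"
  shows "L v \<in> fib E x0" "snd t0 x0 (L v) = L' (v c0)"
proof -
  let ?w = "mderiv M (total_atlas M E) (\<lambda>x. (x, \<delta>f (x, l0))) x0 v"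
  let ?\<psi> = "\<lambda>t e. snd t (chi e) (\<delta>f (chi e, l0))"
  let ?e = "snd c0 x0"
  note inv = vector_bundle_inv[OF D1 at(4)]
  \<comment> \<open>The only candidate for the vertical projection, determined by its component in
    \<open>t0\<close>; the other trivializations have to agree with it.\<close>
  let ?u = "inv_into (fib E x0) (snd t0 x0) (L' (v c0))"
  have "snd t x0 ?u = snd (?w (total_chart E c t))" if c: "c \<in> charts_at M x0" and t: "t \<in> trivs_at E x0" for c t
  proof -
    have tE: "t \<in> trivs E" "x0 \<in> fst t" using t by (auto simp: trivs_at_def)
    have "vb_morphism k M E E (\<lambda>x v. v)" using D1 unfolding vector_bundle_def by blast
    then obtain T where T: "C_map k M (fst t0 \<inter> fst t) space_atlas T"
      "\<And>x v. x \<in> fst t0 \<inter> fst t \<Longrightarrow> v \<in> fib E x \<Longrightarrow> snd t x v = blinfun_apply (T x) (snd t0 x v)"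
      by (rule vb_morphism_rep[OF _ at_mem(7) tE(1)]) (rule that)
    define S where "S = snd c0 ` (fst c0 \<inter> (fst t0 \<inter> fst t))"
    have S: "open S" "?e \<in> S"
      using open_chart_image[OF A1(1) at_mem(1), of "fst t0 \<inter> fst t"] at_mem tE
        vector_bundle_openin[OF D1 at_mem(7)] vector_bundle_openin[OF D1 tE(1)]
      by (auto simp: S_def)
    have "continuous_on S (\<lambda>e. T (chi e))"
      using C_on_continuous[OF C_map_space_chart[OF T(1) at_mem(1)]] by (simp add: S_def chi_def)
    then have cT: "isCont (\<lambda>e. T (chi e)) ?e" using S by (simp add: continuous_on_eq_continuous_at)
    have "((\<lambda>e. blinfun_apply (T (chi e)) (\<Phi> (e, snd b0 l0))) has_derivative (\<lambda>a. blinfun_apply (T (chi ?e)) (L' a))) (at ?e)"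
      by (rule bounded_bilinear_has_derivative_right[OF bounded_bilinear_blinfun_apply cT has_derivative_L' zero_at_base])
    then have "(?\<psi> t has_derivative (\<lambda>a. blinfun_apply (T (chi ?e)) (L' a))) (at ?e)"
    proof (rule has_derivative_transform_within_open[OF _ S])
      fix e assume "e \<in> S"
      then obtain x where x: "x \<in> fst c0" "x \<in> fst t0 \<inter> fst t" "e = snd c0 x" by (auto simp: S_def)
      have "x \<in> points M" using x(1) at_mem(1) by (auto simp: points_def)
      then have "\<delta>f (x, l0) \<in> fib E x" using D4(1) base by blast
      then show "blinfun_apply (T (chi e)) (\<Phi> (e, snd b0 l0)) = ?\<psi> t e"
        using T(2)[OF x(2)] x at_mem(4) by (simp add: \<Phi>_def)
    qed
    from frechet_derivative_eqI[OF this]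
    have "snd (?w (total_chart E c t)) = blinfun_apply (T x0) (L' (v c0))"
      using vertical_derivative(2)[OF c t v] at_mem(2) by simp
    also have "\<dots> = snd t x0 ?u" using T(2)[of x0 ?u] at_mem(8) tE inv by simp
    finally show ?thesis by simp
  qed
  then have "L v = ?u"
    unfolding L vert_proj_def
  proof (intro the_equality)
    fix u assume u: "u \<in> fib E x0 \<and> (\<forall>c\<in>charts_at M x0. \<forall>t\<in>trivs_at E x0. snd t x0 u = snd (?w (total_chart E c t)))"
    assume *: "\<And>c t. c \<in> charts_at M x0 \<Longrightarrow> t \<in> trivs_at E x0 \<Longrightarrow> snd t x0 ?u = snd (?w (total_chart E c t))"
    have "snd t0 x0 u = snd t0 x0 ?u" using u *[OF at(1,4)] at(1,4) by simp
    then show "u = ?u" using inv(3)[of u] inv(2) u by metis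
  qed (use inv in blast)
  then show "L v \<in> fib E x0" "snd t0 x0 (L v) = L' (v c0)" using inv by simp_all
qed

definition "\<beta> = frechet_derivative (coord_map a0 c0 (\<lambda>g. act g x0)) (at (snd a0 \<one>\<^bsub>G\<^esub>))"

lemma has_derivative_\<beta>:
  "(coord_map a0 c0 (\<lambda>g. act g x0) has_derivative \<beta>) (at (snd a0 \<one>\<^bsub>G\<^esub>))"
proof -
  have "x0 \<in> points M" using x0_D D_mem by blast
  then have "c0 \<in> charts_at M (act \<one>\<^bsub>G\<^esub> x0)" using at(1) act_one by simp
  then have "coord_map a0 c0 (\<lambda>g. act g x0) differentiable at (snd a0 \<one>\<^bsub>G\<^esub>)"
    using B(3) base(1) at(3) unfolding mdifferentiable_at_def by blast
  then show ?thesis unfolding \<beta>_def by (rule frechet_derivative_worksI)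
qed

lemma orbit_deriv_\<beta>: "w \<in> tangent AG \<one>\<^bsub>G\<^esub> \<Longrightarrow> orbit_deriv G AG M act x0 w c0 = \<beta> (w a0)"
  unfolding \<beta>_def by (rule orbit_deriv_eq[OF base(1) _ at(1)])

lemmas tvecG = tangent_vec[OF manAG[of 1] order_refl at(3)]

lemma range_\<beta>: "range \<beta> = {v. L' v = 0}"
proof -
  have zero: "L v = fib_zero E x0 \<longleftrightarrow> L' (v c0) = 0" if "v \<in> tangent M x0" for v
    using fib_zero_iff[OF D1 at(4) L_rep(1)[OF that]] L_rep(2)[OF that] by simp
  show ?thesis
  proof (intro equalityI subsetI)
    fix a assume "a \<in> range \<beta>"
    then obtain h where "a = \<beta> h" by blast
    then have a: "a = orbit_deriv G AG M act x0 (tangent_vec AG \<one>\<^bsub>G\<^esub> a0 h) c0"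
      by (simp add: orbit_deriv_\<beta> tvecG)
    have "orbit_deriv G AG M act x0 (tangent_vec AG \<one>\<^bsub>G\<^esub> a0 h) \<in> {v \<in> tangent M x0. L v = fib_zero E x0}"
      unfolding G2 using tvecG(1) by blast
    then show "a \<in> {v. L' v = 0}" using zero a by auto
  next
    fix a assume "a \<in> {v. L' v = 0}"
    then have "tangent_vec M x0 c0 a \<in> {v \<in> tangent M x0. L v = fib_zero E x0}"
      using zero tvec[OF x0_D] by simp
    then obtain w where w: "w \<in> tangent AG \<one>\<^bsub>G\<^esub>" "tangent_vec M x0 c0 a = orbit_deriv G AG M act x0 w"
      unfolding G2 by blast
    have "a = tangent_vec M x0 c0 a c0" by (simp add: tvec[OF x0_D])
    also have "\<dots> = \<beta> (w a0)" unfolding w(2) by (rule orbit_deriv_\<beta>[OF w(1)])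
    finally show "a \<in> range \<beta>" by simp
  qed
qed

lemma local_problem:
  fixes R :: "'n::euclidean_space \<Rightarrow> 'h"
  assumes R: "linear R" "surj R"
  obtains J I J' sl where "degenerate_zero k \<Phi> U W (snd c0 x0) (snd b0 l0) L' J I
    (J' :: 'e \<Rightarrow> 'f \<Rightarrow>\<^sub>L 'y \<Rightarrow>\<^sub>L real) sl \<beta> R"
proof -
  obtain J' :: "'m \<Rightarrow> 'f \<Rightarrow>\<^sub>L 'y \<Rightarrow>\<^sub>L real" where J': "continuous_on U (\<lambda>e. J' (chi e))"
    "\<And>x v \<eta>. x \<in> D \<Longrightarrow> v \<in> fib E x \<Longrightarrow> \<eta> \<in> fib Y x \<Longrightarrow> J' x (snd t0 x v) (snd y0 x \<eta>) = j' x v \<eta>"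
    by (rule J'_rep) (rule that)
  obtain J :: "'m \<Rightarrow> 'f \<Rightarrow>\<^sub>L 'e \<Rightarrow>\<^sub>L real" where
    J: "\<And>x v u. x \<in> D \<Longrightarrow> v \<in> fib E x \<Longrightarrow> u \<in> tangent M x \<Longrightarrow> J x (snd t0 x v) (u c0) = j x v u"
    by (rule J_rep) (rule that)
  obtain I :: "'m \<Rightarrow> 'e \<Rightarrow>\<^sub>L 'f" where
    I: "\<And>x u. x \<in> D \<Longrightarrow> u \<in> tangent M x \<Longrightarrow> snd t0 x (i x u) = I x (u c0)"
    by (rule I_rep) (rule that)
  obtain sl :: "'e \<Rightarrow> 'h \<Rightarrow>\<^sub>L 'y" where sl: "continuous_on U sl"
    "\<And>x w. x \<in> D \<Longrightarrow> w \<in> tangent AG \<one>\<^bsub>G\<^esub> \<Longrightarrow> sl (snd c0 x) (w a0) = snd y0 x (s x w)"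
    by (rule s_rep) (rule that)
  have x0M: "x0 \<in> points M" using x0_D D_mem by blast
  have s_in: "s x w \<in> fib Y x" if "x \<in> points M" "w \<in> tangent AG \<one>\<^bsub>G\<^esub>" for x w
    using Lin_bundle_in[OF F2(1)[THEN bspec, OF that(1)], of w] that(2) by (simp add: const_bundle_def)
  have JI: "J x0 (I x0 u) v = j x0 (i x0 (tangent_vec M x0 c0 u)) (tangent_vec M x0 c0 v)" for u v
    using J[OF x0_D i_in[OF x0M tvec(1)[OF x0_D]] tvec(1)[OF x0_D], of u v] I[OF x0_D tvec(1)[OF x0_D], of u]
    by (simp add: tvec[OF x0_D])
  \<comment> \<open>If the relation failed at some point, it would fail on an open set, which meets
    the dense set \<open>M'\<close>.\<close>
  have ann: "J' (chi e) (\<Phi> (e, p)) (sl e h) = 0" if ep: "e \<in> U" "p \<in> W" for e p h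
  proof (rule ccontr)
    assume neq: "J' (chi e) (\<Phi> (e, p)) (sl e h) \<noteq> 0"
    have "continuous_on U (\<lambda>e. \<Phi> (e, p))"
      by (rule continuous_on_compose2[OF C_on_continuous[OF \<Phi>_C]]) (use ep(2) in \<open>auto intro: continuous_intros\<close>)
    then have "continuous_on U (\<lambda>e. J' (chi e) (\<Phi> (e, p)) (sl e h))"
      by (rule bounded_bilinear.continuous_on[OF bounded_bilinear_blinfun_apply
            bounded_bilinear.continuous_on[OF bounded_bilinear_blinfun_apply J'(1)]
            bounded_linear.continuous_on[OF blinfun.bounded_linear_left sl(1)]])
    then have op: "open (U \<inter> (\<lambda>e. J' (chi e) (\<Phi> (e, p)) (sl e h)) -` (- {0}))"
      by (rule continuous_open_preimage[OF _ open_U]) auto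
    define V where "V = fst c0 \<inter> snd c0 -` (U \<inter> (\<lambda>e. J' (chi e) (\<Phi> (e, p)) (sl e h)) -` (- {0}))"
    have "openin (mtop M) V" unfolding V_def by (rule openin_mtop_chart[OF at_mem(1) op])
    moreover have "chi e \<in> V" using U_E[OF ep(1)] ep(1) neq D_mem(2) by (simp add: V_def)
    moreover have "chi e \<in> mtop M closure_of M'" using B(2) U_E(1)[OF ep(1)] D_mem by blast
    ultimately obtain x where x: "x \<in> M'" "x \<in> V" by (auto simp: in_closure_of)
    have xc: "x \<in> fst c0" using x(2) by (simp add: V_def)
    have "snd c0 x \<in> U" using x(2) by (simp add: V_def)
    then have xD: "x \<in> D" using U_E(1)[of "snd c0 x"] xc by simp
    obtain l where l: "l \<in> fst b0" "p = snd b0 l" using ep(2) by (auto simp: W_def)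
    let ?w = "tangent_vec AG \<one>\<^bsub>G\<^esub> a0 h"
    have "J' x (\<Phi> (snd c0 x, p)) (sl (snd c0 x) h) = j' x (\<delta>f (x, l)) (s x ?w)"
    proof -
      have "\<Phi> (snd c0 x, p) = snd t0 x (\<delta>f (x, l))" using xc l by (simp add: \<Phi>_def)
      moreover have "sl (snd c0 x) h = snd y0 x (s x ?w)" using sl(2)[OF xD tvecG(1), of h] by (simp add: tvecG)
      moreover have "\<delta>f (x, l) \<in> fib E x" using D4(1) D_mem(1)[OF xD] Lam_points[OF l(1)] by blast
      ultimately show ?thesis using J'(2)[OF xD _ s_in[OF D_mem(1)[OF xD] tvecG(1)]] by simp
    qed
    also have "\<dots> = 0" by (rule annihilates[OF x(1) tvecG(1) Lam_points[OF l(1)]])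
    finally show False using x(2) xc by (simp add: V_def)
  qed
  \<comment> \<open>As \<open>x0\<close> lies in \<open>M'\<close>, the extension \<open>s\<close>
    comes from the actual orbit derivative there, and (F1) replaces \<open>j'\<close> by
    \<open>j\<close>.\<close>
  have J'_base: "J' (chi (snd c0 x0)) \<epsilon> (sl (snd c0 x0) h) = J x0 \<epsilon> (\<beta> h)" for \<epsilon> h
  proof -
    let ?w = "tangent_vec AG \<one>\<^bsub>G\<^esub> a0 h" and ?v = "inv_into (fib E x0) (snd t0 x0) \<epsilon>"
    note inv = vector_bundle_inv(1,2)[OF D1 at(4), of \<epsilon>]
    have "J' x0 (snd t0 x0 ?v) (snd y0 x0 (s x0 ?w)) = j' x0 ?v (s x0 ?w)"
      by (rule J'(2)[OF x0_D inv(1) s_in[OF x0M tvecG(1)]])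
    also have "\<dots> = j x0 ?v (orbit_deriv G AG M act x0 ?w)"
      using F2(3) base(1) tvecG(1) j'_\<kappa>[OF x0M inv(1) orbit_tangent[OF base(1) tvecG(1)]] by simp
    also have "\<dots> = J x0 (snd t0 x0 ?v) (orbit_deriv G AG M act x0 ?w c0)"
      by (rule J[OF x0_D inv(1) orbit_tangent[OF base(1) tvecG(1)], symmetric])
    finally show ?thesis
      using sl(2)[OF x0_D tvecG(1), of h] at_mem(2) by (simp add: inv tvecG orbit_deriv_\<beta>)
  qed
  have fib_rep_L: "fib_rep (tangent_bundle M) x0 (fst c0, \<lambda>x v. v c0) x0 t0 L = blinfun_apply L'"
    by (rule ext) (simp add: fib_rep_def inv_tangent_c0[OF x0_D] L_rep(2)[OF tvec(1)[OF x0_D]] tvec[OF x0_D])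
  have fred: "fredholm L'" "fredholm_index L' = 0"
    using G1[unfolded fib_fredholm_def, THEN conjunct2, THEN bspec, OF tangent_bundle_triv_at[OF at(1)],
        THEN bspec, OF at(4)] unfolding fib_rep_L by simp_all
  have "degenerate_zero k \<Phi> U W (snd c0 x0) (snd b0 l0) L' (J x0) (I x0) (\<lambda>e. J' (chi e)) sl \<beta> R"
  proof (rule degenerate_zero.intro)
    show "k \<ge> 1" "open U" "open W" by (rule k open_U open_W)+
    show "snd c0 x0 \<in> U" "snd b0 l0 \<in> W" using x0_D at_mem by (auto simp: U_def W_def)
    show "C_on k (U \<times> W) \<Phi>" by (rule \<Phi>_C)
    show "\<Phi> (snd c0 x0, snd b0 l0) = 0" by (rule zero_at_base)
    show "((\<lambda>x. \<Phi> (x, snd b0 l0)) has_derivative blinfun_apply L') (at (snd c0 x0))" by (rule has_derivative_L')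
    show "fredholm L'" "fredholm_index L' = 0" by (fact fred)+
    show "J x0 (I x0 u) v = J x0 (I x0 v) u" for u v
      unfolding JI using D3(1) x0M tvec(1)[OF x0_D] by blast
    show "J x0 (I x0 u) u > 0" if "u \<noteq> 0" for u
    proof -
      have "tangent_vec M x0 c0 u \<noteq> fib_zero (tangent_bundle M) x0"
        unfolding fib_zero_tangent[OF A1(1) sk at(1)] using that tvec(2)[OF x0_D] by metis
      then show ?thesis unfolding JI using D3(2) x0M tvec(1)[OF x0_D] by blast
    qed
    show "continuous_on U (\<lambda>e. J' (chi e))" "continuous_on U sl" by (rule J' sl)+
    show "J' (chi x) (\<Phi> (x, l)) (sl x w) = 0" if "x \<in> U" "l \<in> W" for x l w by (rule ann[OF that])
    show "J' (chi (snd c0 x0)) e (sl (snd c0 x0) w) = J x0 e (\<beta> w)" for e w by (rule J'_base)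
    show "linear \<beta>" using has_derivative_\<beta> by (rule has_derivative_linear)
    show "range \<beta> = {v. L' v = 0}" by (rule range_\<beta>)
    show "linear R" "surj R" by (fact R)+
  qed
  then show thesis by (rule that)
qed

section \<open>Moving points into the slice by the group\<close>

lemma carrier_points: "carrier G = points AG"
  using A2(1) unfolding lie_group_def by blast

lemma a0_carrier: "g \<in> fst a0 \<Longrightarrow> g \<in> carrier G"
  using at_mem(5) by (auto simp: carrier_points points_def)

lemma continuous_act: "continuous_map (prod_topology (mtop AG) (mtop M)) (mtop M) (\<lambda>(g, x). act g x)"
  using A2(2) unfolding continuous_action_def by blast

lemma continuous_act_left:
  assumes "g \<in> carrier G"
  shows "continuous_map (mtop M) (mtop M) (act g)"
proof -
  have "continuous_map (mtop M) (prod_topology (mtop AG) (mtop M)) (\<lambda>x. (g, x))"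
    using assms by (intro continuous_map_pairedI) (simp_all add: carrier_points)
  from continuous_map_compose[OF this continuous_act] show ?thesis by (simp add: o_def)
qed

lemma continuous_chi: "continuous_map (top_of_set (snd c0 ` fst c0)) (mtop M) chi"
  unfolding chi_def by (rule continuous_map_chart_inverse[OF A1(1) at_mem(1)])

lemma act_inv:
  assumes "g \<in> carrier G" "x \<in> points M"
  shows "act g x \<in> points M" "act (inv\<^bsub>G\<^esub> g) (act g x) = x"
  using element_image[OF assms refl] orbit_sym_aux[OF assms refl] by simp_all

text \<open>Group elements near 1 are parametrized by \<open>r \<mapsto> ai (p + R r)\<close>. In
  this parameter the orbit map of \<open>x0\<close> has derivative \<open>\<beta>\<close> after
  \<open>R\<close>, so the hypothesis on \<open>Q\<close> is the one that the fixed point argument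
  needs.\<close>

lemma slice:
  fixes R :: "'n::euclidean_space \<Rightarrow> 'h" and Q :: "'e \<Rightarrow> 'n"
  assumes R: "linear R" and Q: "bounded_linear Q" "\<And>v. Q (\<beta> (R (Q v))) = Q v"
    and N2: "open N2" "snd c0 x0 \<in> N2"
  obtains N1 where "open N1" "snd c0 x0 \<in> N1" "N1 \<subseteq> U"
    "\<And>x. x \<in> D \<Longrightarrow> snd c0 x \<in> N1 \<Longrightarrow>
       \<exists>g\<in>carrier G. act g x \<in> D \<and> snd c0 (act g x) \<in> N2 \<and> Q (snd c0 (act g x) - snd c0 x0) = 0"
proof -
  define ai where "ai = inv_into (fst a0) (snd a0)"
  define p where "p = snd a0 \<one>\<^bsub>G\<^esub>"
  note inj_a0 = manifoldD(1)[OF manAG at_mem(5)]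
  have aip: "ai p = \<one>\<^bsub>G\<^esub>" by (simp add: ai_def p_def inv_into_f_f[OF inj_a0] at_mem)
  have blR: "bounded_linear R" using R by (simp add: linear_conv_bounded_linear)
  have contR: "continuous_on S (\<lambda>r. p + R r)" for S
    by (intro continuous_intros linear_continuous_on blR)
  define A where "A = (\<lambda>r. p + R r) -` (snd a0 ` fst a0)"
  have "open A" unfolding A_def by (rule open_vimage[OF manifoldD(2)[OF manAG at_mem(5)] contR])
  have x0M: "x0 \<in> points M" using x0_D D_mem by blast
  define \<alpha> where "\<alpha> z = act (ai (p + R (snd z))) (chi (fst z))" for z
  have UA: "open (U \<times> A)" using open_U \<open>open A\<close> by (rule open_Times)
  have "continuous_map (top_of_set (U \<times> A)) (mtop AG) (\<lambda>z. ai (p + R (snd z)))"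
  proof -
    have "continuous_map (top_of_set (U \<times> A)) (top_of_set (snd a0 ` fst a0)) (\<lambda>z. p + R (snd z))"
    proof (rule continuous_map_into_subtopology)
      have "continuous_on (U \<times> A) (\<lambda>z. p + R (snd z))"
        by (rule continuous_on_compose2[OF contR[of UNIV] continuous_on_snd[OF continuous_on_id]]) simp
      then show "continuous_map (top_of_set (U \<times> A)) euclidean (\<lambda>z. p + R (snd z))" by simp
    qed (auto simp: A_def)
    from continuous_map_compose[OF this continuous_map_chart_inverse[OF manAG at_mem(5)]]
    show ?thesis by (simp add: o_def ai_def)
  qed
  moreover have "continuous_map (top_of_set (U \<times> A)) (mtop M) (\<lambda>z. chi (fst z))"
  proof -
    have "continuous_map (top_of_set (U \<times> A)) (top_of_set (snd c0 ` fst c0)) fst"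
      by (intro continuous_map_into_subtopology) (auto simp: U_def D_def intro!: continuous_intros)
    from continuous_map_compose[OF this continuous_chi] show ?thesis by (simp add: o_def)
  qed
  ultimately have "continuous_map (top_of_set (U \<times> A)) (prod_topology (mtop AG) (mtop M))
    (\<lambda>z. (ai (p + R (snd z)), chi (fst z)))"
    by (rule continuous_map_pairedI)
  from continuous_map_compose[OF this continuous_act]
  have cont: "continuous_map (top_of_set (U \<times> A)) (mtop M) \<alpha>" by (simp add: o_def \<alpha>_def[abs_def])
  \<comment> \<open>Where the moved point stays within the coordinates; a product neighbourhood
    inside it separates the conditions on the point from those on the parameter.\<close>
  define \<Omega> where "\<Omega> = {z \<in> U \<times> A. \<alpha> z \<in> D}"
  have "openin (top_of_set (U \<times> A)) \<Omega>"
    using openin_continuous_map_preimage[OF cont openin_D] by (simp add: \<Omega>_def)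
  then have "open \<Omega>" using UA by (simp add: openin_open_eq)
  moreover have "(snd c0 x0, 0) \<in> \<Omega>"
    using x0_D at_mem aip linear_0[OF R] act_one[OF x0M]
    by (auto simp: \<Omega>_def \<alpha>_def A_def U_def p_def)
  ultimately obtain O1 O2 where O12: "open O1" "open O2" "(snd c0 x0, 0) \<in> O1 \<times> O2" "O1 \<times> O2 \<subseteq> \<Omega>"
    by (rule open_prod_elim)
  have "continuous_map (top_of_set (O1 \<times> O2)) (subtopology (mtop M) (fst c0)) \<alpha>"
  proof (rule continuous_map_into_subtopology)
    show "continuous_map (top_of_set (O1 \<times> O2)) (mtop M) \<alpha>"
      by (rule continuous_map_from_subtopology_mono[OF cont]) (use O12(4) in \<open>auto simp: \<Omega>_def\<close>)
  qed (use O12(4) in \<open>auto simp: \<Omega>_def D_def\<close>)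
  from continuous_map_compose[OF this continuous_map_chart[OF at_mem(1)]]
  have "continuous_on (O1 \<times> O2) (\<lambda>z. snd c0 (\<alpha> z))" by (simp add: o_def)
  then have cont_y: "continuous_on (O1 \<times> O2) (\<lambda>(e, r). snd c0 (\<alpha> (e, r)))"
    by (simp add: split_beta')
  have y_eq: "snd c0 (\<alpha> (snd c0 x0, r)) = coord_map a0 c0 (\<lambda>g. act g x0) (p + R r)" for r
    using at_mem(2) by (simp add: \<alpha>_def coord_map_def ai_def)
  have "((\<lambda>r. p + R r) has_derivative R) (at 0)"
    using has_derivative_add[OF has_derivative_const[of p] bounded_linear_imp_has_derivative[OF blR]] by simp
  moreover have "p + R 0 = p" by (simp add: linear_0[OF R])
  ultimately have der: "((\<lambda>r. snd c0 (\<alpha> (snd c0 x0, r))) has_derivative (\<lambda>r. \<beta> (R r))) (at 0)"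
    unfolding y_eq using has_derivative_compose[of "\<lambda>r. p + R r" R 0 UNIV "coord_map a0 c0 (\<lambda>g. act g x0)" \<beta>]
      has_derivative_\<beta> by (simp add: p_def)
  have y0: "snd c0 (\<alpha> (snd c0 x0, 0)) = snd c0 x0"
    using at_mem(2) aip act_one[OF x0M] by (simp add: \<alpha>_def linear_0[OF R])
  have O0: "snd c0 x0 \<in> O1" "0 \<in> O2" using O12(3) by simp_all
  obtain N1 where N1: "open N1" "snd c0 x0 \<in> N1" "N1 \<subseteq> O1"
    "\<And>e. e \<in> N1 \<Longrightarrow> \<exists>r\<in>O2. snd c0 (\<alpha> (e, r)) \<in> N2 \<and> Q (snd c0 (\<alpha> (e, r)) - snd c0 x0) = 0"
    by (rule brouwer_slice[of O1 "snd c0 x0" O2 "\<lambda>e r. snd c0 (\<alpha> (e, r))" "\<lambda>r. \<beta> (R r)" Q N2,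
          OF O12(1) O0(1) O12(2) O0(2) cont_y der y0 Q N2]) (rule that)
  show thesis
  proof (rule that[OF N1(1,2)])
    show "N1 \<subseteq> U" using N1(3) O12(4) O0(2) by (auto simp: \<Omega>_def)
    fix x assume x: "x \<in> D" "snd c0 x \<in> N1"
    obtain r where r: "r \<in> O2" "snd c0 (\<alpha> (snd c0 x, r)) \<in> N2" "Q (snd c0 (\<alpha> (snd c0 x, r)) - snd c0 x0) = 0"
      using N1(4)[OF x(2)] by blast
    have "(snd c0 x, r) \<in> \<Omega>" using r(1) x(2) N1(3) O12(4) by blast
    then have *: "p + R r \<in> snd a0 ` fst a0" "\<alpha> (snd c0 x, r) \<in> D" by (simp_all add: \<Omega>_def A_def)
    have "ai (p + R r) \<in> carrier G"
      unfolding ai_def by (rule a0_carrier[OF inv_into_into[OF *(1)]])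
    moreover have "\<alpha> (snd c0 x, r) = act (ai (p + R r)) x"
      using D_mem(2)[OF x(1)] by (simp add: \<alpha>_def)
    ultimately show "\<exists>g\<in>carrier G. act g x \<in> D \<and> snd c0 (act g x) \<in> N2 \<and> Q (snd c0 (act g x) - snd c0 x0) = 0"
      using r *(2) by (intro bexI[of _ "ai (p + R r)"]) simp_all
  qed
qed

text \<open>Regularity has to be checked in all charts; \<open>\<sigma>\<close> is composed on both
  sides with changes of charts, which are of class k + 1.\<close>

lemma C_map_from_chart:
  assumes C: "C_on k V \<sigma>" and V: "open V" "\<sigma> ` V \<subseteq> U"
  shows "C_map k Lam (fst b0 \<inter> snd b0 -` V) M (\<lambda>l. chi (\<sigma> (snd b0 l)))"
  unfolding C_map_def
proof (intro conjI ballI)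
  let ?\<Lambda> = "fst b0 \<inter> snd b0 -` V" and ?\<sigma> = "\<lambda>l. chi (\<sigma> (snd b0 l))"
  show "openin (mtop Lam) ?\<Lambda>" by (rule openin_mtop_chart[OF at_mem(3) V(1)])
  have "continuous_map (subtopology (mtop Lam) ?\<Lambda>) euclidean (snd b0)"
    by (rule continuous_map_from_subtopology_mono[OF continuous_map_chart[OF at_mem(3)]]) blast
  then have 1: "continuous_map (subtopology (mtop Lam) ?\<Lambda>) (top_of_set V) (snd b0)"
    by (rule continuous_map_into_subtopology) auto
  have 2: "continuous_map (top_of_set V) (top_of_set (snd c0 ` fst c0)) \<sigma>"
    by (rule continuous_map_into_subtopology) (use C_on_continuous[OF C] V(2) in \<open>auto simp: U_def D_def\<close>)
  from continuous_map_compose[OF continuous_map_compose[OF 1 2] continuous_chi]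
  show "continuous_map (subtopology (mtop Lam) ?\<Lambda>) (mtop M) ?\<sigma>" by (simp add: o_def)
  fix b d assume b: "b \<in> Lam" and d: "d \<in> M"
  let ?S = "snd b ` (fst b \<inter> ?\<Lambda> \<inter> ?\<sigma> -` fst d)"
  note inj_b = manifoldD(1)[OF A1(2) b]
  have tr: "coord_map b b0 (\<lambda>x. x) (snd b l) = snd b0 l" if "l \<in> fst b" for l
    by (rule coord_map_apply[OF inj_b that])
  have C1: "C_on k ?S (coord_map b b0 (\<lambda>x. x))"
    by (rule C_on_le[OF C_on_subset[OF manifoldD(4)[OF A1(2) b at_mem(3)]]]) auto
  have sub1: "coord_map b b0 (\<lambda>x. x) ` ?S \<subseteq> V" by (auto simp: tr)
  have C2: "C_on k ?S (\<lambda>e. \<sigma> (coord_map b b0 (\<lambda>x. x) e))" by (rule C_on_compose[OF C1 C sub1])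
  have sub2: "(\<lambda>e. \<sigma> (coord_map b b0 (\<lambda>x. x) e)) ` ?S \<subseteq> snd c0 ` (fst c0 \<inter> fst d)"
  proof
    fix e assume "e \<in> (\<lambda>e. \<sigma> (coord_map b b0 (\<lambda>x. x) e)) ` ?S"
    then obtain l where l: "l \<in> fst b" "snd b0 l \<in> V" "?\<sigma> l \<in> fst d" "e = \<sigma> (snd b0 l)" by (auto simp: tr)
    have "e \<in> U" using l V(2) by blast
    then have "chi e \<in> fst c0" "snd c0 (chi e) = e" using U_E D_mem by blast+
    then show "e \<in> snd c0 ` (fst c0 \<inter> fst d)" using l by (intro image_eqI[of _ _ "chi e"]) auto
  qed
  have C3: "C_on k (snd c0 ` (fst c0 \<inter> fst d)) (coord_map c0 d (\<lambda>x. x))"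
    by (rule C_on_le[OF manifoldD(4)[OF A1(1) at_mem(1) d]]) simp
  show "C_on k ?S (coord_map b d ?\<sigma>)"
  proof (rule C_on_cong[OF C_on_compose[OF C2 C3 sub2]])
    fix e assume "e \<in> ?S"
    then obtain l where l: "l \<in> fst b" "e = snd b l" by blast
    show "coord_map c0 d (\<lambda>x. x) (\<sigma> (coord_map b b0 (\<lambda>x. x) e)) = coord_map b d ?\<sigma> e"
      using coord_map_apply[OF inj_b l(1), of d ?\<sigma>] by (simp add: l(2) tr[OF l(1)]) (simp add: coord_map_def chi_def)
  qed
qed

text \<open>The neighbourhood is \<open>X \<times> \<Lambda>\<close>, with \<open>X\<close> the
  saturation of a small neighbourhood \<open>NM\<close> of \<open>x0\<close>; invariance and
  inclusion of the whole orbit come from this form. By (C) a critical point over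
  \<open>\<Lambda>\<close> can be moved into \<open>NM\<close> and on into the slice, where
  uniqueness leaves only \<open>\<tau> l\<close>.\<close>

theorem critical_orbits:
  "\<exists>V \<Lambda>\<^sub>0 \<sigma>.
      openin (prod_topology (mtop M) (mtop Lam)) V \<and>
      orbit G act x0 \<times> {l0} \<subseteq> V \<and>
      (\<forall>g\<in>carrier G. \<forall>(x, l)\<in>V. (act g x, l) \<in> V) \<and>
      openin (mtop Lam) \<Lambda>\<^sub>0 \<and> l0 \<in> \<Lambda>\<^sub>0 \<and>
      C_map k Lam \<Lambda>\<^sub>0 M \<sigma> \<and> \<sigma> l0 = x0 \<and>
      (\<forall>x\<in>points M. \<forall>l\<in>\<Lambda>\<^sub>0.
        (x, l) \<in> V \<and> critical M f x l \<longleftrightarrow> x \<in> orbit G act (\<sigma> l))"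
proof -
  have "\<exists>B::'h set. finite B \<and> span B = UNIV" using A2(1) unfolding lie_group_def by blast
  then obtain R :: "(real, 'h idx) vec \<Rightarrow> 'h" where R: "linear R" "surj R"
    by (rule euclidean_surjection) (rule that)
  obtain J I sl and J' :: "'e \<Rightarrow> 'f \<Rightarrow>\<^sub>L 'y \<Rightarrow>\<^sub>L real" where
    dz: "degenerate_zero k \<Phi> U W (snd c0 x0) (snd b0 l0) L' J I J' sl \<beta> R"
    by (rule local_problem[OF R]) (rule that)
  obtain Q :: "'e \<Rightarrow> (real, 'h idx) vec" and N V1 \<sigma> where Q: "bounded_linear Q" "\<And>v. Q (\<beta> (R (Q v))) = Q v"
    and N: "open N" "(snd c0 x0, snd b0 l0) \<in> N" "N \<subseteq> U \<times> W" and V1: "open V1" "snd b0 l0 \<in> V1"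
    and \<sigma>: "C_on k V1 \<sigma>" "\<sigma> (snd b0 l0) = snd c0 x0" "\<And>p. p \<in> V1 \<Longrightarrow> (\<sigma> p, p) \<in> N \<and> \<Phi> (\<sigma> p, p) = 0"
    and uniq: "\<And>e p. (e, p) \<in> N \<Longrightarrow> p \<in> V1 \<Longrightarrow> \<Phi> (e, p) = 0 \<Longrightarrow> Q (e - snd c0 x0) = 0 \<Longrightarrow> e = \<sigma> p"
    by (rule degenerate_zero.zero_set[OF dz]) (rule that)
  \<comment> \<open>The slice lemma controls the point but not the parameter, so uniqueness is used
    on a product inside \<open>N\<close>.\<close>
  obtain N2 V2 where N2: "open N2" "open V2" "(snd c0 x0, snd b0 l0) \<in> N2 \<times> V2" "N2 \<times> V2 \<subseteq> N"
    by (rule open_prod_elim[OF N(1,2)]) (rule that)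
  have N2x: "snd c0 x0 \<in> N2" using N2(3) by simp
  obtain N1 where N1: "open N1" "snd c0 x0 \<in> N1" "N1 \<subseteq> U"
    and sl: "\<And>x. x \<in> D \<Longrightarrow> snd c0 x \<in> N1 \<Longrightarrow>
       \<exists>g\<in>carrier G. act g x \<in> D \<and> snd c0 (act g x) \<in> N2 \<and> Q (snd c0 (act g x) - snd c0 x0) = 0"
    by (rule slice[OF R(1) Q N2(1) N2x]) (rule that)
  \<comment> \<open>\<open>\<sigma>\<close> has to stay in \<open>N1\<close> for
    \<open>\<tau> l\<close> to lie in \<open>NM\<close>; \<open>V2\<close> makes uniqueness
    applicable to points in the slice.\<close>
  define V0 where "V0 = (V1 \<inter> \<sigma> -` N1) \<inter> V2"
  define \<Lambda> where "\<Lambda> = fst b0 \<inter> snd b0 -` V0"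
  define \<tau> where "\<tau> l = chi (\<sigma> (snd b0 l))" for l
  define NM where "NM = fst c0 \<inter> snd c0 -` N1 \<inter> D"
  define X where "X = {x \<in> points M. \<exists>g\<in>carrier G. act g x \<in> NM}"
  have x0M: "x0 \<in> points M" using x0_D D_mem by blast
  have "open V0"
    unfolding V0_def
    by (intro open_Int continuous_open_preimage[OF C_on_continuous[OF \<sigma>(1)] V1(1) N1(1)] N2(2))
  have C0: "C_on k V0 \<sigma>" by (rule C_on_subset[OF \<sigma>(1)]) (auto simp: V0_def)
  have oN: "openin (mtop M) NM"
    unfolding NM_def by (intro openin_Int openin_D openin_mtop_chart at_mem N1(1))
  have oX: "openin (mtop M) X"
  proof -
    have "X = (\<Union>g\<in>carrier G. {x \<in> topspace (mtop M). act g x \<in> NM})" by (auto simp: X_def)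
    moreover have "openin (mtop M) \<dots>"
      using openin_continuous_map_preimage[OF continuous_act_left oN] by (intro openin_Union) blast
    ultimately show ?thesis by simp
  qed
  have o\<Lambda>: "openin (mtop Lam) \<Lambda>" unfolding \<Lambda>_def by (rule openin_mtop_chart[OF at_mem(3) \<open>open V0\<close>])
  have x0N: "x0 \<in> NM" using x0_D N1(2) at_mem by (simp add: NM_def)
  have l0\<Lambda>: "l0 \<in> \<Lambda>" using at_mem V1(2) N1(2) N2(3) \<sigma>(2) by (simp add: \<Lambda>_def V0_def)
  have cl: "critical M f (act g x) l" if "g \<in> carrier G" "x \<in> points M" "l \<in> \<Lambda>" "critical M f x l" for g x l
    using C that Lam_points by (simp add: \<Lambda>_def)
  have \<tau>: "\<tau> l \<in> NM" "snd c0 (\<tau> l) = \<sigma> (snd b0 l)" "critical M f (\<tau> l) l" if "l \<in> \<Lambda>" for l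
  proof -
    have l: "l \<in> fst b0" "snd b0 l \<in> V1" "\<sigma> (snd b0 l) \<in> N1" using that by (simp_all add: \<Lambda>_def V0_def)
    then have "\<sigma> (snd b0 l) \<in> U" using N1(3) by blast
    from U_E[OF this] have u: "\<tau> l \<in> D" "snd c0 (\<tau> l) = \<sigma> (snd b0 l)" by (simp_all add: \<tau>_def)
    then show "\<tau> l \<in> NM" "snd c0 (\<tau> l) = \<sigma> (snd b0 l)" using l D_mem(2)[OF u(1)] by (simp_all add: NM_def)
    show "critical M f (\<tau> l) l" using critical_iff[OF u(1) l(1)] \<sigma>(3)[OF l(2)] u(2) by simp
  qed
  have NM_D: "x \<in> D" "snd c0 x \<in> N1" "x \<in> points M" if "x \<in> NM" for x
    using that D_mem by (simp_all add: NM_def)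
  have main: "(x, l) \<in> X \<times> \<Lambda> \<and> critical M f x l \<longleftrightarrow> x \<in> orbit G act (\<tau> l)"
    if x: "x \<in> points M" and l: "l \<in> \<Lambda>" for x l
  proof
    assume "x \<in> orbit G act (\<tau> l)"
    then obtain g where g: "g \<in> carrier G" "x = act g (\<tau> l)" by (auto simp: orbit_def)
    note \<tau>M = NM_D(3)[OF \<tau>(1)[OF l]]
    have "act (inv\<^bsub>G\<^esub> g) x \<in> NM" using act_inv(2)[OF g(1) \<tau>M] \<tau>(1)[OF l] g(2) by simp
    then have "x \<in> X" using x g(1) unfolding X_def by blast
    then show "(x, l) \<in> X \<times> \<Lambda> \<and> critical M f x l"
      using l cl[OF g(1) \<tau>M l \<tau>(3)[OF l]] g(2) by simp
  next
    assume "(x, l) \<in> X \<times> \<Lambda> \<and> critical M f x l"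
    then obtain g where g: "g \<in> carrier G" "act g x \<in> NM" and cr: "critical M f x l" by (auto simp: X_def)
    note gx = NM_D[OF g(2)]
    obtain h where h: "h \<in> carrier G" "act h (act g x) \<in> D" "snd c0 (act h (act g x)) \<in> N2"
      "Q (snd c0 (act h (act g x)) - snd c0 x0) = 0"
      using sl[OF gx(1,2)] by blast
    let ?y = "act h (act g x)"
    have lb: "l \<in> fst b0" "snd b0 l \<in> V1" "snd b0 l \<in> V2" using l by (simp_all add: \<Lambda>_def V0_def)
    \<comment> \<open>The point was moved twice, by \<open>g\<close> into \<open>NM\<close> and by
      \<open>h\<close> into the slice; it is still critical, so uniqueness applies.\<close>
    have "critical M f ?y l" by (intro cl h(1) gx(3) l g(1) x cr)
    then have "\<Phi> (snd c0 ?y, snd b0 l) = 0" using critical_iff[OF h(2) lb(1)] by simp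
    then have "snd c0 ?y = \<sigma> (snd b0 l)"
      using h(3,4) N2(4) lb by (intro uniq) auto
    then have "\<tau> l = ?y" using D_mem(2)[OF h(2)] by (simp add: \<tau>_def flip: \<open>snd c0 ?y = \<sigma> (snd b0 l)\<close>)
    also have "?y = act (h \<otimes>\<^bsub>G\<^esub> g) x" by (rule composition_rule[OF x h(1) g(1), symmetric])
    finally have "act (inv\<^bsub>G\<^esub> (h \<otimes>\<^bsub>G\<^esub> g)) (\<tau> l) = x"
      using act_inv(2)[OF G.m_closed[OF h(1) g(1)] x] by simp
    then show "x \<in> orbit G act (\<tau> l)"
      using G.inv_closed[OF G.m_closed[OF h(1) g(1)]] unfolding orbit_def by blast
  qed
  show ?thesis
  proof (intro exI conjI ballI)
    show "openin (prod_topology (mtop M) (mtop Lam)) (X \<times> \<Lambda>)"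
      using oX o\<Lambda> by (simp add: openin_prod_Times_iff)
    show "orbit G act x0 \<times> {l0} \<subseteq> X \<times> \<Lambda>"
    proof -
      have "act g x0 \<in> X" if "g \<in> carrier G" for g
        using act_inv[OF that x0M] x0N G.inv_closed[OF that] unfolding X_def by force
      then show ?thesis using l0\<Lambda> by (auto simp: orbit_def)
    qed
    show "case z of (x, l) \<Rightarrow> (act g x, l) \<in> X \<times> \<Lambda>" if g: "g \<in> carrier G" and z: "z \<in> X \<times> \<Lambda>" for g z
    proof -
      obtain x l h where xl: "z = (x, l)" "x \<in> points M" "l \<in> \<Lambda>" "h \<in> carrier G" "act h x \<in> NM"
        using z by (auto simp: X_def)
      have "act (h \<otimes>\<^bsub>G\<^esub> inv\<^bsub>G\<^esub> g) (act g x) = act h x"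
        using composition_rule[OF act_inv(1)[OF g xl(2)] xl(4) G.inv_closed[OF g]] act_inv(2)[OF g xl(2)] by simp
      then have "act g x \<in> X"
        using act_inv(1)[OF g xl(2)] xl(4,5) G.m_closed[OF xl(4) G.inv_closed[OF g]] unfolding X_def by force
      then show ?thesis using xl by simp
    qed
    show "openin (mtop Lam) \<Lambda>" "l0 \<in> \<Lambda>" by (fact o\<Lambda> l0\<Lambda>)+
    show "C_map k Lam \<Lambda> M \<tau>"
      unfolding \<Lambda>_def \<tau>_def
      by (rule C_map_from_chart[OF C0 \<open>open V0\<close>]) (use N1(3) in \<open>auto simp: V0_def\<close>)
    show "\<tau> l0 = x0" using at_mem by (simp add: \<tau>_def \<sigma>(2))
  qed (rule main)
qed

end

theorem theoremA:
  fixes k :: nat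
    and M :: "('m, 'e::banach) atlas"
    and Lam :: "('l, 'p::banach) atlas"
    and G :: "('g, 'z) monoid_scheme"
    and A\<^sub>G :: "('g, 'h::banach) atlas"
    and act :: "'g \<Rightarrow> 'm \<Rightarrow> 'm"
    and f :: "'m \<times> 'l \<Rightarrow> real"
    and M' :: "'m set"
    and E :: "('m, 'u, 'f::banach) vbundle"
    and i :: "'m \<Rightarrow> (('m, 'e) chart \<Rightarrow> 'e) \<Rightarrow> 'u"
    and j :: "'m \<Rightarrow> 'u \<Rightarrow> (('m, 'e) chart \<Rightarrow> 'e) \<Rightarrow> real"
    and \<delta>f :: "'m \<times> 'l \<Rightarrow> 'u"
    and \<phi> :: "'g \<Rightarrow> 'm \<Rightarrow> 'u \<Rightarrow> 'u"
    and Y :: "('m, 'w, 'y::banach) vbundle"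
    and j' :: "'m \<Rightarrow> 'u \<Rightarrow> 'w \<Rightarrow> real"
    and \<kappa> :: "'m \<Rightarrow> (('m, 'e) chart \<Rightarrow> 'e) \<Rightarrow> 'w"
    and x\<^sub>0 :: 'm and l\<^sub>0 :: 'l
    and L :: "(('m, 'e) chart \<Rightarrow> 'e) \<Rightarrow> 'u"
  assumes k: "k \<ge> 1"
    and A1: "manifold (Suc k) M" "manifold (Suc k) Lam"
    and A2: "lie_group G A\<^sub>G" "continuous_action G A\<^sub>G M act"
    and A3: "C_map (Suc k) (prod_atlas M Lam) (points M \<times> points Lam) space_atlas f"
      "\<forall>g\<in>carrier G. \<forall>x\<in>points M. \<forall>l\<in>points Lam. f (act g x, l) = f (x, l)"
    and B: "M' \<subseteq> points M" "mtop M closure_of M' = points M"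
      "\<forall>x\<in>M'. mdifferentiable_at A\<^sub>G M (\<lambda>g. act g x) \<one>\<^bsub>G\<^esub>"
    and C: "\<forall>l\<in>points Lam. \<forall>g\<in>carrier G. \<forall>x\<in>points M.
        critical M f x l \<longrightarrow> critical M f (act g x) l"
    and D1: "vector_bundle k M E"
    and D2: "vb_morphism k M (tangent_bundle M) E i"
      "vb_morphism k M E (dual_bundle M (tangent_bundle M)) j"
      "\<forall>x\<in>points M. inj_on (j x) (fib E x)"
    and D3: "\<forall>x\<in>points M. \<forall>u\<in>tangent M x. \<forall>v\<in>tangent M x. j x (i x u) v = j x (i x v) u"
      "\<forall>x\<in>points M. \<forall>u\<in>tangent M x. u \<noteq> fib_zero (tangent_bundle M) x \<longrightarrow> j x (i x u) u > 0"
    and D4: "\<forall>x\<in>points M. \<forall>l\<in>points Lam. \<delta>f (x, l) \<in> fib E x"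
      "C_map k (prod_atlas M Lam) (points M \<times> points Lam) (total_atlas M E)
         (\<lambda>(x, l). (x, \<delta>f (x, l)))"
      "\<forall>x\<in>points M. \<forall>l\<in>points Lam. j x (\<delta>f (x, l)) = partial1 M f x l"
    and E1: "continuous_bundle_action G A\<^sub>G M act E \<phi>"
    and E2: "\<forall>l\<in>points Lam. \<forall>g\<in>carrier G. \<forall>x\<in>points M. \<delta>f (act g x, l) = \<phi> g x (\<delta>f (x, l))"
    and F: "vector_bundle k M Y"
      "vb_morphism k M E (dual_bundle M Y) j'"
      "vb_morphism k M (tangent_bundle M) Y \<kappa>"
      "\<forall>x\<in>points M. inj_on (\<kappa> x) (tangent M x)"
    and F1: "\<forall>x\<in>points M. \<forall>e\<in>fib E x. fib_adjoint (tangent_bundle M) \<kappa> x (j' x e) = j x e"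
    and F2: "\<exists>s. (\<forall>x\<in>points M.
          s x \<in> fib (Lin_bundle (const_bundle M (tangent_bundle A\<^sub>G) \<one>\<^bsub>G\<^esub>) Y) x) \<and>
        continuous_map (mtop M)
          (mtop (total_atlas M (Lin_bundle (const_bundle M (tangent_bundle A\<^sub>G) \<one>\<^bsub>G\<^esub>) Y)))
          (\<lambda>x. (x, s x)) \<and>
        (\<forall>x\<in>M'. \<forall>v\<in>tangent A\<^sub>G \<one>\<^bsub>G\<^esub>. s x v = \<kappa> x (orbit_deriv G A\<^sub>G M act x v))"
    and base: "x\<^sub>0 \<in> M'" "l\<^sub>0 \<in> points Lam"
    and crit: "critical M f x\<^sub>0 l\<^sub>0"
    and L: "L = (\<lambda>v. vert_proj M E x\<^sub>0
        (mderiv M (total_atlas M E) (\<lambda>x. (x, \<delta>f (x, l\<^sub>0))) x\<^sub>0 v))"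
    and G1: "fib_fredholm (tangent_bundle M) x\<^sub>0 E x\<^sub>0 0 L"
    and G2: "{v \<in> tangent M x\<^sub>0. L v = fib_zero E x\<^sub>0} =
        orbit_deriv G A\<^sub>G M act x\<^sub>0 ` tangent A\<^sub>G \<one>\<^bsub>G\<^esub>"
  shows "\<exists>V \<Lambda>\<^sub>0 \<sigma>.
      openin (prod_topology (mtop M) (mtop Lam)) V \<and>
      orbit G act x\<^sub>0 \<times> {l\<^sub>0} \<subseteq> V \<and>
      (\<forall>g\<in>carrier G. \<forall>(x, l)\<in>V. (act g x, l) \<in> V) \<and>
      openin (mtop Lam) \<Lambda>\<^sub>0 \<and> l\<^sub>0 \<in> \<Lambda>\<^sub>0 \<and>
      C_map k Lam \<Lambda>\<^sub>0 M \<sigma> \<and> \<sigma> l\<^sub>0 = x\<^sub>0 \<and>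
      (\<forall>x\<in>points M. \<forall>l\<in>\<Lambda>\<^sub>0.
        (x, l) \<in> V \<and> critical M f x l \<longleftrightarrow> x \<in> orbit G act (\<sigma> l))"
proof -
  obtain s where s:
    "\<forall>x\<in>points M. s x \<in> fib (Lin_bundle (const_bundle M (tangent_bundle A\<^sub>G) \<one>\<^bsub>G\<^esub>) Y) x"
    "continuous_map (mtop M)
       (mtop (total_atlas M (Lin_bundle (const_bundle M (tangent_bundle A\<^sub>G) \<one>\<^bsub>G\<^esub>) Y))) (\<lambda>x. (x, s x))"
    "\<forall>x\<in>M'. \<forall>v\<in>tangent A\<^sub>G \<one>\<^bsub>G\<^esub>. s x v = \<kappa> x (orbit_deriv G A\<^sub>G M act x v)"
    using F2 by (elim exE conjE) (rule that)
  have x\<^sub>0: "x\<^sub>0 \<in> points M" using B(1) base(1) by blast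
  obtain c0 where c0: "c0 \<in> charts_at M x\<^sub>0" using x\<^sub>0 by (auto simp: points_def charts_at_def)
  obtain b0 where b0: "b0 \<in> charts_at Lam l\<^sub>0" using base(2) by (auto simp: points_def charts_at_def)
  have "\<one>\<^bsub>G\<^esub> \<in> points A\<^sub>G"
    using A2(1) group.is_monoid monoid.one_closed unfolding lie_group_def by metis
  then obtain a0 where a0: "a0 \<in> charts_at A\<^sub>G \<one>\<^bsub>G\<^esub>" by (auto simp: points_def charts_at_def)
  have "x\<^sub>0 \<in> (\<Union>t\<in>trivs E. fst t)" "x\<^sub>0 \<in> (\<Union>t\<in>trivs Y. fst t)"
    using D1 F(1) x\<^sub>0 unfolding vector_bundle_def by simp_all
  then obtain t0 y0 where ty: "t0 \<in> trivs_at E x\<^sub>0" "y0 \<in> trivs_at Y x\<^sub>0"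
    unfolding trivs_at_def by blast
  \<comment> \<open>The conclusion does not mention \<open>s\<close>, the charts or the
    trivializations, so any choice of them will do.\<close>
  interpret equivariant_setting k M Lam G A\<^sub>G act f M' E i j \<delta>f Y j' \<kappa> s x\<^sub>0 l\<^sub>0 L c0 b0 a0 t0 y0
    by (rule equivariant_setting.intro[OF k A1 A2 A3 B C D1 D2 D3 D4 F(1-3) F1 s base crit L G1 G2 c0 b0 a0 ty])
  show ?thesis by (rule critical_orbits)
qed

end
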